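(* Let $u\in C^2(\mathbb{R}^2)$ satisfy $\Delta u=W'(u)$ in $\mathbb{R}^2$, and assume there is a constant $C>0$ such that $\int_{B_R(0)}\frac12|\nabla u|^2+W(u)\le CR$ for all $R>0$. Then the blowing down limit data $\Sigma$ and $(n_1,\dots,n_N)$ are uniquely determined by $u$, i.e. they do not depend on the subsequence along which the blowing down limit is taken. Precisely: if $\varepsilon_j\to0^+$ and $\tilde\varepsilon_j\to0^+$ are two sequences along which blowing down limits exist, with data $(\Sigma; N; e_1,\dots,e_N; n_1,\dots,n_N)$ and $(\tilde\Sigma;\tilde N;\tilde e_1,\dots,\tilde e_{\tilde N};\tilde n_1,\dots,\tilde n_{\tilde N})$ respectively, then $\Sigma=\tilde\Sigma$, $N=\tilde N$ and, after relabeling the rays, $e_i=\tilde e_i$ and $n_i=\tilde n_i$ for every $i$.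
   Context: $W$ is a standard double-well potential: $W\in C^3(\mathbb{R})$, $W\ge 0$, $W(t)=0$ if and only if $t=\pm1$; there is $\gamma\in(-1,1)$ with $W'>0$ on $(-1,\gamma)$ and $W'<0$ on $(\gamma,1)$; and there are $\alpha\in(0,1)$, $\kappa>0$ with $W''(t)\ge\kappa$ for $|t|\ge\alpha$. $g\in C^2(\mathbb{R})$ is the one-dimensional profile: $g''=W'(g)$ on $\mathbb{R}$, $g(0)=0$, $\lim_{t\to\pm\infty}g(t)=\pm1$; it satisfies $g'=\sqrt{2W(g)}>0$. Put $\sigma_0:=\int_{\mathbb{R}}\frac12|g'|^2+W(g)\,dt=\int_{\mathbb{R}}|g'|^2dt<\infty$. Blowing down limit: for $\varepsilon>0$ let $u_\varepsilon(x,y):=u(\varepsilon^{-1}x,\varepsilon^{-1}y)$. By the linear energy bound, from every sequence $\varepsilon\to0$ one can extract a subsequence along which, weakly as Radon measures on compact sets of $\mathbb{R}^2$, $\varepsilon|\nabla u_\varepsilon|^2dxdy\rightharpoonup\mu_1$ and $\frac1\varepsilon W(u_\varepsilon)dxdy\rightharpoonup\mu_2$. Along such a subsequence we say a blowing down limit exists, and we put $\mu=\mu_1/2+\mu_2$ and $\Sigma=\mathrm{spt}\,\mu$. By a known theorem (Hutchinson-Tonegawa), along such a subsequence there exist $N$, distinct unit vectors $e_1,\dots,e_N$ and positive integers $n_1,\dots,n_N$ such that, with $L_i=\{te_i:t\ge0\}$: $\Sigma=\bigcup_{i=1}^N L_i$; $u_\varepsilon\to\pm1$ uniformly on compact sets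 of $\mathbb{R}^2\setminus\Sigma$ (the sign being constant on each connected component); $\mu_1=2\mu_2=\sigma_0\sum_{i=1}^N n_i\mathcal{H}^1\lfloor_{L_i}$; and $\sum_{i=1}^N n_ie_i=0$. (If $u\equiv\pm1$, then $\Sigma=\emptyset$ and $N=0$.) A priori these data may depend on the subsequence. *)

theory Defs
  imports "HOL-Analysis.Analysis"
begin

section \<open>Differential operators on Euclidean spaces\<close>

definition partial_deriv :: "'a::euclidean_space \<Rightarrow> ('a \<Rightarrow> real) \<Rightarrow> 'a \<Rightarrow> real" where
  "partial_deriv b f x = frechet_derivative f (at x) b"

lemma partial_deriv_real:
  fixes f :: "real \<Rightarrow> real"
  assumes "f differentiable (at x)"
  shows "partial_deriv 1 f x = deriv f x"
proof -
  have "(f has_derivative (*) (deriv f x)) (at x)"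
    using assms by (simp add: DERIV_deriv_iff_real_differentiable flip: has_field_derivative_def)
  then have "frechet_derivative f (at x) = (*) (deriv f x)"
    by (simp add: frechet_derivative_at[symmetric])
  then show ?thesis
    by (simp add: partial_deriv_def)
qed

text \<open>Since \<open>Basis = {1}\<close> on the real line, this also covers functions of one real variable.\<close>

primrec C_k :: "nat \<Rightarrow> ('a::euclidean_space \<Rightarrow> real) \<Rightarrow> bool" where
  "C_k 0 f \<longleftrightarrow> continuous_on UNIV f"
| "C_k (Suc k) f \<longleftrightarrow> (\<forall>x. f differentiable (at x)) \<and> (\<forall>b\<in>Basis. C_k k (partial_deriv b f))"

definition gradient :: "('a::euclidean_space \<Rightarrow> real) \<Rightarrow> 'a \<Rightarrow> 'a" where
  "gradient f x = (\<Sum>b\<in>Basis. partial_deriv b f x *\<^sub>R b)"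

definition laplacian :: "('a::euclidean_space \<Rightarrow> real) \<Rightarrow> 'a \<Rightarrow> real" where
  "laplacian f x = (\<Sum>b\<in>Basis. partial_deriv b (partial_deriv b f) x)"

section \<open>Double-well potential and one-dimensional profile\<close>

definition double_well :: "(real \<Rightarrow> real) \<Rightarrow> bool" where
  "double_well W \<longleftrightarrow>
     C_k 3 W \<and> (\<forall>t. W t \<ge> 0) \<and> (\<forall>t. W t = 0 \<longleftrightarrow> t = 1 \<or> t = -1) \<and>
     (\<exists>\<gamma>\<in>{-1<..<1}. (\<forall>t\<in>{-1<..<\<gamma>}. deriv W t > 0) \<and> (\<forall>t\<in>{\<gamma><..<1}. deriv W t < 0)) \<and>
     (\<exists>\<alpha>\<in>{0<..<1}. \<exists>\<kappa>>0. \<forall>t. \<bar>t\<bar> \<ge> \<alpha> \<longrightarrow> deriv (deriv W) t \<ge> \<kappa>)"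

definition is_profile :: "(real \<Rightarrow> real) \<Rightarrow> (real \<Rightarrow> real) \<Rightarrow> bool" where
  "is_profile W g \<longleftrightarrow>
     C_k 2 g \<and> (\<forall>t. deriv (deriv g) t = deriv W (g t)) \<and> g 0 = 0 \<and>
     (g \<longlongrightarrow> 1) at_top \<and> (g \<longlongrightarrow> -1) at_bot"

definition surface_tension :: "(real \<Rightarrow> real) \<Rightarrow> (real \<Rightarrow> real) \<Rightarrow> real" where
  "surface_tension W g = (LINT t|lborel. (deriv g t)\<^sup>2 / 2 + W (g t))"

section \<open>Radon measures and one-dimensional Hausdorff measure\<close>

text \<open>On Euclidean spaces every locally finite Borel measure is regular, so no regularity
  condition is needed.\<close>

definition radon_measure :: "'a::euclidean_space measure \<Rightarrow> bool" where
  "radon_measure M \<longleftrightarrow> sets M = sets borel \<and> (\<forall>K. compact K \<longrightarrow> emeasure M K < \<infinity>)"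

definition radon_weak_conv :: "(nat \<Rightarrow> 'a::euclidean_space measure) \<Rightarrow> 'a measure \<Rightarrow> bool" where
  "radon_weak_conv M L \<longleftrightarrow>
     (\<forall>\<phi> :: 'a \<Rightarrow> real. continuous_on UNIV \<phi> \<and> (\<exists>K. compact K \<and> (\<forall>x. x \<notin> K \<longrightarrow> \<phi> x = 0)) \<longrightarrow>
        (\<lambda>j. LINT x|M j. \<phi> x) \<longlonglongrightarrow> (LINT x|L. \<phi> x))"

definition measure_support :: "'a::metric_space measure \<Rightarrow> 'a set" where
  "measure_support M = {x. \<forall>r>0. emeasure M (ball x r) > 0}"

text \<open>The boundedness requirement is needed because \<open>diameter\<close> is only meaningful for bounded
  sets. In dimension one the usual normalising constant is \<open>1\<close>.\<close>

definition hausdorff1_pre :: "real \<Rightarrow> 'a::metric_space set \<Rightarrow> ennreal" where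
  "hausdorff1_pre \<delta> A =
     (INF C \<in> {C :: nat \<Rightarrow> 'a set. A \<subseteq> (\<Union>j. C j) \<and> (\<forall>j. bounded (C j) \<and> diameter (C j) \<le> \<delta>)}.
        (\<Sum>j. ennreal (diameter (C j))))"

definition hausdorff1 :: "'a::metric_space set \<Rightarrow> ennreal" where
  "hausdorff1 A = (SUP \<delta> \<in> {0<..}. hausdorff1_pre \<delta> A)"

section \<open>Blowing down limits\<close>

definition rescale :: "real \<Rightarrow> ('a::real_vector \<Rightarrow> real) \<Rightarrow> 'a \<Rightarrow> real" where
  "rescale \<epsilon> u = (\<lambda>x. u (inverse \<epsilon> *\<^sub>R x))"

definition gradient_measure :: "(real^2 \<Rightarrow> real) \<Rightarrow> real \<Rightarrow> (real^2) measure" where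
  "gradient_measure u \<epsilon> =
     density lborel (\<lambda>x. ennreal (\<epsilon> * (norm (gradient (rescale \<epsilon> u) x))\<^sup>2))"

definition potential_measure :: "(real \<Rightarrow> real) \<Rightarrow> (real^2 \<Rightarrow> real) \<Rightarrow> real \<Rightarrow> (real^2) measure" where
  "potential_measure W u \<epsilon> = density lborel (\<lambda>x. ennreal (1 / \<epsilon> * W (rescale \<epsilon> u x)))"

definition blowing_down_limit ::
  "(real \<Rightarrow> real) \<Rightarrow> (real^2 \<Rightarrow> real) \<Rightarrow> (nat \<Rightarrow> real) \<Rightarrow> (real^2) measure \<Rightarrow> (real^2) measure \<Rightarrow> bool" where
  "blowing_down_limit W u \<epsilon> \<mu>1 \<mu>2 \<longleftrightarrow>
     (\<forall>j. \<epsilon> j > 0) \<and> \<epsilon> \<longlonglongrightarrow> 0 \<and> radon_measure \<mu>1 \<and> radon_measure \<mu>2 \<and>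
     radon_weak_conv (\<lambda>j. gradient_measure u (\<epsilon> j)) \<mu>1 \<and>
     radon_weak_conv (\<lambda>j. potential_measure W u (\<epsilon> j)) \<mu>2"

definition energy_measure :: "'a::euclidean_space measure \<Rightarrow> 'a measure \<Rightarrow> 'a measure" where
  "energy_measure \<mu>1 \<mu>2 = measure_of UNIV (sets borel) (\<lambda>A. emeasure \<mu>1 A / 2 + emeasure \<mu>2 A)"

lemma sets_energy_measure [simp]: "sets (energy_measure \<mu>1 \<mu>2) = sets borel"
  using sets.sigma_sets_eq[of borel] by (simp add: energy_measure_def)

lemma emeasure_energy_measure:
  fixes \<mu>1 \<mu>2 :: "'a::euclidean_space measure"
  assumes "sets \<mu>1 = sets borel" "sets \<mu>2 = sets borel" "A \<in> sets borel"
  shows "emeasure (energy_measure \<mu>1 \<mu>2) A = emeasure \<mu>1 A / 2 + emeasure \<mu>2 A"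
proof (rule emeasure_measure_of[OF energy_measure_def])
  show "countably_additive (sets (energy_measure \<mu>1 \<mu>2)) (\<lambda>A. emeasure \<mu>1 A / 2 + emeasure \<mu>2 A)"
    unfolding countably_additive_def
  proof (intro allI impI)
    fix F :: "nat \<Rightarrow> 'a set"
    assume F: "range F \<subseteq> sets (energy_measure \<mu>1 \<mu>2)" "disjoint_family F"
    have "(\<Sum>i. emeasure \<mu>1 (F i) / 2) = emeasure \<mu>1 (\<Union>i. F i) / 2"
      using F assms by (simp add: suminf_emeasure divide_ennreal_def)
    moreover have "(\<Sum>i. emeasure \<mu>2 (F i)) = emeasure \<mu>2 (\<Union>i. F i)"
      using F assms by (simp add: suminf_emeasure)
    ultimately show "(\<Sum>i. emeasure \<mu>1 (F i) / 2 + emeasure \<mu>2 (F i)) =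
        emeasure \<mu>1 (\<Union>i. F i) / 2 + emeasure \<mu>2 (\<Union>i. F i)"
      by (simp add: suminf_add[symmetric])
  qed
qed (use assms in \<open>auto simp: positive_def\<close>)

definition ray :: "'a::real_vector \<Rightarrow> 'a set" where
  "ray e = {t *\<^sub>R e | t. t \<ge> 0}"

text \<open>The data that the Hutchinson-Tonegawa theorem attaches to a blowing down limit.  The function
  \<open>s\<close> is the \<open>\<plusminus>1\<close>-valued limit of the rescaled solutions off \<open>\<Sigma>\<close>. The values of \<open>e\<close> and \<open>n\<close> outside
  \<open>{1..N}\<close> are irrelevant.\<close>

definition blowing_down_data ::
  "(real \<Rightarrow> real) \<Rightarrow> (real \<Rightarrow> real) \<Rightarrow> (real^2 \<Rightarrow> real) \<Rightarrow> (nat \<Rightarrow> real) \<Rightarrow>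
   (real^2) set \<Rightarrow> nat \<Rightarrow> (nat \<Rightarrow> real^2) \<Rightarrow> (nat \<Rightarrow> nat) \<Rightarrow> bool" where
  "blowing_down_data W g u \<epsilon> \<Sigma> N e n \<longleftrightarrow>
     (\<exists>\<mu>1 \<mu>2. blowing_down_limit W u \<epsilon> \<mu>1 \<mu>2 \<and>
        \<Sigma> = measure_support (energy_measure \<mu>1 \<mu>2) \<and>
        (\<forall>i\<in>{1..N}. norm (e i) = 1) \<and> inj_on e {1..N} \<and> (\<forall>i\<in>{1..N}. n i > 0) \<and>
        \<Sigma> = (\<Union>i\<in>{1..N}. ray (e i)) \<and>
        (\<exists>s. (\<forall>x\<in>-\<Sigma>. s x = 1 \<or> s x = -1) \<and> (\<forall>C\<in>components (-\<Sigma>). s constant_on C) \<and>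
             (\<forall>K. compact K \<and> K \<subseteq> -\<Sigma> \<longrightarrow>
                uniform_limit K (\<lambda>j. rescale (\<epsilon> j) u) s sequentially)) \<and>
        (\<forall>A\<in>sets borel. emeasure \<mu>1 A = 2 * emeasure \<mu>2 A) \<and>
        (\<forall>A\<in>sets borel. emeasure \<mu>1 A =
           ennreal (surface_tension W g) * (\<Sum>i=1..N. of_nat (n i) * hausdorff1 (A \<inter> ray (e i)))) \<and>
        (\<Sum>i=1..N. of_nat (n i) *\<^sub>R e i) = 0)"

end

theory Submission
  imports Defs
begin

text \<open>
  Write \<open>T\<close> for the tensor \<open>\<nabla>u \<otimes> \<nabla>u + (W(u) - |\<nabla>u|\<^sup>2/2) I\<close>.  In the plane the equation \<open>\<Delta>u = W'(u)\<close>
  makes \<open>T\<close> satisfy the compatibility conditions of a Hessian: there is a function \<open>U\<close> with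
  \<open>D\<^sup>2U = T\<close>, \<open>U(0) = 0\<close> and \<open>\<nabla>U(0) = 0\<close> (lemmas \<open>potential_of_hessian\<close> and \<open>stress_potential\<close>).  The
  trace of \<open>T\<close> is \<open>2W(u)\<close>, so with \<open>V\<^sub>R(x) = U(Rx)/R\<close> the potential part of the rescaled energy at
  scale \<open>\<epsilon> = 1/R\<close> has density \<open>\<Delta>V\<^sub>R/2\<close>.  By the gradient bound of Modica, \<open>|\<nabla>u|\<^sup>2 \<le> 2W(u)\<close>, the
  tensor \<open>T\<close> is positive semidefinite, that is, \<open>U\<close> is convex; and for a convex function that vanishes
  at the origin the quotient \<open>U(Rx)/R\<close> is nondecreasing in \<open>R\<close>.  If this monotone family stays bounded
  in \<open>L\<^sup>1\<close> on compact sets, it converges there along the full limit \<open>R \<rightarrow> \<infinity>\<close>, so \<open>\<Delta>V\<^sub>R\<close> converges as a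
  distribution and the limit \<open>\<mu>\<^sub>2\<close> cannot depend on the sequence of scales
  (\<open>blow_down_limit_unique\<close>).

  The bound on \<open>V\<^sub>R\<close> comes from the linear growth of the energy.  Let \<open>\<rho>(x) = max(0, 1 - |x|\<^sup>2)\<close>.  There
  is a compactly supported \<open>\<phi>\<close> with \<open>\<Delta>\<phi> = \<rho>(x) - 4\<rho>(2x)\<close>, because the right-hand side is radial of mass
  zero in the plane (\<open>annular_test_function\<close>).  Convexity gives \<open>V\<^sub>R(x/2) \<le> V\<^sub>R(x)/2\<close>, so testing with
  \<open>\<phi>\<close> absorbs the negative term and leaves \<open>\<integral>V\<^sub>R \<rho> \<le> 2 \<integral>V\<^sub>R \<Delta>\<phi> = 2 \<integral>\<phi> \<Delta>V\<^sub>R\<close>, which is controlled by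
  the energy in a ball.

  Two a priori estimates enter Modica's bound.  First \<open>|u| \<le> 1\<close>: a convex function of \<open>u\<close> that vanishes
  for \<open>u \<le> 1\<close> and grows at most quadratically is subharmonic, is controlled by \<open>W(u)\<close>, and hence has
  averages over large balls that tend to zero (\<open>solution_le_1\<close>).  Then \<open>|\<nabla>u|\<close> is bounded by Bernstein's
  argument (\<open>gradient_bounded\<close>).  Both Bernstein's and Modica's argument apply the maximum principle to
  \<open>a|\<nabla>u|\<^sup>2/2 + b\<close>.  Since \<open>u\<close> is only of class \<open>C\<^sup>2\<close>, this function need not be twice differentiable;
  the gradient is replaced by difference quotients, which satisfy a linearized equation, and the
  maximum principle is passed to the limit (\<open>limit_maximum_principle\<close>, \<open>gradient_functional_max\<close>).

  Finally \<open>\<mu>\<^sub>2\<close> determines the data: its support is \<open>\<Sigma>\<close>, the directions \<open>e\<^sub>i\<close> are the unit vectors in \<open>\<Sigma>\<close>,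
  and near \<open>e\<^sub>i\<close> the measure is proportional to \<open>n\<^sub>i\<close>.
\<close>

section \<open>Functions of class \<open>C\<^sup>2\<close> with gradient and Hessian\<close>

text \<open>Carrying the gradient field and the Hessian as explicit arguments lets each closure lemma below
  double as a formula for the derivatives.  The Hessian is an operator, so that its trace is the
  Laplacian.\<close>
definition C2_jet :: "('a::euclidean_space \<Rightarrow> real) \<Rightarrow> ('a \<Rightarrow> 'a) \<Rightarrow> ('a \<Rightarrow> 'a \<Rightarrow> 'a) \<Rightarrow> bool" where
  "C2_jet f G H \<longleftrightarrow>
     (\<forall>x. (f has_derivative (\<lambda>v. G x \<bullet> v)) (at x)) \<and>
     (\<forall>x. (G has_derivative H x) (at x)) \<and>
     (\<forall>v. continuous_on UNIV (\<lambda>x. H x v))"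

definition trace_op :: "('a::euclidean_space \<Rightarrow> 'a) \<Rightarrow> real" where
  "trace_op A = (\<Sum>b\<in>Basis. A b \<bullet> b)"

lemma C2_jetI:
  assumes "\<And>x. (f has_derivative (\<lambda>v. G x \<bullet> v)) (at x)"
    and "\<And>x. (G has_derivative H x) (at x)"
    and "\<And>v. continuous_on UNIV (\<lambda>x. H x v)"
  shows "C2_jet f G H"
  using assms by (auto simp: C2_jet_def)

lemma C2_jetD:
  assumes "C2_jet f G H"
  shows "(f has_derivative (\<lambda>v. G x \<bullet> v)) (at x)" "(G has_derivative H x) (at x)"
    "continuous_on UNIV (\<lambda>x. H x v)"
  using assms by (auto simp: C2_jet_def)

lemma C2_jet_continuous:
  assumes "C2_jet f G H"
  shows "continuous_on S f" "continuous_on S G"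
  using C2_jetD(1,2)[OF assms]
  by (blast intro: has_derivative_continuous continuous_at_imp_continuous_on)+

lemma C2_jet_linear:
  assumes "C2_jet f G H"
  shows "linear (H x)"
  using C2_jetD(2)[OF assms] has_derivative_linear by blast

lemma linear_Basis_expansion:
  fixes v :: "'a::euclidean_space" and A :: "'a \<Rightarrow> 'b::real_vector"
  assumes "linear A"
  shows "A v = (\<Sum>b\<in>Basis. (v \<bullet> b) *\<^sub>R A b)"
proof -
  have "A (\<Sum>b\<in>Basis. (v \<bullet> b) *\<^sub>R b) = (\<Sum>b\<in>Basis. (v \<bullet> b) *\<^sub>R A b)"
    by (simp add: linear_sum[OF assms] linear_scale[OF assms])
  then show ?thesis
    by (simp add: euclidean_representation)
qed

lemma C2_jet_continuous_hessian:
  assumes "C2_jet f G H" "continuous_on S k" "continuous_on S l"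
  shows "continuous_on S (\<lambda>x. H (k x) (l x))"
proof -
  have "continuous_on S (\<lambda>x. \<Sum>b\<in>Basis. (l x \<bullet> b) *\<^sub>R H (k x) b)"
    by (intro continuous_intros assms continuous_on_compose2[OF C2_jetD(3)[OF assms(1)] assms(2)]) auto
  moreover have "H (k x) (l x) = (\<Sum>b\<in>Basis. (l x \<bullet> b) *\<^sub>R H (k x) b)" for x
    by (rule linear_Basis_expansion[OF C2_jet_linear[OF assms(1)]])
  ultimately show ?thesis
    by simp
qed

lemma C2_jet_line:
  assumes "C2_jet f G H"
  shows "((\<lambda>t. f (x + t *\<^sub>R v)) has_real_derivative G (x + t *\<^sub>R v) \<bullet> v) (at t)"
    and "((\<lambda>t. G (x + t *\<^sub>R v) \<bullet> w) has_real_derivative H (x + t *\<^sub>R v) v \<bullet> w) (at t)"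
proof -
  have line: "((\<lambda>t. x + t *\<^sub>R v) has_derivative (\<lambda>s. s *\<^sub>R v)) (at t)"
    by (auto intro!: derivative_eq_intros)
  have "((\<lambda>t. f (x + t *\<^sub>R v)) has_derivative (\<lambda>s. G (x + t *\<^sub>R v) \<bullet> (s *\<^sub>R v))) (at t)"
    using has_derivative_compose[OF line C2_jetD(1)[OF assms]] by simp
  then show "((\<lambda>t. f (x + t *\<^sub>R v)) has_real_derivative G (x + t *\<^sub>R v) \<bullet> v) (at t)"
    by (simp add: has_field_derivative_def mult_commute_abs)
  have "((\<lambda>t. G (x + t *\<^sub>R v)) has_derivative (\<lambda>s. H (x + t *\<^sub>R v) (s *\<^sub>R v))) (at t)"
    using has_derivative_compose[OF line C2_jetD(2)[OF assms]] by simp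
  from has_derivative_inner_left[OF this, of w]
  show "((\<lambda>t. G (x + t *\<^sub>R v) \<bullet> w) has_real_derivative H (x + t *\<^sub>R v) v \<bullet> w) (at t)"
    by (simp add: has_field_derivative_def linear_scale[OF C2_jet_linear[OF assms]] mult_commute_abs)
qed

text \<open>The mixed second difference over a small parallelogram is symmetric in the two directions, and
  two applications of the mean value theorem turn it into a value of the Hessian nearby.\<close>
lemma C2_jet_symmetric:
  assumes C2: "C2_jet f G H"
  shows "H x v \<bullet> w = H x w \<bullet> v"
proof -
  define D where "D h v w = f (x + h *\<^sub>R v + h *\<^sub>R w) - f (x + h *\<^sub>R v) - f (x + h *\<^sub>R w) + f x" for h :: real and v w
  have mixed: "\<exists>s t. 0 < s \<and> s < h \<and> 0 < t \<and> t < h \<and> D h v w = h * h * (H (x + s *\<^sub>R v + t *\<^sub>R w) w \<bullet> v)"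
    if h: "h > 0" for h v w
  proof -
    have d1: "((\<lambda>s. f (x + h *\<^sub>R w + s *\<^sub>R v) - f (x + s *\<^sub>R v)) has_real_derivative
        G (x + h *\<^sub>R w + s *\<^sub>R v) \<bullet> v - G (x + s *\<^sub>R v) \<bullet> v) (at s)" for s
      by (intro DERIV_diff C2_jet_line[OF C2])
    obtain s where s: "0 < s" "s < h" and
      es: "(f (x + h *\<^sub>R w + h *\<^sub>R v) - f (x + h *\<^sub>R v)) - (f (x + h *\<^sub>R w + 0 *\<^sub>R v) - f (x + 0 *\<^sub>R v))
        = (h - 0) * (G (x + h *\<^sub>R w + s *\<^sub>R v) \<bullet> v - G (x + s *\<^sub>R v) \<bullet> v)"
      using MVT2[OF h d1] by blast
    obtain t where t: "0 < t" "t < h" and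
      et: "G (x + s *\<^sub>R v + h *\<^sub>R w) \<bullet> v - G (x + s *\<^sub>R v + 0 *\<^sub>R w) \<bullet> v =
        (h - 0) * (H (x + s *\<^sub>R v + t *\<^sub>R w) w \<bullet> v)"
      using MVT2[OF h C2_jet_line(2)[OF C2]] by metis
    have "D h v w = h * (h * (H (x + s *\<^sub>R v + t *\<^sub>R w) w \<bullet> v))"
      using es et by (simp add: D_def algebra_simps)
    then show ?thesis
      using s t by (metis mult.assoc)
  qed
  have lim: "((\<lambda>h. D h v w / (h * h)) \<longlongrightarrow> H x w \<bullet> v) (at_right 0)" for v w
  proof -
    have "\<forall>h. \<exists>p. h > 0 \<longrightarrow> (0 < fst p \<and> fst p < h \<and> 0 < snd p \<and> snd p < h \<and>
       D h v w = h * h * (H (x + fst p *\<^sub>R v + snd p *\<^sub>R w) w \<bullet> v))"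
      using mixed by fastforce
    then obtain p where p: "\<And>h. h > 0 \<Longrightarrow> 0 < fst (p h) \<and> fst (p h) < h \<and> 0 < snd (p h) \<and> snd (p h) < h \<and>
       D h v w = h * h * (H (x + fst (p h) *\<^sub>R v + snd (p h) *\<^sub>R w) w \<bullet> v)"
      by metis
    have id: "((\<lambda>h::real. h) \<longlongrightarrow> 0) (at_right 0)"
      by (rule tendsto_ident_at)
    have "((\<lambda>h. fst (p h)) \<longlongrightarrow> 0) (at_right 0)"
      by (rule tendsto_sandwich[OF _ _ tendsto_const id])
         (simp_all add: eventually_at_filter p less_imp_le)
    moreover have "((\<lambda>h. snd (p h)) \<longlongrightarrow> 0) (at_right 0)"
      by (rule tendsto_sandwich[OF _ _ tendsto_const id])
         (simp_all add: eventually_at_filter p less_imp_le)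
    ultimately have "((\<lambda>h. x + fst (p h) *\<^sub>R v + snd (p h) *\<^sub>R w) \<longlongrightarrow> x + 0 *\<^sub>R v + 0 *\<^sub>R w) (at_right 0)"
      by (intro tendsto_intros)
    moreover have "isCont (\<lambda>y. H y w \<bullet> v) x"
      using C2_jetD(3)[OF C2] by (simp add: continuous_on_eq_continuous_at)
    ultimately have "((\<lambda>h. H (x + fst (p h) *\<^sub>R v + snd (p h) *\<^sub>R w) w \<bullet> v) \<longlongrightarrow> H x w \<bullet> v) (at_right 0)"
      using isCont_tendsto_compose by force
    then show ?thesis
    proof (rule Lim_transform_eventually)
      show "\<forall>\<^sub>F h in at_right 0. H (x + fst (p h) *\<^sub>R v + snd (p h) *\<^sub>R w) w \<bullet> v = D h v w / (h * h)"
        using p by (simp add: eventually_at_filter)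
    qed
  qed
  have "D h v w = D h w v" for h
    by (simp add: D_def algebra_simps)
  with lim[of v w] lim[of w v] show ?thesis
    using tendsto_unique[of "at_right (0::real)"] by force
qed

lemma C2_jet_const: "C2_jet (\<lambda>x. c) (\<lambda>x. 0) (\<lambda>x v. 0)"
  by (rule C2_jetI) auto

lemma C2_jet_add:
  assumes "C2_jet f G H" "C2_jet f' G' H'"
  shows "C2_jet (\<lambda>x. f x + f' x) (\<lambda>x. G x + G' x) (\<lambda>x v. H x v + H' x v)"
  unfolding C2_jet_def inner_add_left
  by (intro allI conjI has_derivative_add continuous_on_add C2_jetD[OF assms(1)] C2_jetD[OF assms(2)])

lemma C2_jet_cmult:
  assumes "C2_jet f G H"
  shows "C2_jet (\<lambda>x. c * f x) (\<lambda>x. c *\<^sub>R G x) (\<lambda>x v. c *\<^sub>R H x v)"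
  unfolding C2_jet_def inner_scaleR_left
  by (intro allI conjI has_derivative_mult_right has_derivative_scaleR_right continuous_intros C2_jetD[OF assms])

lemma C2_jet_mult:
  assumes "C2_jet f G H" "C2_jet f' G' H'"
  shows "C2_jet (\<lambda>x. f x * f' x) (\<lambda>x. f x *\<^sub>R G' x + f' x *\<^sub>R G x)
     (\<lambda>x v. f x *\<^sub>R H' x v + (G x \<bullet> v) *\<^sub>R G' x + (f' x *\<^sub>R H x v + (G' x \<bullet> v) *\<^sub>R G x))"
  apply (rule C2_jetI)
    apply (rule derivative_eq_intros C2_jetD[OF assms(1)] C2_jetD[OF assms(2)] refl)+
    apply (simp add: inner_add_left mult.commute)
   apply (rule derivative_eq_intros C2_jetD[OF assms(1)] C2_jetD[OF assms(2)] refl)+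
  apply (intro continuous_intros C2_jet_continuous[OF assms(1)] C2_jet_continuous[OF assms(2)]
     C2_jetD(3)[OF assms(1)] C2_jetD(3)[OF assms(2)])
  done

lemma C2_jet_sum:
  assumes "\<And>i. i \<in> I \<Longrightarrow> C2_jet (f i) (G i) (H i)"
  shows "C2_jet (\<lambda>x. \<Sum>i\<in>I. f i x) (\<lambda>x. \<Sum>i\<in>I. G i x) (\<lambda>x v. \<Sum>i\<in>I. H i x v)"
  unfolding C2_jet_def inner_sum_left
  by (intro allI conjI has_derivative_sum continuous_on_sum C2_jetD[OF assms])

lemma C2_jet_compose:
  fixes a a' a'' :: "real \<Rightarrow> real"
  assumes "C2_jet f G H" and a: "\<And>t. (a has_real_derivative a' t) (at t)"
    and a': "\<And>t. (a' has_real_derivative a'' t) (at t)" and a'': "continuous_on UNIV a''"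
  shows "C2_jet (\<lambda>x. a (f x)) (\<lambda>x. a' (f x) *\<^sub>R G x)
     (\<lambda>x v. a' (f x) *\<^sub>R H x v + (a'' (f x) * (G x \<bullet> v)) *\<^sub>R G x)"
proof (rule C2_jetI)
  have ca: "continuous_on UNIV a'"
    using a' by (meson DERIV_isCont continuous_at_imp_continuous_on)
  fix x
  show "((\<lambda>x. a (f x)) has_derivative (\<lambda>v. (a' (f x) *\<^sub>R G x) \<bullet> v)) (at x)"
    using has_derivative_compose[OF C2_jetD(1)[OF assms(1)] a[unfolded has_field_derivative_def]] by simp
  have "((\<lambda>x. a' (f x)) has_derivative (\<lambda>v. a'' (f x) * (G x \<bullet> v))) (at x)"
    using has_derivative_compose[OF C2_jetD(1)[OF assms(1)] a'[unfolded has_field_derivative_def]] by simp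
  from has_derivative_scaleR[OF this C2_jetD(2)[OF assms(1)]]
  show "((\<lambda>x. a' (f x) *\<^sub>R G x) has_derivative
     (\<lambda>v. a' (f x) *\<^sub>R H x v + (a'' (f x) * (G x \<bullet> v)) *\<^sub>R G x)) (at x)"
    by simp
  show "continuous_on UNIV (\<lambda>x. a' (f x) *\<^sub>R H x v + (a'' (f x) * (G x \<bullet> v)) *\<^sub>R G x)" for v
    by (intro continuous_intros C2_jetD(3)[OF assms(1)] C2_jet_continuous[OF assms(1)]
        continuous_on_compose2[OF ca C2_jet_continuous(1)[OF assms(1)]]
        continuous_on_compose2[OF a'' C2_jet_continuous(1)[OF assms(1)]]) auto
qed

lemma C2_jet_affine:
  assumes "C2_jet f G H"
  shows "C2_jet (\<lambda>x. f (r *\<^sub>R x + d)) (\<lambda>x. r *\<^sub>R G (r *\<^sub>R x + d)) (\<lambda>x v. (r * r) *\<^sub>R H (r *\<^sub>R x + d) v)"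
proof (rule C2_jetI)
  fix x
  have l: "((\<lambda>x. r *\<^sub>R x + d) has_derivative (\<lambda>v. r *\<^sub>R v)) (at x)"
    by (auto intro!: derivative_eq_intros)
  show "((\<lambda>x. f (r *\<^sub>R x + d)) has_derivative (\<lambda>v. (r *\<^sub>R G (r *\<^sub>R x + d)) \<bullet> v)) (at x)"
    using has_derivative_compose[OF l C2_jetD(1)[OF assms]] by simp
  show "((\<lambda>x. r *\<^sub>R G (r *\<^sub>R x + d)) has_derivative (\<lambda>v. (r * r) *\<^sub>R H (r *\<^sub>R x + d) v)) (at x)"
    using has_derivative_scaleR_right[OF has_derivative_compose[OF l C2_jetD(2)[OF assms]], of r]
    by (simp add: linear_scale[OF C2_jet_linear[OF assms]])
  show "continuous_on UNIV (\<lambda>x. (r * r) *\<^sub>R H (r *\<^sub>R x + d) v)" for v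
    by (intro continuous_intros continuous_on_compose2[OF C2_jetD(3)[OF assms]]) auto
qed

lemma C2_jet_sqdist:
  "C2_jet (\<lambda>x. (x - c) \<bullet> (x - c)) (\<lambda>x. 2 *\<^sub>R (x - c)) (\<lambda>x v. 2 *\<^sub>R v)"
proof (rule C2_jetI)
  fix x
  have d: "((\<lambda>x. x - c) has_derivative (\<lambda>v. v)) (at x)"
    by (auto intro!: derivative_eq_intros)
  show "((\<lambda>x. (x - c) \<bullet> (x - c)) has_derivative (\<lambda>v. (2 *\<^sub>R (x - c)) \<bullet> v)) (at x)"
    using has_derivative_inner[OF d d] by (simp add: inner_commute)
  show "((\<lambda>x. 2 *\<^sub>R (x - c)) has_derivative (\<lambda>v. 2 *\<^sub>R v)) (at x)"
    using has_derivative_scaleR_right[OF d] .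
  show "continuous_on UNIV (\<lambda>x::'a. 2 *\<^sub>R v)" for v :: 'a
    by (rule continuous_on_const)
qed

lemma trace_op_add: "trace_op (\<lambda>v. A v + B v) = trace_op A + trace_op B"
  by (simp add: trace_op_def inner_add_left sum.distrib)

lemma trace_op_scaleR: "trace_op (\<lambda>v. c *\<^sub>R A v) = c * trace_op A"
  by (simp add: trace_op_def sum_distrib_left)

lemma trace_op_sum: "trace_op (\<lambda>v. \<Sum>i\<in>I. A i v) = (\<Sum>i\<in>I. trace_op (A i))"
  unfolding trace_op_def inner_sum_left by (rule sum.swap)

lemma trace_op_rank1: "trace_op (\<lambda>v. (p \<bullet> v) *\<^sub>R q) = p \<bullet> q"
  unfolding trace_op_def inner_scaleR_left
  by (subst euclidean_inner[of p q]) (rule refl)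

lemma trace_op_rank1': "trace_op (\<lambda>v. (c * (p \<bullet> v)) *\<^sub>R q) = c * (p \<bullet> q)"
  using trace_op_rank1[of "c *\<^sub>R p" q] by simp

lemma trace_op_ident: "trace_op (\<lambda>v::'a::euclidean_space. v) = DIM('a)"
  by (simp add: trace_op_def)

lemma trace_op_zero: "trace_op (\<lambda>v. 0) = 0"
  by (simp add: trace_op_def)

lemmas trace_op_simps = trace_op_add trace_op_scaleR trace_op_sum trace_op_rank1 trace_op_rank1'
  trace_op_ident trace_op_zero

lemma C2_jet_continuous_trace:
  assumes "C2_jet f G H" "continuous_on S k"
  shows "continuous_on S (\<lambda>x. trace_op (H (k x)))"
  unfolding trace_op_def
  by (intro continuous_intros C2_jet_continuous_hessian[OF assms])

text \<open>Membership in \<open>C_k\<close> includes Frechet differentiability of every partial derivative, so the gradient and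
  the Hessian can be assembled from coordinates.\<close>
lemma C_k_2_imp_jet:
  fixes f :: "'a::euclidean_space \<Rightarrow> real"
  assumes "C_k 2 f"
  obtains H where "C2_jet f (gradient f) H" "\<And>x. trace_op (H x) = laplacian f x"
proof -
  from assms have f: "f differentiable (at x)"
    and df: "b \<in> Basis \<Longrightarrow> partial_deriv b f differentiable (at x)"
    and ddf: "b \<in> Basis \<Longrightarrow> c \<in> Basis \<Longrightarrow> continuous_on UNIV (partial_deriv c (partial_deriv b f))" for x b c
    by (auto simp: numeral_2_eq_2)
  define H where "H x v = (\<Sum>b\<in>Basis. frechet_derivative (partial_deriv b f) (at x) v *\<^sub>R b)" for x v
  have lin: "linear (frechet_derivative (partial_deriv b f) (at x))" if "b \<in> Basis" for b x
    using df[OF that] by (rule linear_frechet_derivative)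
  have "C2_jet f (gradient f) H"
  proof (rule C2_jetI)
    fix x
    have d: "(f has_derivative frechet_derivative f (at x)) (at x)"
      using f frechet_derivative_works by blast
    have "frechet_derivative f (at x) v = gradient f x \<bullet> v" for v
      by (subst linear_Basis_expansion[OF has_derivative_linear[OF d]])
         (simp add: gradient_def partial_deriv_def inner_sum_right mult.commute inner_commute[of _ v])
    then have "frechet_derivative f (at x) = (\<lambda>v. gradient f x \<bullet> v)" ..
    with d show "(f has_derivative (\<lambda>v. gradient f x \<bullet> v)) (at x)"
      by simp
    show "(gradient f has_derivative H x) (at x)"
      unfolding gradient_def[abs_def] H_def[abs_def]
      by (intro has_derivative_sum has_derivative_scaleR_left) (use df frechet_derivative_works in blast)
  next
    fix v
    have "continuous_on UNIV (\<lambda>x. \<Sum>b\<in>Basis. (\<Sum>c\<in>Basis. (v \<bullet> c) * partial_deriv c (partial_deriv b f) x) *\<^sub>R b)"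
      by (intro continuous_intros ddf)
    moreover have "H x v = (\<Sum>b\<in>Basis. (\<Sum>c\<in>Basis. (v \<bullet> c) * partial_deriv c (partial_deriv b f) x) *\<^sub>R b)" for x
      unfolding H_def
      by (intro sum.cong refl arg_cong2[of _ _ _ _ scaleR])
         (subst linear_Basis_expansion[OF lin], auto simp: partial_deriv_def)
    ultimately show "continuous_on UNIV (\<lambda>x. H x v)"
      by simp
  qed
  moreover have "trace_op (H x) = laplacian f x" for x
    by (simp add: trace_op_def laplacian_def H_def inner_sum_left_Basis partial_deriv_def)
  ultimately show ?thesis
    using that by blast
qed

lemma C_k_Suc_real:
  fixes f :: "real \<Rightarrow> real"
  assumes "C_k (Suc k) f"
  shows "(f has_real_derivative deriv f t) (at t)" "C_k k (deriv f)"
proof -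
  have d: "f differentiable (at x)" for x
    using assms by simp
  then show "(f has_real_derivative deriv f t) (at t)"
    using DERIV_deriv_iff_real_differentiable by blast
  have "partial_deriv 1 f = deriv f"
    using partial_deriv_real[OF d] by auto
  then show "C_k k (deriv f)"
    using assms by simp
qed

section \<open>Integration by parts against compactly supported functions\<close>

lemma integrable_compact_support:
  fixes f :: "'a::euclidean_space \<Rightarrow> real"
  assumes "continuous_on UNIV f" "\<And>x. r < norm x \<Longrightarrow> f x = 0"
  shows "integrable lborel f"
proof -
  have "integrable lborel (\<lambda>x. indicator (cball 0 r) x *\<^sub>R f x)"
    using assms(1) by (intro borel_integrable_compact) (auto intro: continuous_on_subset)
  moreover have "(\<lambda>x. indicator (cball 0 r) x *\<^sub>R f x) = f"
    using assms(2) by (auto simp: indicator_def fun_eq_iff not_le)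
  ultimately show ?thesis
    by simp
qed

lemma integral_lborel_translate:
  fixes f :: "'a::euclidean_space \<Rightarrow> real"
  assumes "f \<in> borel_measurable borel"
  shows "(LINT x|lborel. f (x + d)) = (LINT x|lborel. f x)"
proof -
  have "(LINT x|lborel. f x) = (LINT x|distr lborel borel ((+) d). f x)"
    by (simp add: lborel_distr_plus)
  also have "\<dots> = (LINT x|lborel. f (d + x))"
    using assms by (subst integral_distr) auto
  finally show ?thesis
    by (simp add: add.commute)
qed

lemma integral_lborel_scale:
  fixes f :: "'a::euclidean_space \<Rightarrow> real"
  assumes "f \<in> borel_measurable borel" "r > 0"
  shows "(LINT x|lborel. f x) = r ^ DIM('a) * (LINT x|lborel. f (r *\<^sub>R x))"
proof -
  have "(LINT x|lborel. f x) =
     (LINT x|density (distr lborel borel (\<lambda>x. 0 + r *\<^sub>R x)) (\<lambda>_. ennreal (\<bar>r\<bar> ^ DIM('a))). f x)"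
    using lborel_affine[of r "0::'a"] assms(2) by simp
  also have "\<dots> = (LINT x|distr lborel borel (\<lambda>x. 0 + r *\<^sub>R x). r ^ DIM('a) * f x)"
    using assms by (subst integral_density) (auto simp: measurable_distr_eq1)
  also have "\<dots> = r ^ DIM('a) * (LINT x|lborel. f (r *\<^sub>R x))"
    using assms by (subst integral_distr) auto
  finally show ?thesis .
qed

lemma line_derivative_shift:
  fixes F F' :: "'a::real_normed_vector \<Rightarrow> real"
  assumes "\<And>x. ((\<lambda>t. F (x + t *\<^sub>R b)) has_real_derivative F' x) (at 0)"
  shows "((\<lambda>t. F (x + t *\<^sub>R b)) has_real_derivative F' (x + t *\<^sub>R b)) (at t)"
proof -
  have "(\<lambda>s. F (x + (t + s) *\<^sub>R b)) = (\<lambda>s. F ((x + t *\<^sub>R b) + s *\<^sub>R b))"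
    by (simp add: scaleR_left_distrib add.assoc)
  then show ?thesis
    using assms[of "x + t *\<^sub>R b"] DERIV_shift[of "\<lambda>t. F (x + t *\<^sub>R b)" "F' (x + t *\<^sub>R b)" 0 t]
    by (simp add: add.commute)
qed

text \<open>Translation invariance makes the integral of every difference quotient vanish; the quotients
  converge boundedly on a fixed ball.\<close>
lemma integral_directional_derivative_eq_0:
  fixes F F' :: "'a::euclidean_space \<Rightarrow> real"
  assumes deriv: "\<And>x. ((\<lambda>t. F (x + t *\<^sub>R b)) has_real_derivative F' x) (at 0)"
    and cont: "continuous_on UNIV F" "continuous_on UNIV F'"
    and supp: "\<And>x. r < norm x \<Longrightarrow> F x = 0" "\<And>x. r < norm x \<Longrightarrow> F' x = 0"
  shows "(LINT x|lborel. F' x) = 0"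
proof -
  have F_meas[measurable]: "F \<in> borel_measurable borel" and F'_meas[measurable]: "F' \<in> borel_measurable borel"
    using cont by (auto intro: borel_measurable_continuous_onI)
  have F_int: "integrable lborel F"
    using cont(1) supp(1) by (rule integrable_compact_support)
  note deriv_t = line_derivative_shift[OF deriv]
  obtain M where M: "\<And>x. x \<in> cball 0 r \<Longrightarrow> norm (F' x) \<le> M"
  proof -
    have "compact (F' ` cball 0 r)"
      using cont(2) by (intro compact_continuous_image) (auto intro: continuous_on_subset)
    then show ?thesis
      using that by (meson bounded_iff compact_imp_bounded imageI)
  qed
  have M': "\<bar>F' x\<bar> \<le> max M 0" for x
    using M[of x] supp(2)[of x] by (cases "norm x \<le> r") (auto simp: max_def)
  define h where "h n = 1 / real (Suc n)" for n
  have h: "0 < h n" "h n \<le> 1" for n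
    by (auto simp: h_def)
  have far: "r < norm (x + h n *\<^sub>R b)" if "r + norm b < norm x" for x n
  proof -
    have "norm (h n *\<^sub>R b) \<le> 1 * norm b"
      unfolding norm_scaleR by (rule mult_right_mono) (use h[of n] in auto)
    moreover have "norm x \<le> norm (x + h n *\<^sub>R b) + norm (h n *\<^sub>R b)"
      using norm_triangle_ineq4[of "x + h n *\<^sub>R b" "h n *\<^sub>R b"] by (simp del: norm_scaleR)
    ultimately show ?thesis
      using that by linarith
  qed
  define s where "s n x = (F (x + h n *\<^sub>R b) - F x) / h n" for n x
  have bound: "\<bar>s n x\<bar> \<le> max M 0 * indicator (cball 0 (r + norm b)) x" for n x
  proof (cases "norm x \<le> r + norm b")
    case True
    obtain z where "F (x + h n *\<^sub>R b) - F (x + 0 *\<^sub>R b) = (h n - 0) * F' (x + z *\<^sub>R b)"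
      using MVT2[OF h(1), OF deriv_t] by blast
    then have "s n x = F' (x + z *\<^sub>R b)"
      using h(1)[of n] by (simp add: s_def)
    with True M'[of "x + z *\<^sub>R b"] show ?thesis
      by simp
  next
    case False
    then have "r < norm x"
      using norm_ge_zero[of b] by linarith
    then show ?thesis
      using False far[of x n] by (simp add: s_def supp(1))
  qed
  have s_int: "(LINT x|lborel. s n x) = 0" for n
  proof -
    have "integrable lborel (\<lambda>x. F (x + h n *\<^sub>R b))"
    proof (rule integrable_compact_support[where r = "r + norm b"])
      show "continuous_on UNIV (\<lambda>x. F (x + h n *\<^sub>R b))"
        by (intro continuous_on_compose2[OF cont(1)] continuous_intros) auto
    qed (intro supp(1) far)
    then show ?thesis
      using F_int unfolding s_def by (simp add: integral_lborel_translate)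
  qed
  have "(\<lambda>n. LINT x|lborel. s n x) \<longlonglongrightarrow> (LINT x|lborel. F' x)"
  proof (rule integral_dominated_convergence)
    show "s n \<in> borel_measurable lborel" for n
      unfolding s_def by measurable
    show "integrable lborel (\<lambda>x. max M 0 * indicator (cball 0 (r + norm b)) x :: real)"
      using emeasure_lborel_cball_finite by (intro integrable_mult_right integrable_real_indicator) auto
    show "AE x in lborel. (\<lambda>n. s n x) \<longlonglongrightarrow> F' x"
    proof (rule AE_I2)
      fix x
      have "((\<lambda>h. (F (x + h *\<^sub>R b) - F x) / h) \<longlongrightarrow> F' x) (at 0)"
        using deriv[of x] by (simp add: DERIV_def)
      moreover have "filterlim h (at 0) sequentially"
        unfolding h_def[abs_def] filterlim_at
        using LIMSEQ_inverse_real_of_nat by (simp add: inverse_eq_divide)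
      ultimately show "(\<lambda>n. s n x) \<longlonglongrightarrow> F' x"
        unfolding s_def by (rule filterlim_compose)
    qed
  qed (use bound in auto)
  then have "(\<lambda>n. 0 :: real) \<longlonglongrightarrow> (LINT x|lborel. F' x)"
    by (simp add: s_int)
  then show ?thesis
    using LIMSEQ_unique tendsto_const by blast
qed

lemma C2_jet_support:
  assumes "C2_jet f G H" and f: "\<And>x. r < norm x \<Longrightarrow> f x = 0" and "r < norm x"
  shows "G x = 0" "H x v = 0"
proof -
  have S: "open {x::'a. r < norm x}"
    by (intro open_Collect_less continuous_intros)
  have G0: "G x = 0" if "r < norm x" for x
  proof -
    have "(f has_derivative (\<lambda>v. 0)) (at x)"
      by (rule has_derivative_transform_within_open[of "\<lambda>_. 0" _ _ _ "{x. r < norm x}"]) (use S that f in auto)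
    with C2_jetD(1)[OF assms(1)] have "(\<lambda>v. G x \<bullet> v) = (\<lambda>v. 0)"
      by (rule has_derivative_unique)
    then show ?thesis
      by (metis inner_eq_zero_iff)
  qed
  show "G x = 0"
    by (rule G0) fact
  have "(G has_derivative (\<lambda>v. 0)) (at x)"
    by (rule has_derivative_transform_within_open[of "\<lambda>_. 0" _ _ _ "{x. r < norm x}"]) (use S assms(3) G0 in auto)
  with C2_jetD(2)[OF assms(1)] have "H x = (\<lambda>v. 0)"
    by (rule has_derivative_unique)
  then show "H x v = 0"
    by simp
qed

text \<open>The Laplacian is moved from the test function to \<open>f\<close> one direction at a time:
  \<open>f \<partial>\<^sub>b\<^sub>b\<phi> - \<phi> \<partial>\<^sub>b\<^sub>bf\<close> is the derivative in direction \<open>b\<close> of \<open>f \<partial>\<^sub>b\<phi> - \<phi> \<partial>\<^sub>bf\<close>.\<close>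
lemma integral_trace_by_parts:
  assumes f: "C2_jet f G H" and \<phi>: "C2_jet \<phi> K L" and supp: "\<And>x. r < norm x \<Longrightarrow> \<phi> x = 0"
  shows "(LINT x|lborel. f x * trace_op (L x)) = (LINT x|lborel. trace_op (H x) * \<phi> x)"
proof -
  have i1: "integrable lborel (\<lambda>x. f x * (L x b \<bullet> b))" for b
    by (rule integrable_compact_support[where r = r])
       (intro continuous_intros C2_jet_continuous[OF f] C2_jetD(3)[OF \<phi>], simp add: C2_jet_support(2)[OF \<phi> supp])
  have i2: "integrable lborel (\<lambda>x. (H x b \<bullet> b) * \<phi> x)" for b
    by (rule integrable_compact_support[where r = r])
       (intro continuous_intros C2_jet_continuous[OF \<phi>] C2_jetD(3)[OF f], simp add: supp)
  have "(LINT x|lborel. f x * (L x b \<bullet> b) - (H x b \<bullet> b) * \<phi> x) = 0" for b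
  proof (rule integral_directional_derivative_eq_0[where F = "\<lambda>x. f x * (K x \<bullet> b) - \<phi> x * (G x \<bullet> b)" and b = b and r = r])
    show "((\<lambda>t. f (x + t *\<^sub>R b) * (K (x + t *\<^sub>R b) \<bullet> b) - \<phi> (x + t *\<^sub>R b) * (G (x + t *\<^sub>R b) \<bullet> b))
       has_real_derivative f x * (L x b \<bullet> b) - (H x b \<bullet> b) * \<phi> x) (at 0)" for x
      using DERIV_diff[OF DERIV_mult[OF C2_jet_line(1)[OF f, of x b 0] C2_jet_line(2)[OF \<phi>, of x b b 0]]
         DERIV_mult[OF C2_jet_line(1)[OF \<phi>, of x b 0] C2_jet_line(2)[OF f, of x b b 0]]]
      by (simp add: algebra_simps)
    show "continuous_on UNIV (\<lambda>x. f x * (K x \<bullet> b) - \<phi> x * (G x \<bullet> b))"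
      by (intro continuous_intros C2_jet_continuous[OF f] C2_jet_continuous[OF \<phi>])
    show "continuous_on UNIV (\<lambda>x. f x * (L x b \<bullet> b) - (H x b \<bullet> b) * \<phi> x)"
      by (intro continuous_intros C2_jet_continuous[OF f] C2_jet_continuous[OF \<phi>] C2_jetD(3)[OF f] C2_jetD(3)[OF \<phi>])
  qed (simp_all add: supp C2_jet_support[OF \<phi> supp])
  then have "(LINT x|lborel. f x * (L x b \<bullet> b)) = (LINT x|lborel. (H x b \<bullet> b) * \<phi> x)" for b
    by (simp add: Bochner_Integration.integral_diff[OF i1 i2])
  then show ?thesis
    unfolding trace_op_def sum_distrib_left sum_distrib_right
    by (simp add: Bochner_Integration.integral_sum i1 i2)
qed

section \<open>A maximum principle for functionals of the gradient\<close>

text \<open>If a second directional derivative were positive at a critical point, the first one would be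
  positive just after it, and the function would increase along that direction.\<close>
lemma C2_jet_local_max:
  assumes f: "C2_jet f G H" and r: "r > 0" and max: "\<And>y. y \<in> ball x r \<Longrightarrow> f y \<le> f x"
  shows "G x = 0" "H x v \<bullet> v \<le> 0"
proof -
  have near: "f (x + t *\<^sub>R w) \<le> f x" if "\<bar>t\<bar> < r / (norm w + 1)" for t w
  proof (rule max)
    have "\<bar>t\<bar> * norm w \<le> \<bar>t\<bar> * (norm w + 1)"
      by (simp add: mult_left_mono)
    also have "\<dots> < r"
      using that by (simp add: pos_less_divide_eq add_nonneg_pos)
    finally show "x + t *\<^sub>R w \<in> ball x r"
      by (simp add: dist_norm)
  qed
  have d: "r / (norm w + 1) > 0" for w :: 'a
    using r by (simp add: add_nonneg_pos)
  have G0: "G x \<bullet> w = 0" for w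
    using DERIV_local_max[OF C2_jet_line(1)[OF f, of x w 0] d[of w]] near[of _ w] by simp
  then show "G x = 0"
    by (metis inner_eq_zero_iff)
  show "H x v \<bullet> v \<le> 0"
  proof (rule ccontr)
    assume "\<not> H x v \<bullet> v \<le> 0"
    then obtain \<delta> where \<delta>: "\<delta> > 0" "\<And>h. 0 < h \<Longrightarrow> h < \<delta> \<Longrightarrow> G (x + 0 *\<^sub>R v) \<bullet> v < G (x + (0 + h) *\<^sub>R v) \<bullet> v"
      using DERIV_pos_inc_right[OF C2_jet_line(2)[OF f, of x v v 0]] by auto
    obtain t where t: "0 < t" "t < \<delta>" "t < r / (norm v + 1)"
      using \<delta>(1) d[of v] field_lbound_gt_zero by blast
    obtain z where z: "0 < z" "z < t" "f (x + t *\<^sub>R v) - f (x + 0 *\<^sub>R v) = (t - 0) * (G (x + z *\<^sub>R v) \<bullet> v)"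
      using MVT2[OF t(1) C2_jet_line(1)[OF f]] by blast
    have "0 < G (x + z *\<^sub>R v) \<bullet> v"
      using \<delta>(2)[of z] z t G0[of v] by simp
    with z t have "f x < f (x + t *\<^sub>R v)"
      by (simp add: algebra_simps)
    with near[of t v] t show False
      by simp
  qed
qed

lemma trace_op_local_max:
  assumes "C2_jet f G H" "r > 0" "\<And>y. y \<in> ball x r \<Longrightarrow> f y \<le> f x"
  shows "trace_op (H x) \<le> 0"
  unfolding trace_op_def by (rule sum_nonpos) (rule C2_jet_local_max(2)[OF assms])

text \<open>A maximum principle for a function \<open>F\<close> that is only approximated by \<open>C\<^sup>2\<close> functions, where \<open>L\<close> is the
  limit of their Laplacians.  Subtracting \<open>c|y - x|\<^sup>2\<close> makes the maximum of \<open>F\<close> strict, so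
  maximum points of the approximants converge to \<open>x\<close> and are eventually interior.  Convergence along
  all sequences \<open>\<eta>\<^sub>j \<rightarrow> 0\<close>, \<open>X\<^sub>j \<rightarrow> y\<close> replaces locally uniform convergence; it is easy to verify for
  difference quotients.\<close>
lemma limit_maximum_principle:
  fixes f :: "real \<Rightarrow> 'a::euclidean_space \<Rightarrow> real"
  assumes jets: "\<And>h. h > 0 \<Longrightarrow> C2_jet (f h) (G h) (H h)"
    and conv_f: "\<And>\<eta> X y. (\<And>j::nat. \<eta> j > 0) \<Longrightarrow> \<eta> \<longlonglongrightarrow> 0 \<Longrightarrow> X \<longlonglongrightarrow> y \<Longrightarrow> (\<lambda>j. f (\<eta> j) (X j)) \<longlonglongrightarrow> F y"
    and conv_L: "\<And>\<eta> X y. (\<And>j::nat. \<eta> j > 0) \<Longrightarrow> \<eta> \<longlonglongrightarrow> 0 \<Longrightarrow> X \<longlonglongrightarrow> y \<Longrightarrow> (\<lambda>j. trace_op (H (\<eta> j) (X j))) \<longlonglongrightarrow> L y"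
    and r: "r > 0" and max: "\<And>y. y \<in> cball x r \<Longrightarrow> F y \<le> F x"
  shows "L x \<le> 0"
proof -
  have "L x \<le> c * (2 * real DIM('a))" if c: "c > 0" for c
  proof -
    define \<eta> where "\<eta> j = 1 / real (Suc j)" for j
    have \<eta>: "\<eta> j > 0" "\<eta> \<longlonglongrightarrow> 0" for j
      using LIMSEQ_inverse_real_of_nat by (auto simp: \<eta>_def[abs_def] inverse_eq_divide)
    define g where "g j y = f (\<eta> j) y + (- c) * ((y - x) \<bullet> (y - x))" for j y
    have jet: "C2_jet (g j) (\<lambda>y. G (\<eta> j) y + (- c) *\<^sub>R (2 *\<^sub>R (y - x))) (\<lambda>y v. H (\<eta> j) y v + (- c) *\<^sub>R (2 *\<^sub>R v))" for j
      unfolding g_def[abs_def] by (intro C2_jet_add C2_jet_cmult C2_jet_sqdist jets \<eta>)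
    have "\<exists>z\<in>cball x r. \<forall>y\<in>cball x r. g j y \<le> g j z" for j
      using r C2_jet_continuous(1)[OF jet] by (intro continuous_attains_sup) auto
    then obtain X where X: "\<And>j. X j \<in> cball x r" "\<And>j y. y \<in> cball x r \<Longrightarrow> g j y \<le> g j (X j)"
      by metis
    obtain y \<sigma> where y: "y \<in> cball x r" "strict_mono \<sigma>" "(X \<circ> \<sigma>) \<longlonglongrightarrow> y"
      using compact_cball[of x r] X(1) unfolding compact_def by blast
    have \<eta>\<sigma>: "\<eta> (\<sigma> j) > 0" "(\<lambda>j. \<eta> (\<sigma> j)) \<longlonglongrightarrow> 0" for j
      using \<eta>(1) LIMSEQ_subseq_LIMSEQ[OF \<eta>(2) y(2)] by (auto simp: o_def)
    have X\<sigma>: "(\<lambda>j. X (\<sigma> j)) \<longlonglongrightarrow> y"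
      using y(3) by (simp add: o_def)
    have "F x \<le> F y + (- c) * ((y - x) \<bullet> (y - x))"
    proof (rule LIMSEQ_le)
      show "(\<lambda>j. f (\<eta> (\<sigma> j)) x) \<longlonglongrightarrow> F x"
        by (rule conv_f[OF \<eta>\<sigma> tendsto_const])
      show "(\<lambda>j. f (\<eta> (\<sigma> j)) (X (\<sigma> j)) + (- c) * ((X (\<sigma> j) - x) \<bullet> (X (\<sigma> j) - x))) \<longlonglongrightarrow> F y + (- c) * ((y - x) \<bullet> (y - x))"
        by (intro tendsto_intros conv_f[OF \<eta>\<sigma> X\<sigma>] X\<sigma>)
      have "f (\<eta> j) x \<le> f (\<eta> j) (X j) + (- c) * ((X j - x) \<bullet> (X j - x))" for j
        using X(2)[of x j] r by (simp add: g_def)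
      then show "\<exists>N. \<forall>n\<ge>N. f (\<eta> (\<sigma> n)) x \<le> f (\<eta> (\<sigma> n)) (X (\<sigma> n)) + (- c) * ((X (\<sigma> n) - x) \<bullet> (X (\<sigma> n) - x))"
        by blast
    qed
    with max[OF y(1)] have "c * ((y - x) \<bullet> (y - x)) \<le> 0"
      by simp
    then have "(y - x) \<bullet> (y - x) \<le> 0"
      using c by (simp add: mult_le_0_iff)
    then have yx: "y = x"
      using inner_ge_zero[of "y - x"] inner_eq_zero_iff[of "y - x"] by simp
    have "\<forall>\<^sub>F j in sequentially. X (\<sigma> j) \<in> ball x r"
      using X\<sigma> yx r by (intro topological_tendstoD) auto
    then have ev: "\<forall>\<^sub>F j in sequentially. trace_op (H (\<eta> (\<sigma> j)) (X (\<sigma> j))) \<le> c * (2 * real DIM('a))"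
    proof eventually_elim
      case (elim j)
      define \<rho> where "\<rho> = r - dist x (X (\<sigma> j))"
      have "\<rho> > 0"
        using elim by (simp add: \<rho>_def)
      have "trace_op (\<lambda>v. H (\<eta> (\<sigma> j)) (X (\<sigma> j)) v + (- c) *\<^sub>R (2 *\<^sub>R v)) \<le> 0"
      proof (rule trace_op_local_max[OF jet \<open>\<rho> > 0\<close>])
        fix z assume "z \<in> ball (X (\<sigma> j)) \<rho>"
        then have "z \<in> cball x r"
          using dist_triangle[of x z "X (\<sigma> j)"] by (simp add: \<rho>_def)
        then show "g (\<sigma> j) z \<le> g (\<sigma> j) (X (\<sigma> j))"
          by (rule X(2))
      qed
      then show ?case
        unfolding trace_op_simps by simp
    qed
    show ?thesis
      by (rule tendsto_upperbound[OF conv_L[OF \<eta>\<sigma> X\<sigma>[unfolded yx]] ev]) simp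
  qed
  then have "L x \<le> 0 + e" if "e > 0" for e
  proof -
    have "e / (2 * real DIM('a)) > 0"
      using that by simp
    from \<open>\<And>c. c > 0 \<Longrightarrow> L x \<le> c * (2 * real DIM('a))\<close>[OF this] show ?thesis
      by simp
  qed
  then show ?thesis
    by (rule field_le_epsilon)
qed

lemma difference_quotient_tendsto:
  fixes w w' :: "'a::real_normed_vector \<Rightarrow> real"
  assumes deriv: "\<And>x t. ((\<lambda>t. w (x + t *\<^sub>R v)) has_real_derivative w' (x + t *\<^sub>R v)) (at t)"
    and cont: "continuous_on UNIV w'"
    and \<eta>: "\<And>j::nat. \<eta> j > 0" "\<eta> \<longlonglongrightarrow> 0" and X: "X \<longlonglongrightarrow> y"
  shows "(\<lambda>j. (w (X j + \<eta> j *\<^sub>R v) - w (X j)) / \<eta> j) \<longlonglongrightarrow> w' y"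
proof -
  have "\<exists>z. 0 < z \<and> z < \<eta> j \<and> (w (X j + \<eta> j *\<^sub>R v) - w (X j)) / \<eta> j = w' (X j + z *\<^sub>R v)" for j
  proof -
    obtain z where "0 < z" "z < \<eta> j" "w (X j + \<eta> j *\<^sub>R v) - w (X j + 0 *\<^sub>R v) = (\<eta> j - 0) * w' (X j + z *\<^sub>R v)"
      using MVT2[OF \<eta>(1) deriv] by blast
    then show ?thesis
      using \<eta>(1)[of j] by (intro exI[of _ z]) (simp add: field_simps)
  qed
  then obtain z where z: "\<And>j. 0 < z j" "\<And>j. z j < \<eta> j"
    "\<And>j. (w (X j + \<eta> j *\<^sub>R v) - w (X j)) / \<eta> j = w' (X j + z j *\<^sub>R v)"
    by metis
  have "z \<longlonglongrightarrow> 0"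
    by (rule tendsto_sandwich[OF _ _ tendsto_const \<eta>(2)]) (auto intro!: always_eventually less_imp_le z)
  then have "(\<lambda>j. X j + z j *\<^sub>R v) \<longlonglongrightarrow> y + 0 *\<^sub>R v"
    by (intro tendsto_intros X)
  then have "(\<lambda>j. w' (X j + z j *\<^sub>R v)) \<longlonglongrightarrow> w' y"
    using continuous_on_tendsto_compose[OF cont] by simp
  then show ?thesis
    by (simp add: z(3))
qed

text \<open>Formally the second inequality says that the Laplacian of \<open>a|\<nabla>u|\<^sup>2/2 + b\<close> is nonpositive at a
  maximum, with \<open>\<Delta>\<nabla>u\<close> replaced by \<open>W''(u)\<nabla>u\<close>.  Third derivatives of \<open>u\<close> are avoided by replacing \<open>\<nabla>u\<close>
  with difference quotients of step \<open>h\<close>: these are \<open>C\<^sup>2\<close>, and by the equation their Laplacian is the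
  difference quotient of \<open>W'(u)\<close>.\<close>
lemma gradient_functional_max:
  fixes u :: "'a::euclidean_space \<Rightarrow> real"
  assumes u: "C2_jet u G H" and eq: "\<And>x. trace_op (H x) = W' (u x)"
    and W': "\<And>t. (W' has_real_derivative W'' t) (at t)" and W'': "continuous_on UNIV W''"
    and a: "C2_jet a A A2" and b: "C2_jet b B B2"
    and r: "r > 0"
    and max: "\<And>y. y \<in> cball x r \<Longrightarrow> a y * (G y \<bullet> G y) / 2 + b y \<le> a x * (G x \<bullet> G x) / 2 + b x"
  shows "a x *\<^sub>R H x (G x) + ((G x \<bullet> G x) / 2) *\<^sub>R A x + B x = 0"
    and "trace_op (A2 x) * (G x \<bullet> G x) / 2 + 2 * (A x \<bullet> H x (G x)) +
      a x * ((\<Sum>i\<in>Basis. H x i \<bullet> H x i) + W'' (u x) * (G x \<bullet> G x)) + trace_op (B2 x) \<le> 0"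
proof -
  let ?F = "\<lambda>y. a y * (G y \<bullet> G y) / 2 + b y"
  have F': "(?F has_derivative (\<lambda>v. (a x *\<^sub>R H x (G x) + ((G x \<bullet> G x) / 2) *\<^sub>R A x + B x) \<bullet> v)) (at x)"
  proof -
    have "((\<lambda>y. 1 / 2 * (a y * (G y \<bullet> G y)) + b y) has_derivative
        (\<lambda>v. 1 / 2 * (a x * (G x \<bullet> H x v + H x v \<bullet> G x) + (A x \<bullet> v) * (G x \<bullet> G x)) + B x \<bullet> v)) (at x)"
      by (rule has_derivative_add has_derivative_mult_right has_derivative_mult has_derivative_inner
          C2_jetD[OF u] C2_jetD[OF a] C2_jetD[OF b])+ 
    moreover have "1 / 2 * (a x * (G x \<bullet> H x v + H x v \<bullet> G x) + (A x \<bullet> v) * (G x \<bullet> G x)) + B x \<bullet> v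
      = (a x *\<^sub>R H x (G x) + ((G x \<bullet> G x) / 2) *\<^sub>R A x + B x) \<bullet> v" for v
      using C2_jet_symmetric[OF u, of x v "G x"]
      by (simp add: inner_add_left inner_commute[of "G x" "H x v"] algebra_simps)
    ultimately show ?thesis
      by simp
  qed
  have "(\<lambda>v. (a x *\<^sub>R H x (G x) + ((G x \<bullet> G x) / 2) *\<^sub>R A x + B x) \<bullet> v) = (\<lambda>v. 0)"
    by (rule differential_zero_maxmin[OF _ open_ball F', of x r]) (use r max in auto)
  then show "a x *\<^sub>R H x (G x) + ((G x \<bullet> G x) / 2) *\<^sub>R A x + B x = 0"
    by (metis inner_eq_zero_iff)

  define v where "v i h y = (1 / h) * (u (y + h *\<^sub>R i) + (- 1) * u y)" for i h y
  define g where "g i h y = (1 / h) *\<^sub>R (G (y + h *\<^sub>R i) + (- 1) *\<^sub>R G y)" for i h y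
  define k where "k i h y w = (1 / h) *\<^sub>R (H (y + h *\<^sub>R i) w + (- 1) *\<^sub>R H y w)" for i h y w
  have v_jet: "C2_jet (v i h) (g i h) (k i h)" for i h
    unfolding v_def[abs_def] g_def[abs_def] k_def[abs_def]
    using C2_jet_affine[OF u, of 1 "h *\<^sub>R i"]
    by (intro C2_jet_cmult C2_jet_add u) simp
  have jets: "C2_jet (\<lambda>x. a x * (\<Sum>i\<in>Basis. 1 / 2 * (v i h x * v i h x)) + b x)
      (\<lambda>x. a x *\<^sub>R (\<Sum>i\<in>Basis. (1 / 2) *\<^sub>R (v i h x *\<^sub>R g i h x + v i h x *\<^sub>R g i h x))
        + (\<Sum>i\<in>Basis. 1 / 2 * (v i h x * v i h x)) *\<^sub>R A x + B x)
      (\<lambda>x w. a x *\<^sub>R (\<Sum>i\<in>Basis. (1 / 2) *\<^sub>R (v i h x *\<^sub>R k i h x w + (g i h x \<bullet> w) *\<^sub>R g i h x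
            + (v i h x *\<^sub>R k i h x w + (g i h x \<bullet> w) *\<^sub>R g i h x)))
          + (A x \<bullet> w) *\<^sub>R (\<Sum>i\<in>Basis. (1 / 2) *\<^sub>R (v i h x *\<^sub>R g i h x + v i h x *\<^sub>R g i h x))
          + ((\<Sum>i\<in>Basis. 1 / 2 * (v i h x * v i h x)) *\<^sub>R A2 x w
            + ((\<Sum>i\<in>Basis. (1 / 2) *\<^sub>R (v i h x *\<^sub>R g i h x + v i h x *\<^sub>R g i h x)) \<bullet> w) *\<^sub>R A x)
          + B2 x w)" for h
    by (intro C2_jet_add C2_jet_mult C2_jet_sum C2_jet_cmult v_jet a b)
  have v_lim: "(\<lambda>j. v i (\<eta> j) (X j)) \<longlonglongrightarrow> G y \<bullet> i"
    if "\<And>j::nat. \<eta> j > 0" "\<eta> \<longlonglongrightarrow> 0" "X \<longlonglongrightarrow> y" for i \<eta> X y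
  proof -
    have "(\<lambda>j. (u (X j + \<eta> j *\<^sub>R i) - u (X j)) / \<eta> j) \<longlonglongrightarrow> G y \<bullet> i"
      by (rule difference_quotient_tendsto[OF C2_jet_line(1)[OF u] _ that])
         (intro continuous_intros C2_jet_continuous[OF u])
    then show ?thesis
      by (simp add: v_def)
  qed
  have g_lim: "(\<lambda>j. g i (\<eta> j) (X j)) \<longlonglongrightarrow> H y i"
    if "\<And>j::nat. \<eta> j > 0" "\<eta> \<longlonglongrightarrow> 0" "X \<longlonglongrightarrow> y" for i \<eta> X y
  proof (subst tendsto_componentwise_iff, rule ballI)
    fix c :: 'a assume "c \<in> Basis"
    have "(\<lambda>j. (G (X j + \<eta> j *\<^sub>R i) \<bullet> c - G (X j) \<bullet> c) / \<eta> j) \<longlonglongrightarrow> H y i \<bullet> c"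
      by (rule difference_quotient_tendsto[where w = "\<lambda>x. G x \<bullet> c", OF C2_jet_line(2)[OF u] _ that])
         (intro continuous_intros C2_jetD(3)[OF u])
    then show "(\<lambda>j. g i (\<eta> j) (X j) \<bullet> c) \<longlonglongrightarrow> H y i \<bullet> c"
      by (simp add: g_def inner_diff_left)
  qed
  have k_lim: "(\<lambda>j. trace_op (k i (\<eta> j) (X j))) \<longlonglongrightarrow> W'' (u y) * (G y \<bullet> i)"
    if "\<And>j::nat. \<eta> j > 0" "\<eta> \<longlonglongrightarrow> 0" "X \<longlonglongrightarrow> y" for i \<eta> X y
  proof -
    have "(\<lambda>j. (W' (u (X j + \<eta> j *\<^sub>R i)) - W' (u (X j))) / \<eta> j) \<longlonglongrightarrow> W'' (u y) * (G y \<bullet> i)"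
      by (rule difference_quotient_tendsto[where w = "\<lambda>x. W' (u x)", OF DERIV_chain2[OF W' C2_jet_line(1)[OF u]] _ that])
         (intro continuous_intros C2_jet_continuous[OF u] continuous_on_compose2[OF W'' C2_jet_continuous(1)[OF u]] subset_UNIV)
    moreover have "trace_op (k i h y) = (W' (u (y + h *\<^sub>R i)) - W' (u y)) / h" for h y
      unfolding k_def[abs_def] trace_op_simps by (simp add: eq)
    ultimately show ?thesis
      by simp
  qed
  have cont_lim: "(\<lambda>j. f (X j)) \<longlonglongrightarrow> f y" if "continuous_on UNIV f" "X \<longlonglongrightarrow> y"
    for f :: "'a \<Rightarrow> 'b::topological_space" and X y
    using continuous_on_tendsto_compose[OF that] by simp
  let ?L = "\<lambda>y. trace_op (A2 y) * (G y \<bullet> G y) / 2 + 2 * (A y \<bullet> H y (G y)) +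
      a y * ((\<Sum>i\<in>Basis. H y i \<bullet> H y i) + W'' (u y) * (G y \<bullet> G y)) + trace_op (B2 y)"
  show "?L x \<le> 0"
  proof (rule limit_maximum_principle[where L = ?L and F = ?F, OF jets _ _ r max])
    fix \<eta> :: "nat \<Rightarrow> real" and X :: "nat \<Rightarrow> 'a" and y :: 'a
    assume \<eta>: "\<And>j. \<eta> j > 0" "\<eta> \<longlonglongrightarrow> 0" and X: "X \<longlonglongrightarrow> y"
    have "(\<lambda>j. a (X j) * (\<Sum>i\<in>Basis. 1 / 2 * (v i (\<eta> j) (X j) * v i (\<eta> j) (X j))) + b (X j))
      \<longlonglongrightarrow> a y * (\<Sum>i\<in>Basis. 1 / 2 * ((G y \<bullet> i) * (G y \<bullet> i))) + b y"
      by (intro tendsto_intros v_lim[OF \<eta> X] cont_lim[OF C2_jet_continuous(1)[OF a] X] cont_lim[OF C2_jet_continuous(1)[OF b] X])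
    then show "(\<lambda>j. a (X j) * (\<Sum>i\<in>Basis. 1 / 2 * (v i (\<eta> j) (X j) * v i (\<eta> j) (X j))) + b (X j)) \<longlonglongrightarrow> ?F y"
      by (simp add: sum_divide_distrib[symmetric] euclidean_inner[symmetric])
    have Hexp: "(\<Sum>i\<in>Basis. (G y \<bullet> i) *\<^sub>R H y i) = H y (G y)"
      using linear_Basis_expansion[OF C2_jet_linear[OF u]] by metis
    have Gexp: "(\<Sum>i\<in>Basis. (G y \<bullet> i) * (G y \<bullet> i)) = G y \<bullet> G y"
      by (rule euclidean_inner[symmetric])
    let ?v = "\<lambda>j i. v i (\<eta> j) (X j)" and ?g = "\<lambda>j i. g i (\<eta> j) (X j)" and ?k = "\<lambda>j i. trace_op (k i (\<eta> j) (X j))"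
    have "(\<lambda>j. a (X j) * (\<Sum>i\<in>Basis. ?v j i * ?k j i + ?g j i \<bullet> ?g j i) + 2 * (A (X j) \<bullet> (\<Sum>i\<in>Basis. ?v j i *\<^sub>R ?g j i))
        + (\<Sum>i\<in>Basis. ?v j i * ?v j i) / 2 * trace_op (A2 (X j)) + trace_op (B2 (X j)))
      \<longlonglongrightarrow> a y * (\<Sum>i\<in>Basis. (G y \<bullet> i) * (W'' (u y) * (G y \<bullet> i)) + H y i \<bullet> H y i) + 2 * (A y \<bullet> (\<Sum>i\<in>Basis. (G y \<bullet> i) *\<^sub>R H y i))
        + (\<Sum>i\<in>Basis. (G y \<bullet> i) * (G y \<bullet> i)) / 2 * trace_op (A2 y) + trace_op (B2 y)"
      by (intro tendsto_intros v_lim[OF \<eta> X] g_lim[OF \<eta> X] k_lim[OF \<eta> X]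
           cont_lim[OF C2_jet_continuous(1)[OF a] X] cont_lim[OF C2_jet_continuous(2)[OF a] X]
           cont_lim[OF C2_jet_continuous_trace[OF a continuous_on_id] X] cont_lim[OF C2_jet_continuous_trace[OF b continuous_on_id] X]) simp
    also have "a y * (\<Sum>i\<in>Basis. (G y \<bullet> i) * (W'' (u y) * (G y \<bullet> i)) + H y i \<bullet> H y i) + 2 * (A y \<bullet> (\<Sum>i\<in>Basis. (G y \<bullet> i) *\<^sub>R H y i))
        + (\<Sum>i\<in>Basis. (G y \<bullet> i) * (G y \<bullet> i)) / 2 * trace_op (A2 y) + trace_op (B2 y) = ?L y"
      unfolding Hexp Gexp[symmetric]
      by (simp add: sum.distrib sum_distrib_left algebra_simps)
    finally show "(\<lambda>j. trace_op (\<lambda>w. a (X j) *\<^sub>R (\<Sum>i\<in>Basis. (1/2) *\<^sub>R (?v j i *\<^sub>R k i (\<eta> j) (X j) w + (?g j i \<bullet> w) *\<^sub>R ?g j i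
            + (?v j i *\<^sub>R k i (\<eta> j) (X j) w + (?g j i \<bullet> w) *\<^sub>R ?g j i)))
          + (A (X j) \<bullet> w) *\<^sub>R (\<Sum>i\<in>Basis. (1/2) *\<^sub>R (?v j i *\<^sub>R ?g j i + ?v j i *\<^sub>R ?g j i))
          + ((\<Sum>i\<in>Basis. 1/2 * (?v j i * ?v j i)) *\<^sub>R A2 (X j) w + ((\<Sum>i\<in>Basis. (1/2) *\<^sub>R (?v j i *\<^sub>R ?g j i + ?v j i *\<^sub>R ?g j i)) \<bullet> w) *\<^sub>R A (X j))
          + B2 (X j) w)) \<longlonglongrightarrow> ?L y"
      unfolding trace_op_simps
      by (simp add: scaleR_2[symmetric] sum_divide_distrib[symmetric] inner_commute algebra_simps)
  qed
qed

section \<open>Compactly supported test functions\<close>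

text \<open>Since \<open>p' 0 = 0\<close>, gluing \<open>p\<close> at the origin to a constant keeps it differentiable.\<close>
lemma deriv_comp_pos_part:
  fixes p p' :: "real \<Rightarrow> real"
  assumes p: "\<And>v. 0 \<le> v \<Longrightarrow> (p has_real_derivative p' v) (at v)" and "p' 0 = 0"
  shows "((\<lambda>y. p (max 0 y)) has_real_derivative p' (max 0 y)) (at y)"
proof -
  consider "y > 0" | "y < 0" | "y = 0" by linarith
  then show ?thesis
  proof cases
    case 1
    have "((\<lambda>y. p (max 0 y)) has_real_derivative p' y) (at y)"
    proof (rule has_field_derivative_transform_within_open[OF p open_greaterThan])
      show "p x = p (max 0 x)" if "x \<in> {0<..}" for x
        using that by (simp add: max_absorb2)
    qed (use 1 in auto)
    with 1 show ?thesis by (simp add: max_absorb2)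
  next
    case 2
    have "((\<lambda>y. p (max 0 y)) has_real_derivative 0) (at y)"
    proof (rule has_field_derivative_transform_within_open[OF DERIV_const open_lessThan])
      show "p 0 = p (max 0 x)" if "x \<in> {..<0}" for x
        using that by (simp add: max_absorb1)
    qed (use 2 in auto)
    with 2 assms(2) show ?thesis by (simp add: max_absorb1)
  next
    case 3
    have "((\<lambda>h. (p h - p 0) / h) \<longlongrightarrow> 0) (at 0)"
      using p[of 0] assms(2) by (simp add: DERIV_def)
    then have lim: "((\<lambda>h. \<bar>(p h - p 0) / h\<bar>) \<longlongrightarrow> 0) (at 0)"
      by (rule tendsto_rabs_zero)
    have "norm ((p (max 0 h) - p 0) / h) \<le> \<bar>(p h - p 0) / h\<bar>" for h
      by (cases "h \<ge> 0") (simp_all add: max_def del: abs_divide)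
    then have "((\<lambda>h. (p (max 0 h) - p 0) / h) \<longlongrightarrow> 0) (at 0)"
      by (intro Lim_null_comparison[OF _ lim] always_eventually allI)
    with 3 assms(2) show ?thesis
      by (simp add: DERIV_def)
  qed
qed

lemma deriv_comp_pos_part_affine:
  fixes p p' :: "real \<Rightarrow> real"
  assumes "\<And>v. 0 \<le> v \<Longrightarrow> (p has_real_derivative p' v) (at v)" "p' 0 = 0"
  shows "((\<lambda>t. p (max 0 (k + m * t))) has_real_derivative p' (max 0 (k + m * t)) * m) (at t)"
proof -
  have "((\<lambda>t. k + m * t) has_real_derivative m) (at t)"
    by (auto intro!: derivative_eq_intros)
  then show ?thesis
    using DERIV_chain2[OF deriv_comp_pos_part[of p p'], of "\<lambda>t. k + m * t"] assms by blast
qed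

definition bump :: "real \<Rightarrow> 'a::euclidean_space \<Rightarrow> 'a \<Rightarrow> real" where
  "bump k c x = (max 0 (k - (x - c) \<bullet> (x - c))) ^ 3"

lemma bump_C2:
  obtains K L where "C2_jet (bump k c) K L"
proof -
  have d: "((\<lambda>v. v ^ 3) has_real_derivative 3 * v ^ 2) (at v)"
    "((\<lambda>v. - 3 * v ^ 2) has_real_derivative - 6 * v) (at v)" for v :: real
    by (auto intro!: derivative_eq_intros)
  have 1: "((\<lambda>s. (max 0 (k - s)) ^ 3) has_real_derivative - 3 * (max 0 (k - s)) ^ 2) (at s)" for s :: real
    using deriv_comp_pos_part_affine[OF d(1), of k "-1" s] by simp
  have 2: "((\<lambda>s. - 3 * (max 0 (k - s)) ^ 2) has_real_derivative 6 * max 0 (k - s)) (at s)" for s :: real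
    using deriv_comp_pos_part_affine[OF d(2), of k "-1" s] by simp
  have 3: "continuous_on UNIV (\<lambda>s. 6 * max 0 (k - s))"
    by (intro continuous_intros)
  show ?thesis
    using that C2_jet_compose[OF C2_jet_sqdist[of c] 1 2 3] unfolding bump_def[abs_def] by blast
qed

lemma bump_nonneg: "0 \<le> bump k c x"
  by (simp add: bump_def)

lemma bump_pos_iff:
  assumes "r > 0"
  shows "0 < bump (r ^ 2) c x \<longleftrightarrow> x \<in> ball c r"
proof -
  have "0 < bump (r ^ 2) c x \<longleftrightarrow> (x - c) \<bullet> (x - c) < r ^ 2"
    by (auto simp: bump_def max_def)
  also have "\<dots> \<longleftrightarrow> norm (x - c) < r"
    using assms by (simp add: norm_lt_square)
  finally show ?thesis
    by (simp add: dist_norm norm_minus_commute)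
qed

lemma set_integrable_ball:
  fixes f :: "'a::euclidean_space \<Rightarrow> real"
  assumes "continuous_on UNIV f"
  shows "set_integrable lborel (ball c R) f"
proof (rule set_integrable_subset)
  show "set_integrable lborel (cball c R) f"
    unfolding set_integrable_def
    using assms by (intro borel_integrable_compact) (auto intro: continuous_on_subset)
qed (auto intro: ball_subset_cball)

text \<open>Null sets have empty interior, so a continuous function that vanishes almost everywhere vanishes.\<close>
lemma integral_eq_0_imp_zero:
  fixes f :: "'a::euclidean_space \<Rightarrow> real"
  assumes cont: "continuous_on UNIV f" and "\<And>x. 0 \<le> f x" and "integrable lborel f"
    and "(LINT x|lborel. f x) = 0"
  shows "f x = 0"
proof -
  have "AE x in lborel. f x = 0"
    using integral_nonneg_eq_0_iff_AE[OF assms(3)] assms(2,4) by simp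
  then have "AE x in lebesgue. x \<in> {x. f x = 0}"
    by (simp add: AE_completion)
  moreover have "closed {x. f x = 0}"
    using cont by (intro closed_Collect_eq) auto
  ultimately show ?thesis
    using mem_closed_if_AE_lebesgue by blast
qed

lemma C2_jet_support_trace:
  assumes "C2_jet \<phi> K L" "\<And>x. r < norm x \<Longrightarrow> \<phi> x = 0" "r < norm x"
  shows "trace_op (L x) = 0"
  unfolding trace_op_def using C2_jet_support(2)[OF assms] by simp

lemma trace_op_bounded:
  assumes "C2_jet \<phi> K L" "\<And>x. r < norm x \<Longrightarrow> \<phi> x = 0"
  obtains B where "\<And>x. \<bar>trace_op (L x)\<bar> \<le> B" "B \<ge> 0"
proof -
  have "compact ((\<lambda>x. trace_op (L x)) ` cball 0 r)"
    using C2_jet_continuous_trace[OF assms(1) continuous_on_id] by (intro compact_continuous_image) auto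
  then obtain B where B: "\<And>x. x \<in> cball 0 r \<Longrightarrow> norm (trace_op (L x)) \<le> B"
    by (meson bounded_iff compact_imp_bounded imageI)
  have "\<bar>trace_op (L x)\<bar> \<le> max B 0" for x
  proof (cases "norm x \<le> r")
    case True
    then show ?thesis using B[of x] by auto
  next
    case False
    then show ?thesis
      using C2_jet_support_trace[OF assms] by simp
  qed
  then show ?thesis
    using that[of "max B 0"] by simp
qed

section \<open>The Allen-Cahn equation: solutions are bounded by one\<close>

text \<open>The function \<open>v\<^sup>3/(1+v)\<close> of \<open>v = max(0, t-1)\<close>.  The cubic numerator makes it \<open>C\<^sup>2\<close> at \<open>t = 1\<close>, and the
  denominator keeps the growth quadratic.\<close>
lemma convex_quadratic_profile:
  obtains a a' a'' :: "real \<Rightarrow> real" where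
    "\<And>t. (a has_real_derivative a' t) (at t)" "\<And>t. (a' has_real_derivative a'' t) (at t)"
    "continuous_on UNIV a''" "\<And>t. 0 \<le> a'' t"
    "\<And>t. 0 \<le> a t" "\<And>t. a t \<le> (max 0 (t - 1))\<^sup>2"
    "\<And>t. t \<le> 1 \<Longrightarrow> a' t = 0" "\<And>t. 1 < t \<Longrightarrow> 0 < a' t"
proof -
  define p where "p v = v ^ 2 - v + 1 - 1 / (1 + v)" for v :: real
  define p' where "p' v = 2 * v - 1 + 1 / (1 + v) ^ 2" for v :: real
  define p'' where "p'' v = 2 - 2 / (1 + v) ^ 3" for v :: real
  have p_deriv: "(p has_real_derivative p' v) (at v)" "(p' has_real_derivative p'' v) (at v)" if "0 \<le> v" for v
    using that unfolding p_def[abs_def] p'_def[abs_def] p''_def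
    by (auto intro!: derivative_eq_intros simp: field_simps power2_eq_square power3_eq_cube add_nonneg_eq_0_iff)
  have p_eq: "p v = v ^ 3 / (1 + v)" "p' v = (3 * v ^ 2 + 2 * v ^ 3) / (1 + v) ^ 2" if "0 \<le> v" for v
    using that by (simp_all add: p_def p'_def field_simps power2_eq_square power3_eq_cube add_nonneg_eq_0_iff)
  have p_le: "p v \<le> v ^ 2" if "0 \<le> v" for v
    using that by (simp add: p_eq field_simps power2_eq_square power3_eq_cube)
  have p''_nonneg: "0 \<le> p'' v" if "0 \<le> v" for v
    using that by (simp add: p''_def field_simps)
  define a where "a t = p (max 0 (t - 1))" for t
  define a' where "a' t = p' (max 0 (t - 1))" for t
  define a'' where "a'' t = p'' (max 0 (t - 1))" for t
  have a_deriv: "(a has_real_derivative a' t) (at t)" for t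
    unfolding a_def[abs_def] a'_def
    using deriv_comp_pos_part_affine[of p p' "-1" 1 t] p_deriv by (simp add: p'_def)
  have a'_deriv: "(a' has_real_derivative a'' t) (at t)" for t
    unfolding a'_def[abs_def] a''_def
    using deriv_comp_pos_part_affine[of p' p'' "-1" 1 t] p_deriv by (simp add: p''_def)
  have a''_cont: "continuous_on UNIV a''"
    unfolding a''_def[abs_def] p''_def by (intro continuous_intros) (simp add: add_nonneg_eq_0_iff)
  have a_nonneg: "0 \<le> a t" for t
    by (simp add: a_def p_eq)
  show ?thesis
  proof (rule that[OF a_deriv a'_deriv a''_cont])
    show "0 \<le> a'' t" for t
      by (simp add: a''_def p''_nonneg)
    show "0 \<le> a t" for t
      by (rule a_nonneg)
    show "a t \<le> (max 0 (t - 1))\<^sup>2" for t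
      unfolding a_def by (rule p_le) simp
    show "a' t = 0" if "t \<le> 1" for t
      using that by (simp add: a'_def p'_def max_absorb1)
    show "0 < a' t" if t: "1 < t" for t
    proof -
      have "0 < t - 1"
        using t by simp
      then show ?thesis
        by (auto simp: a'_def p_eq intro!: divide_pos_pos add_pos_pos)
    qed
  qed
qed

locale allen_cahn =
  fixes W W' W'' :: "real \<Rightarrow> real" and u :: "'a::euclidean_space \<Rightarrow> real"
    and G :: "'a \<Rightarrow> 'a" and H :: "'a \<Rightarrow> 'a \<Rightarrow> 'a"
  assumes u: "C2_jet u G H"
    and eq: "\<And>x. trace_op (H x) = W' (u x)"
    and W': "\<And>t. (W has_real_derivative W' t) (at t)"
    and W'': "\<And>t. (W' has_real_derivative W'' t) (at t)"
    and W''_cont: "continuous_on UNIV W''"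
begin

lemma W_cont: "continuous_on S W" "continuous_on S W'"
  using W' W'' by (meson DERIV_isCont continuous_at_imp_continuous_on)+

lemma Wu_cont: "continuous_on S (\<lambda>x. W (u x))" "continuous_on S (\<lambda>x. W' (u x))"
  by (rule continuous_on_compose2[OF W_cont(1)[of UNIV] C2_jet_continuous(1)[OF u]]
     continuous_on_compose2[OF W_cont(2)[of UNIV] C2_jet_continuous(1)[OF u]]; simp)+

text \<open>For the convex profile \<open>a\<close> above, \<open>\<Delta>a(u) \<ge> a'(u)W'(u)\<close>, and the right-hand side is nonnegative because
  \<open>W\<close> is convex beyond \<open>1\<close>.  Test with a cutoff of radius \<open>R\<close>, whose Laplacian is of order \<open>1/R\<^sup>2\<close>.
  Since \<open>a(u)\<close> is at most a multiple of \<open>W(u)\<close>, whose integral grows linearly, the tested integral is at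
  most of order \<open>1/R\<close>; the cutoffs increase with \<open>R\<close>, so it vanishes.\<close>
lemma solution_le_1:
  assumes W_nonneg: "\<And>t. 0 \<le> W t" and W1: "W 1 = 0"
    and \<kappa>: "\<kappa> > 0" "\<And>t. 1 \<le> t \<Longrightarrow> \<kappa> \<le> W'' t"
    and energy: "\<And>R. R > 0 \<Longrightarrow> (LINT x:ball 0 R|lborel. W (u x)) \<le> C * R"
  shows "u x \<le> 1"
proof -
  have W'1: "W' 1 = 0"
    using DERIV_local_min[OF W' zero_less_one] W_nonneg W1 by auto
  have W'_ge: "\<kappa> * (t - 1) \<le> W' t" if "1 \<le> t" for t
  proof -
    have "W' 1 - \<kappa> * (1 - 1) \<le> W' t - \<kappa> * (t - 1)"
    proof (rule DERIV_nonneg_imp_nondecreasing[OF that])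
      fix s :: real assume "1 \<le> s"
      then show "\<exists>y. ((\<lambda>t. W' t - \<kappa> * (t - 1)) has_real_derivative y) (at s) \<and> 0 \<le> y"
        using \<kappa>(2)[of s] by (intro exI[of _ "W'' s - \<kappa>"]) (auto intro!: derivative_eq_intros W'')
    qed
    then show ?thesis by (simp add: W'1)
  qed
  have W_ge: "\<kappa> / 2 * (t - 1) ^ 2 \<le> W t" if "1 \<le> t" for t
  proof -
    have "W 1 - \<kappa> / 2 * (1 - 1) ^ 2 \<le> W t - \<kappa> / 2 * (t - 1) ^ 2"
    proof (rule DERIV_nonneg_imp_nondecreasing[OF that])
      fix s :: real assume "1 \<le> s"
      then show "\<exists>y. ((\<lambda>t. W t - \<kappa> / 2 * (t - 1) ^ 2) has_real_derivative y) (at s) \<and> 0 \<le> y"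
        using W'_ge[of s] by (intro exI[of _ "W' s - \<kappa> * (s - 1)"]) (auto intro!: derivative_eq_intros W')
    qed
    then show ?thesis by (simp add: W1)
  qed
  obtain a a' a'' where a_deriv: "\<And>t. (a has_real_derivative a' t) (at t)"
    and a'_deriv: "\<And>t. (a' has_real_derivative a'' t) (at t)"
    and a''_cont: "continuous_on UNIV a''" and a''_nonneg: "\<And>t. 0 \<le> a'' t"
    and a_nonneg: "\<And>t. 0 \<le> a t" and a_sq: "\<And>t. a t \<le> (max 0 (t - 1))\<^sup>2"
    and a'_zero: "\<And>t. t \<le> 1 \<Longrightarrow> a' t = 0" and a'_pos: "\<And>t. 1 < t \<Longrightarrow> 0 < a' t"
    by (rule convex_quadratic_profile) (rule that; assumption)
  have a_le: "a t \<le> 2 / \<kappa> * W t" for t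
  proof (cases "1 \<le> t")
    case True
    then have "a t \<le> (t - 1) ^ 2"
      using a_sq[of t] by simp
    also have "\<dots> \<le> 2 / \<kappa> * W t"
      using W_ge[OF True] \<kappa>(1) by (simp add: field_simps)
    finally show ?thesis .
  next
    case False
    then have "a t \<le> 0"
      using a_sq[of t] by simp
    also have "0 \<le> 2 / \<kappa> * W t"
      using W_nonneg[of t] \<kappa>(1) by simp
    finally show ?thesis .
  qed
  define q where "q x = a' (u x) * W' (u x)" for x
  have q_nonneg: "0 \<le> q x" for x
  proof (cases "1 \<le> u x")
    case True
    then have "0 \<le> \<kappa> * (u x - 1)"
      using \<kappa>(1) by simp
    then have "0 \<le> W' (u x)"
      using W'_ge[OF True] by linarith
    moreover have "0 \<le> a' (u x)"
      using a'_zero[of "u x"] a'_pos[of "u x"] by (cases "u x \<le> 1") auto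
    ultimately show ?thesis
      by (simp add: q_def)
  next
    case False
    then show ?thesis by (simp add: q_def a'_zero)
  qed
  have cont_a: "continuous_on UNIV (\<lambda>x. a (u x))" and cont_a': "continuous_on UNIV (\<lambda>x. a' (u x))"
    by (rule continuous_on_compose2[OF DERIV_continuous_on[OF has_field_derivative_at_within[OF a_deriv]] C2_jet_continuous(1)[OF u] subset_UNIV]
        continuous_on_compose2[OF DERIV_continuous_on[OF has_field_derivative_at_within[OF a'_deriv]] C2_jet_continuous(1)[OF u] subset_UNIV])+
  have q_cont: "continuous_on UNIV q"
    unfolding q_def[abs_def] by (intro continuous_intros cont_a' Wu_cont)
  note au = C2_jet_compose[OF u a_deriv a'_deriv a''_cont]
  obtain K L where bump: "C2_jet (bump 1 (0::'a)) K L"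
    by (rule bump_C2)
  have bump_supp: "bump 1 (0::'a) x = 0" if "1 < norm x" for x
  proof -
    have "1 \<le> x \<bullet> x"
      using that by (simp add: power2_norm_eq_inner[symmetric] one_le_power)
    then show ?thesis by (simp add: bump_def)
  qed
  obtain B where B: "\<And>x. \<bar>trace_op (L x)\<bar> \<le> B" "B \<ge> 0"
    using trace_op_bounded[OF bump bump_supp] by blast
  define \<phi> where "\<phi> R x = bump 1 0 ((1 / R) *\<^sub>R x)" for R and x :: 'a
  have \<phi>_jet: "C2_jet (\<phi> R) (\<lambda>x. (1 / R) *\<^sub>R K ((1 / R) *\<^sub>R x)) (\<lambda>x v. (1 / R * (1 / R)) *\<^sub>R L ((1 / R) *\<^sub>R x) v)" for R
    using C2_jet_affine[OF bump, of "1 / R" 0] by (simp add: \<phi>_def[abs_def])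
  have \<phi>_supp: "\<phi> R x = 0" if "R > 0" "R < norm x" for R x
    unfolding \<phi>_def using that by (intro bump_supp) (simp add: field_simps)
  have \<phi>_cont: "continuous_on UNIV (\<phi> R)" for R
    using C2_jet_continuous(1)[OF \<phi>_jet] .
  have q_int: "integrable lborel (\<lambda>x. q x * \<phi> R x)" if "R > 0" for R
    by (rule integrable_compact_support[where r = R]) (use that \<phi>_supp in \<open>auto intro!: continuous_on_mult q_cont \<phi>_cont\<close>)
  have key: "(LINT x|lborel. q x * \<phi> R x) \<le> (4 * B / \<kappa> * C) * (1 / R)" if R: "R > 0" for R
  proof -
    let ?T = "\<lambda>x. trace_op (\<lambda>v. a' (u x) *\<^sub>R H x v + (a'' (u x) * (G x \<bullet> v)) *\<^sub>R G x)"
    let ?S = "\<lambda>x. trace_op (\<lambda>v. (1 / R * (1 / R)) *\<^sub>R L ((1 / R) *\<^sub>R x) v)"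
    have T: "?T x = q x + a'' (u x) * (G x \<bullet> G x)" for x
      unfolding trace_op_simps eq q_def ..
    have "(LINT x|lborel. q x * \<phi> R x) \<le> (LINT x|lborel. ?T x * \<phi> R x)"
    proof (rule integral_mono[OF q_int[OF R]])
      show "integrable lborel (\<lambda>x. ?T x * \<phi> R x)"
        by (rule integrable_compact_support[where r = R])
           (use R \<phi>_supp in \<open>auto intro!: continuous_on_mult C2_jet_continuous_trace[OF au] \<phi>_cont\<close>)
      show "q x * \<phi> R x \<le> ?T x * \<phi> R x" for x
        unfolding T by (intro mult_right_mono) (auto simp: \<phi>_def a''_nonneg bump_nonneg)
    qed
    also have "\<dots> = (LINT x|lborel. a (u x) * ?S x)"
      using integral_trace_by_parts[OF au \<phi>_jet \<phi>_supp[OF R]] by simp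
    also have "\<dots> \<le> (LINT x|lborel. (2 * B / \<kappa> * (1 / R * (1 / R))) * (indicator (ball 0 (2 * R)) x *\<^sub>R W (u x)))"
    proof (rule integral_mono)
      show "integrable lborel (\<lambda>x. a (u x) * ?S x)"
      proof (rule integrable_compact_support[where r = R])
        show "continuous_on UNIV (\<lambda>x. a (u x) * ?S x)"
          by (intro continuous_on_mult cont_a C2_jet_continuous_trace[OF \<phi>_jet] continuous_on_id)
        fix x :: 'a assume "R < norm x"
        from C2_jet_support_trace[OF \<phi>_jet \<phi>_supp[OF R] this] show "a (u x) * ?S x = 0"
          by simp
      qed
      show "integrable lborel (\<lambda>x. (2 * B / \<kappa> * (1 / R * (1 / R))) * (indicator (ball 0 (2 * R)) x *\<^sub>R W (u x)))"
        using set_integrable_ball[OF Wu_cont(1), of 0 "2 * R"] unfolding set_integrable_def by (rule integrable_mult_right)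
      show "a (u x) * ?S x \<le> (2 * B / \<kappa> * (1 / R * (1 / R))) * (indicator (ball 0 (2 * R)) x *\<^sub>R W (u x))" for x
      proof (cases "norm x < 2 * R")
        case True
        have "a (u x) * ?S x \<le> a (u x) * (1 / R * (1 / R) * B)"
          unfolding trace_op_scaleR using B(1)[of "(1 / R) *\<^sub>R x"] a_nonneg R
          by (intro mult_left_mono) auto
        also have "\<dots> \<le> (2 / \<kappa> * W (u x)) * (1 / R * (1 / R) * B)"
          using a_le B(2) R by (intro mult_right_mono) auto
        finally show ?thesis
          using True by (simp add: algebra_simps)
      next
        case False
        then have "R < norm x"
          using R by simp
        from C2_jet_support_trace[OF \<phi>_jet \<phi>_supp[OF R] this] False show ?thesis
          by simp
      qed
    qed
    also have "\<dots> = (2 * B / \<kappa> * (1 / R * (1 / R))) * (LINT x:ball 0 (2 * R)|lborel. W (u x))"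
      unfolding set_lebesgue_integral_def by (rule integral_mult_right_zero)
    also have "\<dots> \<le> (2 * B / \<kappa> * (1 / R * (1 / R))) * (C * (2 * R))"
      using R \<kappa>(1) B(2) by (intro mult_left_mono energy) auto
    also have "\<dots> = (4 * B / \<kappa> * C) * (1 / R)"
      using R by (simp add: field_simps)
    finally show ?thesis .
  qed
  define R0 where "R0 = 2 * (norm x + 1)"
  have R0: "R0 > 0"
    by (simp add: R0_def add_nonneg_pos)
  have "(LINT x|lborel. q x * \<phi> R0 x) \<le> (4 * B / \<kappa> * C) * (1 / R)" if "R0 \<le> R" for R
  proof -
    have "\<phi> R0 x \<le> \<phi> R x" for x
    proof -
      have "x \<bullet> x / (R * R) \<le> x \<bullet> x / (R0 * R0)"
        using that R0 by (intro divide_left_mono mult_mono mult_pos_pos) auto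
      then show ?thesis
        by (auto simp: \<phi>_def bump_def intro!: power_mono)
    qed
    then have "(LINT x|lborel. q x * \<phi> R0 x) \<le> (LINT x|lborel. q x * \<phi> R x)"
      using that R0 by (intro integral_mono q_int mult_left_mono q_nonneg) auto
    with key[of R] that R0 show ?thesis by simp
  qed
  then have "\<forall>\<^sub>F R in at_top. (LINT x|lborel. q x * \<phi> R0 x) \<le> (4 * B / \<kappa> * C) * (1 / R)"
    using eventually_ge_at_top by (rule eventually_mono[rotated])
  moreover have "((\<lambda>R. (4 * B / \<kappa> * C) * (1 / R)) \<longlongrightarrow> (4 * B / \<kappa> * C) * 0) at_top"
    using tendsto_inverse_0_at_top[OF filterlim_ident] by (intro tendsto_intros) (simp add: inverse_eq_divide)
  ultimately have "(LINT x|lborel. q x * \<phi> R0 x) \<le> 0"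
    using tendsto_lowerbound[of _ _ at_top] by fastforce
  moreover have "0 \<le> (LINT x|lborel. q x * \<phi> R0 x)"
    by (rule integral_nonneg_AE) (simp add: q_nonneg \<phi>_def bump_nonneg)
  ultimately have "(LINT x|lborel. q x * \<phi> R0 x) = 0"
    by (rule antisym)
  then have "q x * \<phi> R0 x = 0"
    by (intro integral_eq_0_imp_zero[of "\<lambda>x. q x * \<phi> R0 x"] mult_nonneg_nonneg q_nonneg q_int R0 continuous_on_mult q_cont \<phi>_cont)
       (simp_all add: \<phi>_def bump_nonneg)
  moreover have "\<phi> R0 x > 0"
  proof -
    have "(1 / R0) *\<^sub>R x \<in> ball 0 1"
      using R0 by (simp add: R0_def field_simps)
    then show ?thesis
      unfolding \<phi>_def using bump_pos_iff[of 1 0 "(1 / R0) *\<^sub>R x"] by simp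
  qed
  ultimately have "q x = 0"
    by simp
  show ?thesis
  proof (rule ccontr)
    assume "\<not> u x \<le> 1"
    then have "0 < u x - 1"
      by simp
    then have "0 < a' (u x)"
      by (intro a'_pos) simp
    moreover have "0 < W' (u x)"
      using W'_ge[of "u x"] mult_pos_pos[OF \<kappa>(1) \<open>0 < u x - 1\<close>] \<open>0 < u x - 1\<close> by linarith
    ultimately have "q x \<noteq> 0"
      by (simp add: q_def)
    with \<open>q x = 0\<close> show False
      by simp
  qed
qed

end

section \<open>Gradient bounds of Bernstein and Modica\<close>

text \<open>Cauchy-Schwarz applied to the expansion of \<open>A v\<close> in the images of the basis vectors.\<close>
lemma linear_norm_le_frobenius:
  fixes A :: "'a::euclidean_space \<Rightarrow> 'a"
  assumes "linear A"
  shows "A v \<bullet> A v \<le> (\<Sum>i\<in>Basis. A i \<bullet> A i) * (v \<bullet> v)"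
proof -
  have "norm (A v) \<le> (\<Sum>i\<in>Basis. \<bar>v \<bullet> i\<bar> * \<bar>norm (A i)\<bar>)"
    by (subst linear_Basis_expansion[OF assms]) (auto intro!: norm_sum[THEN order_trans])
  also have "\<dots> \<le> L2_set (\<lambda>i. v \<bullet> i) Basis * L2_set (\<lambda>i. norm (A i)) Basis"
    by (rule L2_set_mult_ineq)
  finally have "(norm (A v))\<^sup>2 \<le> (L2_set (\<lambda>i. v \<bullet> i) Basis * L2_set (\<lambda>i. norm (A i)) Basis)\<^sup>2"
    by (rule power_mono) simp
  also have "\<dots> = (v \<bullet> v) * (\<Sum>i\<in>Basis. A i \<bullet> A i)"
    unfolding L2_set_def power_mult_distrib
    by (simp add: sum_nonneg euclidean_inner[of v v] power2_eq_square[of "v \<bullet> _"] power2_norm_eq_inner)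
  finally show ?thesis
    by (simp add: power2_norm_eq_inner mult.commute)
qed

context allen_cahn
begin

text \<open>Bernstein's argument: maximize \<open>p\<^sup>2|\<nabla>u|\<^sup>2/2 + l u\<^sup>2/2\<close> over the unit ball around \<open>x0\<close>, with
  \<open>p = 1 - |y - x0|\<^sup>2\<close>.  At an interior maximum the term \<open>l|\<nabla>u|\<^sup>2\<close> from the Laplacian of \<open>l u\<^sup>2/2\<close> outweighs
  everything that the cutoff produces, so \<open>|\<nabla>u|\<close> is bounded there by known quantities.\<close>
lemma gradient_bounded:
  assumes bound: "\<And>x. \<bar>u x\<bar> \<le> 1"
  obtains M where "\<And>x. G x \<bullet> G x \<le> M"
proof -
  obtain k1 where k1: "\<And>t. t \<in> {-1..1} \<Longrightarrow> norm (W' t) \<le> k1"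
    using compact_imp_bounded[OF compact_continuous_image[OF W_cont(2) compact_Icc]] by (metis bounded_iff imageI)
  obtain k2 where k2: "\<And>t. t \<in> {-1..1} \<Longrightarrow> norm (W'' t) \<le> k2"
    using compact_imp_bounded[OF compact_continuous_image[OF continuous_on_subset[OF W''_cont subset_UNIV] compact_Icc]]
    by (metis bounded_iff imageI)
  define k where "k = max k1 k2"
  have k: "\<bar>W' (u x)\<bar> \<le> k" "\<bar>W'' (u x)\<bar> \<le> k" for x
    using k1[of "u x"] k2[of "u x"] bound[of x] by (auto simp: k_def abs_le_iff)
  have k0: "0 \<le> k"
    using k(1)[of 0] by linarith
  \<comment> \<open>the coefficient \<open>l\<close> is chosen so that \<open>l - 2n - 16 - k = 1\<close> in the final estimate\<close>
  define l where "l = 2 * real DIM('a) + 17 + k"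
  have l: "l > 0"
    unfolding l_def using k0 by linarith
  have "G x0 \<bullet> G x0 \<le> l * k + l" for x0
  proof -
    define p where "p y = 1 + (- 1) * ((y - x0) \<bullet> (y - x0))" for y
    have p_jet: "C2_jet p (\<lambda>y. 0 + (- 1) *\<^sub>R (2 *\<^sub>R (y - x0))) (\<lambda>y v. 0 + (- 1) *\<^sub>R (2 *\<^sub>R v))"
      unfolding p_def[abs_def] by (intro C2_jet_add C2_jet_const C2_jet_cmult C2_jet_sqdist)
    note a_jet = C2_jet_mult[OF p_jet p_jet]
    note b_jet = C2_jet_cmult[OF C2_jet_mult[OF u u], of "l / 2"]
    let ?F = "\<lambda>y. (p y * p y) * (G y \<bullet> G y) / 2 + l / 2 * (u y * u y)"
    have u2: "u y * u y \<le> 1" for y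
      using bound[of y] by (metis abs_le_square_iff abs_one power2_eq_square power_one)
    have "\<exists>z\<in>cball x0 1. \<forall>y\<in>cball x0 1. ?F y \<le> ?F z"
      by (rule continuous_attains_sup)
         (auto intro!: continuous_intros C2_jet_continuous[OF p_jet] C2_jet_continuous[OF u])
    then obtain z where z: "z \<in> cball x0 1" "\<And>y. y \<in> cball x0 1 \<Longrightarrow> ?F y \<le> ?F z"
      by blast
    have Fz: "?F z \<le> l * k / 2 + l / 2"
    proof (cases "dist x0 z = 1")
      case True
      then have "p z = 0"
        by (simp add: p_def dist_norm norm_minus_commute flip: power2_norm_eq_inner)
      moreover have "l * (u z * u z) \<le> l * 1" "0 \<le> l * k"
        using u2[of z] l k0 by (intro mult_left_mono mult_nonneg_nonneg; simp)+
      ultimately show ?thesis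
        by simp
    next
      case False
      define r where "r = 1 - dist x0 z"
      have r: "r > 0"
        using False z(1) by (simp add: r_def)
      have sub: "y \<in> cball x0 1" if "y \<in> cball z r" for y
        using that dist_triangle[of x0 y z] by (simp add: r_def)
      define D where "D = z - x0"
      define g where "g = G z \<bullet> G z"
      define S where "S = (\<Sum>i\<in>Basis. H z i \<bullet> H z i)"
      define m where "m = D \<bullet> H z (G z)"
      have D1: "D \<bullet> D \<le> 1"
        using z(1) by (simp add: D_def dist_norm norm_minus_commute flip: power2_norm_eq_inner) (simp add: power_le_one)
      have pz: "p z = 1 - D \<bullet> D" "0 \<le> p z" "p z \<le> 1"
        using D1 by (auto simp: p_def D_def)
      have g0: "0 \<le> g" and S0: "0 \<le> S"
        by (auto simp: g_def S_def sum_nonneg)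
      have "m\<^sup>2 \<le> (D \<bullet> D) * (H z (G z) \<bullet> H z (G z))"
        unfolding m_def by (rule Cauchy_Schwarz_ineq)
      also have "\<dots> \<le> 1 * (S * g)"
        unfolding S_def g_def by (intro mult_mono D1 linear_norm_le_frobenius C2_jet_linear[OF u]) auto
      finally have m2: "m\<^sup>2 \<le> S * g" by simp
      have "trace_op (\<lambda>v. p z *\<^sub>R (0 + (- 1) *\<^sub>R (2 *\<^sub>R v)) + ((0 + (- 1) *\<^sub>R (2 *\<^sub>R (z - x0))) \<bullet> v) *\<^sub>R (0 + (- 1) *\<^sub>R (2 *\<^sub>R (z - x0)))
            + (p z *\<^sub>R (0 + (- 1) *\<^sub>R (2 *\<^sub>R v)) + ((0 + (- 1) *\<^sub>R (2 *\<^sub>R (z - x0))) \<bullet> v) *\<^sub>R (0 + (- 1) *\<^sub>R (2 *\<^sub>R (z - x0)))))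
          * (G z \<bullet> G z) / 2
        + 2 * ((p z *\<^sub>R (0 + (- 1) *\<^sub>R (2 *\<^sub>R (z - x0))) + p z *\<^sub>R (0 + (- 1) *\<^sub>R (2 *\<^sub>R (z - x0)))) \<bullet> H z (G z))
        + (p z * p z) * ((\<Sum>i\<in>Basis. H z i \<bullet> H z i) + W'' (u z) * (G z \<bullet> G z))
        + trace_op (\<lambda>v. (l / 2) *\<^sub>R (u z *\<^sub>R H z v + (G z \<bullet> v) *\<^sub>R G z + (u z *\<^sub>R H z v + (G z \<bullet> v) *\<^sub>R G z))) \<le> 0"
        by (rule gradient_functional_max(2)[OF u eq W'' W''_cont a_jet b_jet r]) (rule z(2)[OF sub])
      then have ineq: "(4 * (D \<bullet> D) - 2 * real DIM('a) * p z) * g - 8 * p z * m + (p z * p z) * (S + W'' (u z) * g)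
          + l * (u z * W' (u z) + g) \<le> 0"
        unfolding trace_op_simps eq D_def[symmetric] g_def[symmetric] S_def[symmetric]
        by (simp add: m_def diff_divide_distrib algebra_simps)
      have t1: "(4 * (D \<bullet> D) - 2 * real DIM('a) * p z) * g \<ge> - (2 * real DIM('a)) * g"
      proof (rule mult_right_mono[OF _ g0])
        have "2 * real DIM('a) * p z \<le> 2 * real DIM('a) * 1"
          using pz by (intro mult_left_mono) auto
        then show "- (2 * real DIM('a)) \<le> 4 * (D \<bullet> D) - 2 * real DIM('a) * p z"
          using inner_ge_zero[of D] by linarith
      qed
      have t2: "8 * p z * m \<le> (p z * p z) * S + 16 * g"
      proof (rule power2_le_imp_le)
        have "(8 * p z * m)\<^sup>2 = 64 * (p z * p z) * m\<^sup>2"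
          by (simp add: power2_eq_square)
        also have "\<dots> \<le> 64 * (p z * p z) * (S * g)"
          by (intro mult_left_mono m2) simp
        also have "\<dots> = ((p z * p z) * S + 16 * g)\<^sup>2 - ((p z * p z) * S - 16 * g)\<^sup>2"
          by (simp add: power2_eq_square algebra_simps)
        finally show "(8 * p z * m)\<^sup>2 \<le> ((p z * p z) * S + 16 * g)\<^sup>2"
          by (smt (verit) zero_le_power2)
      qed (simp add: S0 g0)
      have t3: "- k * g \<le> (p z * p z) * (W'' (u z) * g)"
      proof -
        have "\<bar>(p z * p z) * W'' (u z)\<bar> \<le> 1 * k"
          unfolding abs_mult using pz k(2)[of z] by (intro mult_mono mult_le_one) auto
        then have "- k \<le> (p z * p z) * W'' (u z)"
          by linarith
        from mult_right_mono[OF this g0] show ?thesis by simp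
      qed
      have t4: "- k \<le> u z * W' (u z)"
      proof -
        have "\<bar>u z * W' (u z)\<bar> \<le> 1 * k"
          unfolding abs_mult using bound[of z] k(1)[of z] by (intro mult_mono) auto
        then show ?thesis by linarith
      qed
      have "l * (- k) + l * g \<le> l * (u z * W' (u z) + g)"
        using mult_left_mono[OF t4, of l] l by (simp add: distrib_left)
      then have "g * (l - 2 * real DIM('a) - 16 - k) \<le> l * k"
        using ineq t1 t2 t3 by (simp add: algebra_simps)
      then have g: "g \<le> l * k"
        by (simp add: l_def)
      have "(p z * p z) * g \<le> 1 * (l * k)"
        using pz g g0 by (intro mult_mono mult_le_one) auto
      moreover have "l / 2 * (u z * u z) \<le> l / 2"
        using mult_left_mono[OF u2[of z], of "l / 2"] l by simp
      ultimately show ?thesis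
        by (simp add: g_def)
    qed
    have "G x0 \<bullet> G x0 / 2 \<le> ?F x0"
      using l by (simp add: p_def)
    with z(2)[of x0] Fz show ?thesis
      by simp
  qed
  then show ?thesis
    using that by blast
qed

text \<open>Modica's argument shows that \<open>|\<nabla>u|\<^sup>2/2 - W(u)\<close> has no positive interior maximum, but with a
  differential inequality that is not strict.  Here \<open>W\<close> is replaced by
  \<open>V(t) = W(t) + \<delta>(5 - (t - \<gamma>)\<^sup>2)\<close>.  The added term is concave and has the same monotonicity as \<open>W\<close> on
  both sides of \<open>\<gamma>\<close>, which makes the inequality strict with a margin \<open>4\<delta>\<^sup>2\<close>; the constant \<open>5\<close> keeps it
  at least \<open>\<delta>\<close> on \<open>[-1,1]\<close>, so \<open>|\<nabla>u|\<close> is bounded below where the function is positive.  The margin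
  survives a penalization \<open>-\<eta>|y - x1|\<^sup>2\<close>, which forces a maximum to exist on the whole space because
  \<open>|\<nabla>u|\<close> is bounded.  Finally \<open>\<eta> \<rightarrow> 0\<close> and \<open>\<delta> \<rightarrow> 0\<close>.\<close>
lemma modica:
  assumes bound: "\<And>x. \<bar>u x\<bar> \<le> 1" and W_nonneg: "\<And>t. 0 \<le> W t"
    and \<gamma>: "\<bar>\<gamma>\<bar> \<le> 1" and sgn: "\<And>t. \<bar>t\<bar> \<le> 1 \<Longrightarrow> 0 \<le> W' t * (\<gamma> - t)"
  shows "G x \<bullet> G x \<le> 2 * W (u x)"
proof -
  obtain M0 where M0: "\<And>x. G x \<bullet> G x \<le> M0"
    using gradient_bounded[OF bound] by blast
  define M where "M = max M0 1"
  have M: "G x \<bullet> G x \<le> M" "1 \<le> M" for x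
    using M0[of x] by (auto simp: M_def)
  obtain k where k: "\<And>t. t \<in> {-1..1} \<Longrightarrow> norm (W' t) \<le> k"
    using compact_imp_bounded[OF compact_continuous_image[OF W_cont(2) compact_Icc]] by (metis bounded_iff imageI)
  have "G x1 \<bullet> G x1 / 2 \<le> W (u x1) + \<delta> * (5 - (u x1 - \<gamma>)\<^sup>2)" if \<delta>: "\<delta> > 0" for \<delta> x1
  proof (rule ccontr)
    define V where "V t = W t + \<delta> * (5 - (t - \<gamma>)\<^sup>2)" for t
    define V' where "V' t = W' t + 2 * \<delta> * (\<gamma> - t)" for t
    define V'' where "V'' t = W'' t - 2 * \<delta>" for t
    have V_deriv: "(V has_real_derivative V' t) (at t)" "(V' has_real_derivative V'' t) (at t)" for t
      unfolding V_def[abs_def] V'_def[abs_def] V''_def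
      by (auto intro!: derivative_eq_intros W' W'')
    have V''_cont: "continuous_on UNIV V''"
      unfolding V''_def[abs_def] by (intro continuous_intros W''_cont)
    note V_jet = C2_jet_compose[OF u V_deriv V''_cont]
    have V_ge: "\<delta> \<le> V (u y)" for y
    proof -
      have "\<bar>u y - \<gamma>\<bar> \<le> 2"
        using bound[of y] \<gamma> by linarith
      then have "(u y - \<gamma>)\<^sup>2 \<le> 2\<^sup>2"
        by (metis abs_le_square_iff abs_numeral)
      then have "\<delta> * 1 \<le> \<delta> * (5 - (u y - \<gamma>)\<^sup>2)"
        using \<delta> by (intro mult_left_mono) auto
      then show ?thesis
        using W_nonneg[of "u y"] by (simp add: V_def)
    qed
    assume "\<not> G x1 \<bullet> G x1 / 2 \<le> W (u x1) + \<delta> * (5 - (u x1 - \<gamma>)\<^sup>2)"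
    then have pos: "0 < G x1 \<bullet> G x1 / 2 - V (u x1)"
      by (simp add: V_def)
    define K where "K = k + 4 * \<delta>"
    have V'_le: "\<bar>V' (u y)\<bar> \<le> K" for y
    proof -
      have "\<bar>2 * \<delta> * (\<gamma> - u y)\<bar> \<le> 2 * \<delta> * 2"
        unfolding abs_mult using bound[of y] \<gamma> \<delta> by (intro mult_mono) auto
      moreover have "\<bar>W' (u y)\<bar> \<le> k"
        using k[of "u y"] bound[of y] by (auto simp: abs_le_iff)
      ultimately show ?thesis
        unfolding V'_def K_def by linarith
    qed
    define c where "c = 4 * K * sqrt (M / (4 * \<delta>)) + 2 * real DIM('a)"
    have main: "4 * \<delta>\<^sup>2 \<le> c * s" if s: "0 < s" "s \<le> 1" for s
    proof -
      \<comment> \<open>the penalization enters through its square root, so it is parametrized as \<open>\<eta> = s\<^sup>2\<close>\<close>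
      define \<eta> where "\<eta> = s\<^sup>2"
      have \<eta>: "0 < \<eta>" "\<eta> \<le> s"
        using s by (auto simp: \<eta>_def power2_eq_square mult_left_le)
      define b where "b y = (- 1) * V (u y) + (- \<eta>) * ((y - x1) \<bullet> (y - x1))" for y
      note b_jet = C2_jet_add[OF C2_jet_cmult[OF V_jet, of "-1"] C2_jet_cmult[OF C2_jet_sqdist[of x1], of "- \<eta>"], folded b_def]
      let ?F = "\<lambda>y. 1 * (G y \<bullet> G y) / 2 + b y"
      \<comment> \<open>beyond this radius the penalization exceeds the bound on \<open>|\<nabla>u|\<^sup>2\<close>, so the maximum over the ball is interior\<close>
      define \<rho> where "\<rho> = M / \<eta> + 1"
      have \<rho>: "1 \<le> \<rho>" "M < \<eta> * \<rho>"
        using \<eta> M(2) by (auto simp: \<rho>_def field_simps)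
      have "\<exists>z\<in>cball x1 \<rho>. \<forall>y\<in>cball x1 \<rho>. ?F y \<le> ?F z"
        using \<rho> by (intro continuous_attains_sup)
           (auto intro!: continuous_intros C2_jet_continuous(1)[OF b_jet] C2_jet_continuous[OF u])
      then obtain z where z: "z \<in> cball x1 \<rho>" "\<And>y. y \<in> cball x1 \<rho> \<Longrightarrow> ?F y \<le> ?F z"
        by blast
      have "0 < ?F x1"
        using pos by (simp add: b_def)
      also have "\<dots> \<le> ?F z"
        using \<rho> by (intro z(2)) auto
      finally have Fz: "0 < ?F z" .
      define D where "D = z - x1"
      define g where "g = G z \<bullet> G z"
      define S where "S = (\<Sum>i\<in>Basis. H z i \<bullet> H z i)"
      define Q where "Q = V' (u z)"
      have Fz': "V (u z) + \<eta> * (D \<bullet> D) < g / 2"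
        using Fz by (simp add: b_def D_def g_def)
      have D0: "0 \<le> \<eta> * (D \<bullet> D)"
        using \<eta> by simp
      have g: "2 * \<delta> \<le> g" "\<eta> * (D \<bullet> D) \<le> M / 2" "g \<le> M"
        using Fz' V_ge[of z] D0 M(1)[of z] \<delta> unfolding g_def[symmetric] by linarith+
      define r where "r = \<rho> - dist x1 z"
      have "dist x1 z \<noteq> \<rho>"
      proof
        assume "dist x1 z = \<rho>"
        then have "D \<bullet> D = \<rho>\<^sup>2"
          by (simp add: D_def dist_norm norm_minus_commute flip: power2_norm_eq_inner)
        then have "\<eta> * \<rho> * 1 \<le> \<eta> * (D \<bullet> D)"
          using \<rho> \<eta> by (simp add: power2_eq_square)
        with g(2) \<rho> M(2) show False by linarith
      qed
      then have r: "r > 0"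
        using z(1) by (simp add: r_def)
      have sub: "y \<in> cball x1 \<rho>" if "y \<in> cball z r" for y
        using that dist_triangle[of x1 y z] by (simp add: r_def)
      note max = gradient_functional_max[OF u eq W'' W''_cont C2_jet_const[of 1] b_jet r z(2)[OF sub]]
      have grad: "H z (G z) = Q *\<^sub>R G z + (2 * \<eta>) *\<^sub>R D"
        using max(1) by (simp add: Q_def D_def algebra_simps)
      \<comment> \<open>the term \<open>W''(u)|\<nabla>u|\<^sup>2\<close> cancels against the one from the Laplacian of \<open>V(u)\<close>\<close>
      have lap: "S + 2 * \<delta> * g \<le> Q * W' (u z) + 2 * \<eta> * real DIM('a)"
        using max(2) unfolding trace_op_simps eq
        by (simp add: Q_def S_def g_def V''_def algebra_simps)
      define X where "X = \<eta> * (G z \<bullet> D) / g"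
      have g_pos: "g > 0"
        using g(1) \<delta> by linarith
      have X2: "X\<^sup>2 \<le> s\<^sup>2 * (M / (4 * \<delta>))"
      proof -
        have "(G z \<bullet> D)\<^sup>2 \<le> g * (D \<bullet> D)"
          unfolding g_def by (rule Cauchy_Schwarz_ineq)
        then have "X\<^sup>2 \<le> \<eta>\<^sup>2 * (g * (D \<bullet> D)) / g\<^sup>2"
          unfolding X_def power_divide power_mult_distrib by (intro divide_right_mono mult_left_mono) auto
        also have "\<dots> = \<eta> * (\<eta> * (D \<bullet> D)) / g"
          using g_pos by (simp add: power2_eq_square)
        also have "\<dots> \<le> \<eta> * (M / 2) / (2 * \<delta>)"
          using g \<eta> \<delta> M(2) by (intro frac_le mult_left_mono mult_nonneg_nonneg) auto
        finally show ?thesis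
          by (simp add: \<eta>_def)
      qed
      have X: "\<bar>X\<bar> \<le> s * sqrt (M / (4 * \<delta>))"
      proof (rule power2_le_imp_le)
        show "\<bar>X\<bar>\<^sup>2 \<le> (s * sqrt (M / (4 * \<delta>)))\<^sup>2"
          using X2 M(2) \<delta> by (simp add: power_mult_distrib)
      qed (use s M(2) \<delta> in auto)
      have "Q\<^sup>2 * g + 4 * Q * \<eta> * (G z \<bullet> D) \<le> H z (G z) \<bullet> H z (G z)"
        unfolding grad using \<eta> by (simp add: g_def inner_add_left inner_add_right inner_commute algebra_simps power2_eq_square)
      also have "\<dots> \<le> S * g"
        unfolding S_def g_def by (rule linear_norm_le_frobenius[OF C2_jet_linear[OF u]])
      finally have "(Q\<^sup>2 + 4 * Q * X) * g \<le> S * g"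
        using g_pos by (simp add: X_def algebra_simps)
      then have "Q\<^sup>2 + 4 * Q * X \<le> S"
        using g_pos by simp
      moreover have "Q * W' (u z) \<le> Q\<^sup>2"
      proof -
        have "0 \<le> 2 * \<delta> * (W' (u z) * (\<gamma> - u z)) + (2 * \<delta> * (\<gamma> - u z))\<^sup>2"
          using sgn[OF bound, of z] \<delta> by simp
        also have "\<dots> = Q\<^sup>2 - Q * W' (u z)"
          by (simp add: Q_def V'_def power2_eq_square algebra_simps)
        finally show ?thesis by simp
      qed
      moreover have "\<bar>4 * Q * X\<bar> \<le> 4 * K * (s * sqrt (M / (4 * \<delta>)))"
        unfolding abs_mult using V'_le[of z] X by (intro mult_mono) (auto simp: Q_def)
      moreover have "4 * \<delta>\<^sup>2 \<le> 2 * \<delta> * g"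
        using mult_left_mono[OF g(1), of "2 * \<delta>"] \<delta> by (simp add: power2_eq_square)
      moreover have "2 * \<eta> * real DIM('a) \<le> 2 * s * real DIM('a)"
        using \<eta> by (intro mult_right_mono) auto
      ultimately have "4 * \<delta>\<^sup>2 \<le> 4 * K * (s * sqrt (M / (4 * \<delta>))) + 2 * s * real DIM('a)"
        using lap by linarith
      then show ?thesis
        by (simp add: c_def algebra_simps)
    qed
    have "4 * \<delta>\<^sup>2 \<le> c"
      using main[of 1] by simp
    moreover have "0 < \<delta>\<^sup>2"
      using \<delta> by simp
    ultimately have c: "0 < c" "\<delta>\<^sup>2 \<le> c"
      by linarith+
    then have "\<delta>\<^sup>2 / c \<le> 1"
      by simp
    with main[of "\<delta>\<^sup>2 / c"] \<open>0 < \<delta>\<^sup>2\<close> c(1) show False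
      by (simp add: field_simps)
  qed
  then have *: "G x \<bullet> G x / 2 \<le> W (u x) + \<delta> * (5 - (u x - \<gamma>)\<^sup>2)" if "\<delta> > 0" for \<delta>
    using that by blast
  have "G x \<bullet> G x / 2 \<le> W (u x) + e" if "e > 0" for e
  proof -
    have "e / 5 * (5 - (u x - \<gamma>)\<^sup>2) \<le> e / 5 * 5"
      using that by (intro mult_left_mono) auto
    then have "e / 5 * (5 - (u x - \<gamma>)\<^sup>2) \<le> e"
      by simp
    with *[of "e / 5"] that show ?thesis by linarith
  qed
  then have "G x \<bullet> G x / 2 \<le> W (u x)"
    by (rule field_le_epsilon)
  then show ?thesis by simp
qed

end

section \<open>The convex potential of the stress tensor\<close>

lemma has_derivative_from_directional:
  fixes f :: "'a::euclidean_space \<Rightarrow> real"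
  assumes dir: "\<And>x v. ((\<lambda>t. f (x + t *\<^sub>R v)) has_real_derivative S x \<bullet> v) (at 0)"
    and cont: "continuous_on UNIV S"
  shows "(f has_derivative (\<lambda>v. S x \<bullet> v)) (at x)"
  unfolding has_derivative_at_alt
proof (intro conjI allI impI)
  show "bounded_linear (\<lambda>v. S x \<bullet> v)"
    by (rule bounded_linear_inner_right)
  fix e :: real assume e: "e > 0"
  have "isCont S x"
    using cont by (simp add: continuous_on_eq_continuous_at)
  then obtain d where d: "d > 0" "\<And>y. dist y x < d \<Longrightarrow> dist (S y) (S x) < e"
    using e unfolding continuous_at_eps_delta by blast
  have "norm (f y - f x - S x \<bullet> (y - x)) \<le> e * norm (y - x)" if y: "norm (y - x) < d" for y
  proof -
    obtain z where z: "0 < z" "z < 1"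
      "f (x + 1 *\<^sub>R (y - x)) - f (x + 0 *\<^sub>R (y - x)) = (1 - 0) * (S (x + z *\<^sub>R (y - x)) \<bullet> (y - x))"
      using MVT2[OF zero_less_one line_derivative_shift[OF dir]] by blast
    have "dist (x + z *\<^sub>R (y - x)) x = z * norm (y - x)"
      using z by (simp add: dist_norm)
    also have "\<dots> \<le> norm (y - x)"
      using z by (simp add: mult_left_le_one_le)
    finally have S: "norm (S (x + z *\<^sub>R (y - x)) - S x) \<le> e"
      using d(2)[of "x + z *\<^sub>R (y - x)"] y by (simp add: dist_norm)
    have "f y - f x - S x \<bullet> (y - x) = (S (x + z *\<^sub>R (y - x)) - S x) \<bullet> (y - x)"
      using z(3) by (simp add: inner_diff_left)
    also have "norm \<dots> \<le> norm (S (x + z *\<^sub>R (y - x)) - S x) * norm (y - x)"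
      by (rule Cauchy_Schwarz_ineq2[folded real_norm_def])
    also have "\<dots> \<le> e * norm (y - x)"
      by (rule mult_right_mono[OF S norm_ge_zero])
    finally show ?thesis .
  qed
  with d(1) show "\<exists>d>0. \<forall>y. norm (y - x) < d \<longrightarrow> norm (f y - f x - S x \<bullet> (y - x)) \<le> e * norm (y - x)"
    by blast
qed

definition radial_potential :: "('a::euclidean_space \<Rightarrow> 'a) \<Rightarrow> 'a \<Rightarrow> real" where
  "radial_potential S x = integral {0..1} (\<lambda>t. S (t *\<^sub>R x) \<bullet> x)"

text \<open>Poincare lemma.  Closedness turns the derivative of the integrand in direction \<open>v\<close> into
  \<open>d/dt (t S(tx) \<bullet> v)\<close>, which integrates to \<open>S(x) \<bullet> v\<close>.\<close>
lemma has_derivative_radial_potential: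
  fixes S :: "'a::euclidean_space \<Rightarrow> 'a"
  assumes S: "\<And>x. (S has_derivative DS x) (at x)"
    and cont: "\<And>v. continuous_on UNIV (\<lambda>x. DS x v)"
    and closed: "\<And>x v w. DS x v \<bullet> w = DS x w \<bullet> v"
  shows "(radial_potential S has_derivative (\<lambda>v. S x \<bullet> v)) (at x)"
proof (rule has_derivative_from_directional)
  show S_cont: "continuous_on UNIV S"
    using S by (blast intro: has_derivative_continuous continuous_at_imp_continuous_on)
  fix x v
  have lin: "DS y (c *\<^sub>R w) = c *\<^sub>R DS y w" for y c w
    by (rule linear_scale[OF has_derivative_linear[OF S]])
  define D where "D s t = t * (DS (t *\<^sub>R (x + s *\<^sub>R v)) v \<bullet> (x + s *\<^sub>R v)) + S (t *\<^sub>R (x + s *\<^sub>R v)) \<bullet> v" for s t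
  have D: "((\<lambda>s. S (t *\<^sub>R (x + s *\<^sub>R v)) \<bullet> (x + s *\<^sub>R v)) has_real_derivative D s t) (at s)" for s t
  proof -
    have 1: "((\<lambda>s. x + s *\<^sub>R v) has_derivative (\<lambda>h. h *\<^sub>R v)) (at s)"
      by (auto intro!: derivative_eq_intros)
    have "((\<lambda>s. S (t *\<^sub>R (x + s *\<^sub>R v))) has_derivative (\<lambda>h. DS (t *\<^sub>R (x + s *\<^sub>R v)) (t *\<^sub>R (h *\<^sub>R v)))) (at s)"
      by (rule has_derivative_compose[OF has_derivative_scaleR_right[OF 1] S])
    from has_derivative_inner[OF this 1] show ?thesis
      by (rule has_derivative_imp_has_field_derivative) (simp add: D_def lin algebra_simps)
  qed
  have D_cont: "continuous_on (UNIV \<times> cbox 0 1) (\<lambda>(s, t). D s t)"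
    unfolding D_def split_beta
    by (intro continuous_intros continuous_on_compose2[OF cont] continuous_on_compose2[OF S_cont]) auto
  have "((\<lambda>s. integral (cbox 0 1) (\<lambda>t. S (t *\<^sub>R (x + s *\<^sub>R v)) \<bullet> (x + s *\<^sub>R v)))
      has_real_derivative integral (cbox 0 1) (D 0)) (at 0 within UNIV)"
  proof (rule leibniz_rule_field_derivative[OF _ _ D_cont])
    show "(\<lambda>t. S (t *\<^sub>R (x + s *\<^sub>R v)) \<bullet> (x + s *\<^sub>R v)) integrable_on cbox 0 1" for s
      by (intro integrable_continuous continuous_intros continuous_on_compose2[OF S_cont]) auto
  qed (use D in auto)
  moreover have "(D 0 has_integral (1 * (S (1 *\<^sub>R x) \<bullet> v) - 0 * (S (0 *\<^sub>R x) \<bullet> v))) {0..1}"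
  proof (rule fundamental_theorem_of_calculus)
    fix t :: real
    have 1: "((\<lambda>s. s *\<^sub>R x) has_derivative (\<lambda>h. h *\<^sub>R x)) (at t)"
      by (auto intro!: derivative_eq_intros)
    have "((\<lambda>s. S (s *\<^sub>R x) \<bullet> v) has_derivative (\<lambda>h. DS (t *\<^sub>R x) (h *\<^sub>R x) \<bullet> v)) (at t)"
      by (rule has_derivative_inner_left[OF has_derivative_compose[OF 1 S]])
    from has_derivative_mult[OF has_derivative_ident this]
    have "((\<lambda>s. s * (S (s *\<^sub>R x) \<bullet> v)) has_vector_derivative D 0 t) (at t)"
      by (simp add: has_vector_derivative_def D_def lin closed[of _ v x] algebra_simps)
    then show "((\<lambda>s. s * (S (s *\<^sub>R x) \<bullet> v)) has_vector_derivative D 0 t) (at t within {0..1})"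
      by (rule has_vector_derivative_at_within)
  qed simp
  ultimately show "((\<lambda>s. radial_potential S (x + s *\<^sub>R v)) has_real_derivative S x \<bullet> v) (at 0)"
    unfolding radial_potential_def by (simp add: integral_unique)
qed

text \<open>The Poincare lemma is used twice.  Each row of \<open>T\<close> is a closed field, and its potentials are the
  components of a field \<open>p\<close> with derivative \<open>T\<close>; by symmetry of \<open>T\<close> the field \<open>p\<close> is closed as well.\<close>
lemma potential_of_hessian:
  fixes T :: "'a::euclidean_space \<Rightarrow> 'a \<Rightarrow> 'a" and DT :: "'a \<Rightarrow> 'a \<Rightarrow> 'a \<Rightarrow> 'a"
  assumes lin: "\<And>x. linear (T x)" and sym: "\<And>x v w. T x v \<bullet> w = T x w \<bullet> v"
    and T: "\<And>x v. ((\<lambda>y. T y v) has_derivative (\<lambda>w. DT x w v)) (at x)"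
    and cont: "\<And>v w. continuous_on UNIV (\<lambda>x. DT x w v)"
    and closed: "\<And>x v w z. DT x w v \<bullet> z = DT x z v \<bullet> w"
  obtains U p where "C2_jet U p T" "U 0 = 0" "p 0 = 0"
proof -
  define p where "p x = (\<Sum>b\<in>Basis. radial_potential (\<lambda>y. T y b) x *\<^sub>R b)" for x
  have "(p has_derivative (\<lambda>v. \<Sum>b\<in>Basis. (T x b \<bullet> v) *\<^sub>R b)) (at x)" for x
    unfolding p_def[abs_def]
    by (intro has_derivative_sum has_derivative_scaleR_left has_derivative_radial_potential[OF T cont closed])
  moreover have "(\<Sum>b\<in>Basis. (T x b \<bullet> v) *\<^sub>R b) = T x v" for x v
    using euclidean_representation[of "T x v"] by (simp add: sym[of x _ v])
  ultimately have p: "(p has_derivative T x) (at x)" for x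
    by simp
  have T_cont: "continuous_on UNIV (\<lambda>x. T x v)" for v
    using T by (blast intro: has_derivative_continuous continuous_at_imp_continuous_on)
  have "C2_jet (radial_potential p) p T"
    by (intro C2_jetI p T_cont has_derivative_radial_potential[OF p T_cont sym])
  moreover have "radial_potential p 0 = 0" "p 0 = 0"
    by (simp_all add: p_def radial_potential_def)
  ultimately show ?thesis
    using that by blast
qed

text \<open>Along each ray the derivative of \<open>U\<close> is nondecreasing and vanishes at the origin.\<close>
lemma convex_potential_nonneg:
  assumes U: "C2_jet U p T" and psd: "\<And>x v. 0 \<le> T x v \<bullet> v" and "U 0 = 0" "p 0 = 0"
  shows "0 \<le> U x" and "0 \<le> t \<Longrightarrow> t \<le> 1 \<Longrightarrow> U (t *\<^sub>R x) \<le> t * U x"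
proof -
  have d: "((\<lambda>t. U (t *\<^sub>R x)) has_real_derivative p (t *\<^sub>R x) \<bullet> x) (at t)" for t
    using C2_jet_line(1)[OF U, of 0 x t] by simp
  have mono: "p (s *\<^sub>R x) \<bullet> x \<le> p (t *\<^sub>R x) \<bullet> x" if "s \<le> t" for s t
    using C2_jet_line(2)[OF U, of 0 x x] psd by (intro DERIV_nonneg_imp_nondecreasing[OF that]) auto
  have nonneg: "0 \<le> U (t *\<^sub>R x)" if "0 \<le> t" for t
  proof -
    have "U (0 *\<^sub>R x) \<le> U (t *\<^sub>R x)"
    proof (rule DERIV_nonneg_imp_nondecreasing[OF that])
      show "\<exists>y. ((\<lambda>t. U (t *\<^sub>R x)) has_real_derivative y) (at s) \<and> 0 \<le> y" if "0 \<le> s" for s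
        using d[of s] mono[OF that] assms(4) by auto
    qed
    then show ?thesis using assms(3) by simp
  qed
  from nonneg[of 1] show "0 \<le> U x" by simp
  assume t: "0 \<le> t" "t \<le> 1"
  show "U (t *\<^sub>R x) \<le> t * U x"
  proof (cases "t = 0 \<or> t = 1")
    case True
    then show ?thesis using assms(3) by auto
  next
    case False
    with t have t: "0 < t" "t < 1" by auto
    obtain a where a: "0 < a" "a < t" "U (t *\<^sub>R x) - U (0 *\<^sub>R x) = (t - 0) * (p (a *\<^sub>R x) \<bullet> x)"
      using MVT2[OF t(1) d] by blast
    obtain b where b: "t < b" "b < 1" "U (1 *\<^sub>R x) - U (t *\<^sub>R x) = (1 - t) * (p (b *\<^sub>R x) \<bullet> x)"
      using MVT2[OF t(2) d] by blast
    have "U (t *\<^sub>R x) * (1 - t) = t * ((1 - t) * (p (a *\<^sub>R x) \<bullet> x))"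
      using a(3) assms(3) by simp
    also have "\<dots> \<le> t * ((1 - t) * (p (b *\<^sub>R x) \<bullet> x))"
      using t a b by (intro mult_left_mono mono) auto
    also have "\<dots> = t * (U x - U (t *\<^sub>R x))"
      using b(3) by simp
    finally show ?thesis
      by (simp add: algebra_simps)
  qed
qed

locale allen_cahn_plane = allen_cahn W W' W'' u G H
  for W W' W'' :: "real \<Rightarrow> real" and u :: "real^2 \<Rightarrow> real" and G H
begin

text \<open>The tensor \<open>T\<close> is the two-dimensional stress-energy tensor of \<open>u\<close>, rotated by a right angle; that
  the stress-energy tensor is divergence free becomes the closedness of the rows of \<open>T\<close>.  The identity
  behind this depends on the dimension: it is checked in coordinates, with \<open>W'(u)\<close> replaced by
  the sum of the two diagonal entries of the Hessian.\<close>
lemma stress_potential: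
  obtains U p T where "C2_jet U p T" "U 0 = 0" "p 0 = 0"
    "\<And>x v. T x v \<bullet> v = (G x \<bullet> v)\<^sup>2 + (W (u x) - (G x \<bullet> G x) / 2) * (v \<bullet> v)"
    "\<And>x. trace_op (T x) = 2 * W (u x)"
proof -
  define T where "T x v = (G x \<bullet> v) *\<^sub>R G x + (W (u x) - (G x \<bullet> G x) / 2) *\<^sub>R v" for x v
  define DT where "DT x w v = ((G x \<bullet> v) *\<^sub>R H x w + (H x w \<bullet> v) *\<^sub>R G x) + (W' (u x) * (G x \<bullet> w) - H x w \<bullet> G x) *\<^sub>R v"
    for x w v
  have lin: "linear (T x)" for x
    unfolding T_def[abs_def] by (intro linearI) (simp_all add: inner_add_right algebra_simps)
  have sym: "T x v \<bullet> w = T x w \<bullet> v" for x v w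
    unfolding T_def inner_add_left inner_scaleR_left by (simp add: inner_commute[of v w])
  have T_deriv: "((\<lambda>y. T y v) has_derivative (\<lambda>w. DT x w v)) (at x)" for x v
  proof -
    have "((\<lambda>y. W (u y)) has_derivative (\<lambda>w. W' (u x) * (G x \<bullet> w))) (at x)"
      using has_derivative_compose[OF C2_jetD(1)[OF u] W'[unfolded has_field_derivative_def]] .
    moreover have "((\<lambda>y. (1 / 2) * (G y \<bullet> G y)) has_derivative (\<lambda>w. (1 / 2) * (G x \<bullet> H x w + H x w \<bullet> G x))) (at x)"
      by (intro has_derivative_mult_right has_derivative_inner C2_jetD(2)[OF u])
    ultimately have "((\<lambda>y. W (u y) - (1 / 2) * (G y \<bullet> G y)) has_derivative
        (\<lambda>w. W' (u x) * (G x \<bullet> w) - (1 / 2) * (G x \<bullet> H x w + H x w \<bullet> G x))) (at x)"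
      by (rule has_derivative_diff)
    then have 1: "((\<lambda>y. W (u y) - (G y \<bullet> G y) / 2) has_derivative (\<lambda>w. W' (u x) * (G x \<bullet> w) - H x w \<bullet> G x)) (at x)"
      by (simp add: inner_commute[of "G x" "H x _"])
    show ?thesis
      unfolding T_def DT_def
      by (intro has_derivative_add has_derivative_scaleR has_derivative_scaleR_left has_derivative_inner_left
          C2_jetD(2)[OF u] 1)
  qed
  have cont: "continuous_on UNIV (\<lambda>x. DT x w v)" for v w
    unfolding DT_def by (intro continuous_intros C2_jet_continuous[OF u] C2_jetD(3)[OF u] Wu_cont)
  have closed: "DT x w v \<bullet> z = DT x z v \<bullet> w" for x v w z
  proof -
    define e1 e2 where "e1 = (axis 1 1 :: real^2)" and "e2 = (axis 2 1 :: real^2)"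
    define a b c where "a = H x e1 $ 1" and "b = H x e1 $ 2" and "c = H x e2 $ 2"
    have b': "H x e2 $ 1 = b"
      using C2_jet_symmetric[OF u, of x e1 e2] by (simp add: b_def e1_def e2_def inner_axis)
    have Hc: "H x w $ 1 = w $ 1 * a + w $ 2 * b" "H x w $ 2 = w $ 1 * b + w $ 2 * c" for w
    proof -
      have "w = w $ 1 *\<^sub>R e1 + w $ 2 *\<^sub>R e2"
        by (simp add: vec_eq_iff forall_2 e1_def e2_def axis_def)
      then have "H x w = H x (w $ 1 *\<^sub>R e1 + w $ 2 *\<^sub>R e2)"
        by (rule arg_cong)
      also have "\<dots> = w $ 1 *\<^sub>R H x e1 + w $ 2 *\<^sub>R H x e2"
        by (simp add: linear_add[OF C2_jet_linear[OF u]] linear_scale[OF C2_jet_linear[OF u]])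
      finally show "H x w $ 1 = w $ 1 * a + w $ 2 * b" "H x w $ 2 = w $ 1 * b + w $ 2 * c"
        by (simp_all add: a_def b_def c_def b')
    qed
    \<comment> \<open>the equation enters only here, as the trace of the Hessian\<close>
    have tr: "W' (u x) = a + c"
      unfolding eq[symmetric] trace_op_def
      by (simp add: Basis_vec_def UNIV_2 inner_axis axis_eq_axis a_def c_def e1_def e2_def)
    show ?thesis
      unfolding DT_def tr by (simp add: inner_vec_def UNIV_2 Hc algebra_simps)
  qed
  have tr: "trace_op (T x) = 2 * W (u x)" for x
    unfolding T_def[abs_def] trace_op_simps by simp
  have form: "T x v \<bullet> v = (G x \<bullet> v)\<^sup>2 + (W (u x) - (G x \<bullet> G x) / 2) * (v \<bullet> v)" for x v
    by (simp add: T_def inner_add_left power2_eq_square)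
  show ?thesis
    using potential_of_hessian[OF lin sym T_deriv cont closed] that[OF _ _ _ form tr] by blast
qed

end

section \<open>Uniqueness of the blow-down limit of the energy\<close>

text \<open>A radial function \<open>f(|x|\<^sup>2)\<close> has Laplacian \<open>4(s f'(s))'\<close> at \<open>s = |x|\<^sup>2\<close>.  Solving
  \<open>4(s f')' = max(0, 1-s)\<close> gives \<open>f(s) = s/4 - s\<^sup>2/16\<close> up to \<open>s = 1\<close> and a logarithm beyond.\<close>
lemma log_potential:
  obtains \<theta> :: "real^2 \<Rightarrow> real" and K L where "C2_jet \<theta> K L"
    "\<And>x. trace_op (L x) = max 0 (1 - x \<bullet> x)"
    "\<And>x. 1 \<le> norm x \<Longrightarrow> \<theta> x = 3 / 16 + ln (x \<bullet> x) / 8"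
proof -
  define r where "r v = 1 / 8 * ln (1 + v) + 3 / 16 - 1 / 4 * (1 + v) + 1 / 16 * (1 + v)\<^sup>2" for v :: real
  define r' where "r' v = 1 / 8 * inverse (1 + v) - 1 / 4 + 1 / 8 * (1 + v)" for v :: real
  define r'' where "r'' v = 1 / 8 - 1 / 8 * (inverse (1 + v))\<^sup>2" for v :: real
  have r: "(r has_real_derivative r' v) (at v)" "(r' has_real_derivative r'' v) (at v)" if v: "0 \<le> v" for v
  proof -
    have lin: "((\<lambda>v. 1 + v) has_real_derivative 1) (at v)"
      by (auto intro!: derivative_eq_intros)
    have sq: "((\<lambda>v. (1 + v)\<^sup>2) has_real_derivative 2 * (1 + v)) (at v)"
      by (auto intro!: derivative_eq_intros)
    have ln: "((\<lambda>v. ln (1 + v)) has_real_derivative inverse (1 + v)) (at v)"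
      using v by (auto intro!: derivative_eq_intros simp: inverse_eq_divide)
    have inv: "((\<lambda>v. inverse (1 + v)) has_real_derivative - (inverse (1 + v))\<^sup>2) (at v)"
      using v by (auto intro!: derivative_eq_intros simp: power2_eq_square)
    have "(r has_real_derivative 1 / 8 * inverse (1 + v) + 0 - 1 / 4 * 1 + 1 / 16 * (2 * (1 + v))) (at v)"
      unfolding r_def[abs_def] by (intro DERIV_add DERIV_diff DERIV_cmult DERIV_const lin sq ln)
    then show "(r has_real_derivative r' v) (at v)"
      by (rule DERIV_cong) (simp add: r'_def)
    have "(r' has_real_derivative 1 / 8 * (- (inverse (1 + v))\<^sup>2) - 0 + 1 / 8 * 1) (at v)"
      unfolding r'_def[abs_def] by (intro DERIV_add DERIV_diff DERIV_cmult DERIV_const lin inv)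
    then show "(r' has_real_derivative r'' v) (at v)"
      by (rule DERIV_cong) (simp add: r''_def)
  qed
  have r0: "r 0 = 0" "r' 0 = 0" "r'' 0 = 0"
    by (simp_all add: r_def r'_def r''_def)
  define f where "f s = s / 4 - s\<^sup>2 / 16 + r (max 0 (-1 + 1 * s))" for s
  define f' where "f' s = 1 / 4 - s / 8 + r' (max 0 (-1 + 1 * s)) * 1" for s
  define f'' where "f'' s = - 1 / 8 + r'' (max 0 (-1 + 1 * s)) * 1 * 1" for s
  have f: "(f has_real_derivative f' s) (at s)" for s
  proof -
    have "((\<lambda>s. s / 4 - s\<^sup>2 / 16) has_real_derivative 1 / 4 - s / 8) (at s)"
      by (auto intro!: derivative_eq_intros)
    then show ?thesis
      unfolding f_def[abs_def] f'_def by (rule DERIV_add[OF _ deriv_comp_pos_part_affine[OF r(1) r0(2)]])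
  qed
  have f': "(f' has_real_derivative f'' s) (at s)" for s
  proof -
    have "((\<lambda>s. 1 / 4 - s / 8) has_real_derivative - 1 / 8) (at s)"
      by (auto intro!: derivative_eq_intros)
    then show ?thesis
      unfolding f'_def[abs_def] f''_def
      by (rule DERIV_add[OF _ DERIV_cmult_right[OF deriv_comp_pos_part_affine[OF r(2) r0(3)]]])
  qed
  have f''_cont: "continuous_on UNIV f''"
    unfolding f''_def[abs_def] r''_def
    by (intro continuous_intros) (simp add: add_nonneg_eq_0_iff)
  note jet = C2_jet_compose[OF C2_jet_sqdist[of "0 :: real^2"] f f' f''_cont]
  show ?thesis
  proof (rule that[OF jet])
    fix x :: "real^2"
    define s where "s = x \<bullet> x"
    have "4 * f' s + 4 * s * f'' s = max 0 (1 - s)"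
    proof (cases "s \<le> 1")
      case True
      then show ?thesis
        by (simp add: f'_def f''_def r0 max_def algebra_simps)
    next
      case False
      then have "f' s = 1 / (8 * s)" "f'' s = - 1 / (8 * s\<^sup>2)"
        by (simp_all add: f'_def f''_def r'_def r''_def max_def inverse_eq_divide power_divide)
      with False show ?thesis
        by (simp add: power2_eq_square)
    qed
    then show "trace_op (\<lambda>v. f' ((x - 0) \<bullet> (x - 0)) *\<^sub>R (2 *\<^sub>R v) +
        (f'' ((x - 0) \<bullet> (x - 0)) * ((2 *\<^sub>R (x - 0)) \<bullet> v)) *\<^sub>R (2 *\<^sub>R (x - 0))) = max 0 (1 - x \<bullet> x)"
      unfolding trace_op_simps by (simp add: s_def algebra_simps)
    assume "1 \<le> norm x"
    then have "1 \<le> s"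
      by (simp add: s_def one_le_power flip: power2_norm_eq_inner)
    then show "f ((x - 0) \<bullet> (x - 0)) = 3 / 16 + ln (x \<bullet> x) / 8"
      by (simp add: s_def[symmetric] f_def r_def max_def)
  qed
qed

text \<open>Outside the unit ball the logarithms of \<open>\<theta>(x)\<close> and \<open>\<theta>(2x)\<close> differ by a constant, so
  \<open>\<theta>(x) - \<theta>(2x)\<close> becomes compactly supported after adding that constant.\<close>
lemma annular_test_function:
  obtains \<phi> :: "real^2 \<Rightarrow> real" and K L where "C2_jet \<phi> K L"
    "\<And>x. trace_op (L x) = max 0 (1 - x \<bullet> x) - 4 * max 0 (1 - (2 *\<^sub>R x) \<bullet> (2 *\<^sub>R x))"
    "\<And>x. 1 < norm x \<Longrightarrow> \<phi> x = 0"
proof -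
  obtain \<theta> :: "real^2 \<Rightarrow> real" and K L where \<theta>: "C2_jet \<theta> K L"
    and tr: "\<And>x. trace_op (L x) = max 0 (1 - x \<bullet> x)"
    and far: "\<And>x. 1 \<le> norm x \<Longrightarrow> \<theta> x = 3 / 16 + ln (x \<bullet> x) / 8"
    using log_potential by blast
  note jet = C2_jet_add[OF C2_jet_add[OF \<theta> C2_jet_cmult[OF C2_jet_affine[OF \<theta>, of 2 0], of "-1"]] C2_jet_const[of "ln 4 / 8"]]
  show ?thesis
  proof (rule that[OF jet])
    fix x :: "real^2"
    show "trace_op (\<lambda>v. L x v + (- 1) *\<^sub>R ((2 * 2) *\<^sub>R L (2 *\<^sub>R x + 0) v) + 0)
        = max 0 (1 - x \<bullet> x) - 4 * max 0 (1 - (2 *\<^sub>R x) \<bullet> (2 *\<^sub>R x))"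
      unfolding trace_op_simps tr by simp
    assume x: "1 < norm x"
    then have "x \<noteq> 0"
      by auto
    then have "0 < x \<bullet> x"
      by simp
    with x show "\<theta> x + (- 1) * \<theta> (2 *\<^sub>R x + 0) + ln 4 / 8 = 0"
      by (simp add: far ln_mult[of 4 "x \<bullet> x"] add_divide_distrib del: mult_numeral_left)
  qed
qed

context allen_cahn_plane
begin

text \<open>With \<open>V\<^sub>R(x) = U(Rx)/R\<close> the tested energy at scale \<open>R\<close> is \<open>\<integral>V\<^sub>R \<Delta>\<phi>/2\<close>.  Since \<open>V\<^sub>R\<close> is nondecreasing in
  \<open>R\<close>, its change between two scales is dominated by the change of \<open>A(R) = \<integral>V\<^sub>R(x) \<rho>(x/k')\<close>, which is a
  bounded monotone function of \<open>R\<close>.  Hence the tested energies at two sequences of large scales differ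
  by a null sequence.\<close>
lemma blow_down_limit_unique:
  assumes W_nonneg: "\<And>t. 0 \<le> W t" and modica: "\<And>x. G x \<bullet> G x \<le> 2 * W (u x)"
    and energy: "\<And>R. R > 0 \<Longrightarrow> (LINT x:ball 0 R|lborel. W (u x)) \<le> C * R"
    and \<phi>: "C2_jet \<phi> K L" and supp: "\<And>x. k < norm x \<Longrightarrow> \<phi> x = 0"
    and r: "filterlim r at_top sequentially" "(\<lambda>j. LINT x|lborel. r j * W (u (r j *\<^sub>R x)) * \<phi> x) \<longlonglongrightarrow> l"
    and s: "filterlim s at_top sequentially" "(\<lambda>j. LINT x|lborel. s j * W (u (s j *\<^sub>R x)) * \<phi> x) \<longlonglongrightarrow> l'"
  shows "l = l'"
proof -
  obtain U p T where U: "C2_jet U p T" and U0: "U 0 = 0" "p 0 = 0"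
    and form: "\<And>x v. T x v \<bullet> v = (G x \<bullet> v)\<^sup>2 + (W (u x) - (G x \<bullet> G x) / 2) * (v \<bullet> v)"
    and trace: "\<And>x. trace_op (T x) = 2 * W (u x)"
    using stress_potential by blast
  have psd: "0 \<le> T x v \<bullet> v" for x v
    unfolding form using modica[of x] by simp
  note convex = convex_potential_nonneg[OF U psd U0]
  define V where "V R x = (1 / R) * U (R *\<^sub>R x)" for R x
  have V_jet: "C2_jet (V R) (\<lambda>x. (1 / R) *\<^sub>R (R *\<^sub>R p (R *\<^sub>R x))) (\<lambda>x v. (1 / R) *\<^sub>R ((R * R) *\<^sub>R T (R *\<^sub>R x) v))" for R
    using C2_jet_cmult[OF C2_jet_affine[OF U, of R 0], of "1 / R"] by (simp add: V_def[abs_def])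
  have V_cont: "continuous_on UNIV (V R)" for R
    by (rule C2_jet_continuous(1)[OF V_jet])
  have V_trace: "trace_op (\<lambda>v. (1 / R) *\<^sub>R ((R * R) *\<^sub>R T (R *\<^sub>R x) v)) = 2 * (R * W (u (R *\<^sub>R x)))" if "R > 0" for R x
    unfolding trace_op_simps trace using that by simp
  have V_nonneg: "0 \<le> V R x" if "R > 0" for R x
    using that convex(1) by (simp add: V_def)
  have V_mono: "V a x \<le> V b x" if "0 < a" "a \<le> b" for a b x
  proof -
    have "U ((a / b) *\<^sub>R (b *\<^sub>R x)) \<le> a / b * U (b *\<^sub>R x)"
      using that by (intro convex(2)) auto
    then show ?thesis
      using that by (simp add: V_def field_simps)
  qed
  have V_half: "V R ((1 / 2) *\<^sub>R x) \<le> 1 / 2 * V R x" if "R > 0" for R x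
  proof -
    have "U ((1 / 2) *\<^sub>R (R *\<^sub>R x)) \<le> 1 / 2 * U (R *\<^sub>R x)"
      by (intro convex(2)) auto
    then show ?thesis
      using that by (simp add: V_def field_simps)
  qed
  have by_parts: "(LINT x|lborel. V R x * trace_op (L x)) = 2 * (LINT x|lborel. R * W (u (R *\<^sub>R x)) * \<phi> x)"
    if "R > 0" "C2_jet \<phi> K L" "\<And>x. k < norm x \<Longrightarrow> \<phi> x = 0" for R \<phi> K L k
  proof -
    have "(LINT x|lborel. V R x * trace_op (L x)) = (LINT x|lborel. trace_op (\<lambda>v. (1 / R) *\<^sub>R ((R * R) *\<^sub>R T (R *\<^sub>R x) v)) * \<phi> x)"
      by (rule integral_trace_by_parts[OF V_jet that(2,3)])
    also have "\<dots> = (LINT x|lborel. 2 * (R * W (u (R *\<^sub>R x)) * \<phi> x))"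
      unfolding V_trace[OF that(1)] by (simp only: mult.assoc)
    finally show ?thesis
      by simp
  qed
  define \<rho> where "\<rho> x = max 0 (1 - x \<bullet> x)" for x :: "real^2"
  have \<rho>_cont: "continuous_on UNIV \<rho>"
    unfolding \<rho>_def[abs_def] by (intro continuous_intros)
  have \<rho>_supp: "\<rho> x = 0" if "1 \<le> norm x" for x
    using that by (simp add: \<rho>_def one_le_power flip: power2_norm_eq_inner)
  have \<rho>_nonneg: "0 \<le> \<rho> x" for x
    by (simp add: \<rho>_def)
  have int: "integrable lborel (\<lambda>x. V R (c *\<^sub>R x) * \<rho> (d *\<^sub>R x))" if "d > 0" for R c d
  proof (rule integrable_compact_support[where r = "1 / d"])
    show "continuous_on UNIV (\<lambda>x. V R (c *\<^sub>R x) * \<rho> (d *\<^sub>R x))"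
      by (intro continuous_on_mult continuous_on_compose2[OF V_cont] continuous_on_compose2[OF \<rho>_cont] continuous_intros) auto
    show "V R (c *\<^sub>R x) * \<rho> (d *\<^sub>R x) = 0" if "1 / d < norm x" for x
      using that \<open>d > 0\<close> by (simp add: \<rho>_supp field_simps)
  qed
  have meas: "V R \<in> borel_measurable borel" "\<rho> \<in> borel_measurable borel" for R
    using V_cont \<rho>_cont by (auto intro: borel_measurable_continuous_onI)

  obtain \<psi> K\<psi> L\<psi> where \<psi>: "C2_jet \<psi> K\<psi> L\<psi>"
    and \<psi>_tr: "\<And>x. trace_op (L\<psi> x) = max 0 (1 - x \<bullet> x) - 4 * max 0 (1 - (2 *\<^sub>R x) \<bullet> (2 *\<^sub>R x))"
    and \<psi>_supp: "\<And>x::real^2. 1 < norm x \<Longrightarrow> \<psi> x = 0"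
    by (rule annular_test_function) (rule that)
  have \<psi>_trace: "trace_op (L\<psi> x) = \<rho> x - 4 * \<rho> (2 *\<^sub>R x)" for x
    by (simp only: \<psi>_tr \<rho>_def)
  obtain B\<psi> where B\<psi>: "\<And>x. \<psi> x \<le> B\<psi>" "0 \<le> B\<psi>"
  proof -
    obtain B where B: "\<And>x. x \<in> cball 0 1 \<Longrightarrow> norm (\<psi> x) \<le> B"
      using compact_imp_bounded[OF compact_continuous_image[OF C2_jet_continuous(1)[OF \<psi>] compact_cball[of 0 1]]]
      by (metis bounded_iff imageI)
    have "\<psi> x \<le> max B 0" for x
      using B[of x] \<psi>_supp[of x] by (cases "norm x \<le> 1") auto
    then show ?thesis
      using that[of "max B 0"] by simp
  qed
  define E where "E = 8 * B\<psi> * C"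
  have energy_scaled: "(LINT x|lborel. indicator (ball 0 2) x *\<^sub>R (R * W (u (R *\<^sub>R x)))) \<le> 2 * C" if R: "R > 0" for R
  proof -
    have ind: "indicator (ball 0 (2 * R)) (R *\<^sub>R x) = (indicator (ball 0 2) x :: real)" for x :: "real^2"
      using R by (simp add: indicator_def)
    have "(LINT x|lborel. indicator (ball 0 (2 * R)) x *\<^sub>R W (u x)) =
        R ^ DIM(real^2) * (LINT x|lborel. indicator (ball 0 (2 * R)) (R *\<^sub>R x) *\<^sub>R W (u (R *\<^sub>R x)))"
      using Wu_cont(1)[of UNIV]
      by (intro integral_lborel_scale[OF _ R] borel_measurable_scaleR borel_measurable_indicator)
         (auto intro: borel_measurable_continuous_onI)
    also have "\<dots> = R * (LINT x|lborel. R * (indicator (ball 0 2) x *\<^sub>R W (u (R *\<^sub>R x))))"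
      unfolding ind by (simp add: power2_eq_square)
    also have "\<dots> = R * (LINT x|lborel. indicator (ball 0 2) x *\<^sub>R (R * W (u (R *\<^sub>R x))))"
      by (simp add: mult.left_commute)
    finally have "R * (LINT x|lborel. indicator (ball 0 2) x *\<^sub>R (R * W (u (R *\<^sub>R x)))) \<le> R * (2 * C)"
      using energy[of "2 * R"] R by (simp add: set_lebesgue_integral_def mult.commute mult.left_commute)
    then show ?thesis
      using R by (simp only: mult_le_cancel_left_pos)
  qed
  have E: "(LINT x|lborel. V R x * \<rho> x) \<le> E" if R: "R > 0" for R
  proof -
    have "(LINT x|lborel. V R ((1 / 2) *\<^sub>R x) * \<rho> x) = 2 ^ DIM(real^2) * (LINT x|lborel. V R ((1 / 2) *\<^sub>R (2 *\<^sub>R x)) * \<rho> (2 *\<^sub>R x))"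
      by (intro integral_lborel_scale[of "\<lambda>x. V R ((1 / 2) *\<^sub>R x) * \<rho> x"] borel_measurable_times
          measurable_compose[OF _ meas(1)] meas(2)) auto
    then have scale: "4 * (LINT x|lborel. V R x * \<rho> (2 *\<^sub>R x)) = (LINT x|lborel. V R ((1 / 2) *\<^sub>R x) * \<rho> x)"
      by simp
    \<comment> \<open>the negative part of \<open>\<Delta>\<psi>\<close> costs at most half of the integral to be bounded\<close>
    have "(LINT x|lborel. V R ((1 / 2) *\<^sub>R x) * \<rho> x) \<le> (LINT x|lborel. 1 / 2 * (V R x * \<rho> x))"
    proof (rule integral_mono)
      show "V R ((1 / 2) *\<^sub>R x) * \<rho> x \<le> 1 / 2 * (V R x * \<rho> x)" for x
        using mult_right_mono[OF V_half[OF R] \<rho>_nonneg] by (simp add: mult.assoc)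
    qed (use int[of 1 R "1 / 2"] int[of 1 R 1] in auto)
    also have "\<dots> = 1 / 2 * (LINT x|lborel. V R x * \<rho> x)"
      by (rule integral_mult_right_zero)
    finally have half: "4 * (LINT x|lborel. V R x * \<rho> (2 *\<^sub>R x)) \<le> 1 / 2 * (LINT x|lborel. V R x * \<rho> x)"
      unfolding scale .
    have "(LINT x|lborel. V R x * \<rho> x) - 4 * (LINT x|lborel. V R x * \<rho> (2 *\<^sub>R x))
        = (LINT x|lborel. V R x * \<rho> x - 4 * (V R x * \<rho> (2 *\<^sub>R x)))"
      using int[of 1 R 1] int[of 2 R 1] by (subst Bochner_Integration.integral_diff) auto
    also have "\<dots> = (LINT x|lborel. V R x * trace_op (L\<psi> x))"
      unfolding \<psi>_trace by (simp add: algebra_simps)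
    also have "\<dots> = 2 * (LINT x|lborel. R * W (u (R *\<^sub>R x)) * \<psi> x)"
      by (rule by_parts[OF R \<psi> \<psi>_supp])
    also have "(LINT x|lborel. R * W (u (R *\<^sub>R x)) * \<psi> x) \<le> (LINT x|lborel. B\<psi> * (indicator (ball 0 2) x *\<^sub>R (R * W (u (R *\<^sub>R x)))))"
    proof (rule integral_mono)
      have cont: "continuous_on UNIV (\<lambda>x. R * W (u (R *\<^sub>R x)))"
        by (intro continuous_intros continuous_on_compose2[OF Wu_cont(1)[of UNIV]]) auto
      show "integrable lborel (\<lambda>x. R * W (u (R *\<^sub>R x)) * \<psi> x)"
        by (rule integrable_compact_support[where r = 1])
           (auto intro!: continuous_on_mult[OF cont] C2_jet_continuous(1)[OF \<psi>] simp: \<psi>_supp)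
      show "integrable lborel (\<lambda>x. B\<psi> * (indicator (ball 0 2) x *\<^sub>R (R * W (u (R *\<^sub>R x)))))"
        using set_integrable_ball[OF cont, of 0 2] unfolding set_integrable_def by (rule integrable_mult_right)
      show "R * W (u (R *\<^sub>R x)) * \<psi> x \<le> B\<psi> * (indicator (ball 0 2) x *\<^sub>R (R * W (u (R *\<^sub>R x))))" for x
      proof (cases "norm x < 2")
        case True
        have "R * W (u (R *\<^sub>R x)) * \<psi> x \<le> R * W (u (R *\<^sub>R x)) * B\<psi>"
          using R W_nonneg B\<psi> by (intro mult_left_mono) auto
        with True show ?thesis
          by (simp add: mult.commute)
      next
        case False
        then show ?thesis
          by (simp add: \<psi>_supp)
      qed
    qed
    also have "\<dots> = B\<psi> * (LINT x|lborel. indicator (ball 0 2) x *\<^sub>R (R * W (u (R *\<^sub>R x))))"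
      by (rule integral_mult_right_zero)
    also have "\<dots> \<le> B\<psi> * (2 * C)"
      by (rule mult_left_mono[OF energy_scaled[OF R] B\<psi>(2)])
    finally show ?thesis
      using half by (simp add: E_def)
  qed

  \<comment> \<open>on the support of \<open>\<phi>\<close> the weight \<open>\<rho>(x/k')\<close> is at least \<open>3/4\<close>, so a multiple of it dominates \<open>|\<Delta>\<phi>|\<close>\<close>
  define k' where "k' = 2 * max k 1"
  have k': "2 \<le> k'" "k \<le> k' / 2"
    by (auto simp: k'_def)
  define A where "A R = (LINT x|lborel. V R x * \<rho> ((1 / k') *\<^sub>R x))" for R
  have A_int: "integrable lborel (\<lambda>x. V R x * \<rho> ((1 / k') *\<^sub>R x))" for R
    using int[of "1 / k'" R 1] k' by simp
  have A_mono: "A a \<le> A b" if "0 < a" "a \<le> b" for a b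
    unfolding A_def by (intro integral_mono A_int mult_right_mono V_mono that \<rho>_nonneg)
  have A_le: "A R \<le> k' ^ 3 * E" if R: "R > 0" for R
  proof -
    have "A R = k' ^ DIM(real^2) * (LINT x|lborel. V R (k' *\<^sub>R x) * \<rho> ((1 / k') *\<^sub>R (k' *\<^sub>R x)))"
      unfolding A_def
      by (intro integral_lborel_scale[of "\<lambda>x. V R x * \<rho> ((1 / k') *\<^sub>R x)"] borel_measurable_times
          measurable_compose[OF _ meas(2)] meas(1)) (use k' in auto)
    also have "\<dots> = k' ^ 2 * (LINT x|lborel. k' * (V (k' * R) x * \<rho> x))"
      using k' R by (simp add: V_def mult.commute)
    also have "\<dots> = k' ^ 3 * (LINT x|lborel. V (k' * R) x * \<rho> x)"
      by (simp add: power3_eq_cube power2_eq_square)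
    also have "\<dots> \<le> k' ^ 3 * E"
      using k' R by (intro mult_left_mono E) auto
    finally show ?thesis .
  qed
  obtain B where B: "\<And>x. \<bar>trace_op (L x)\<bar> \<le> B" "B \<ge> 0"
    using trace_op_bounded[OF \<phi> supp] by blast
  have trace_le: "\<bar>trace_op (L x)\<bar> \<le> 2 * B * \<rho> ((1 / k') *\<^sub>R x)" for x
  proof (cases "k < norm x")
    case True
    then show ?thesis
      using C2_jet_support_trace[OF \<phi> supp True] B(2) \<rho>_nonneg by simp
  next
    case False
    then have "norm x / k' \<le> 1 / 2"
      using k' by (simp add: field_simps)
    then have "(norm x / k')\<^sup>2 \<le> (1 / 2)\<^sup>2"
      using k' by (intro power_mono) auto
    moreover have "(norm x / k')\<^sup>2 = ((1 / k') *\<^sub>R x) \<bullet> ((1 / k') *\<^sub>R x)"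
      by (simp add: power_divide power2_norm_eq_inner power2_eq_square[of k'])
    moreover have "(1 / 2)\<^sup>2 \<le> (1 / 2 :: real)"
      by (simp add: power2_eq_square)
    ultimately have "1 / 2 \<le> 1 - ((1 / k') *\<^sub>R x) \<bullet> ((1 / k') *\<^sub>R x)"
      by linarith
    then have "1 / 2 \<le> \<rho> ((1 / k') *\<^sub>R x)"
      unfolding \<rho>_def by (rule max.coboundedI2)
    then have "2 * B * (1 / 2) \<le> 2 * B * \<rho> ((1 / k') *\<^sub>R x)"
      using B(2) by (intro mult_left_mono) auto
    with B(1)[of x] show ?thesis by simp
  qed
  define m where "m R = (LINT x|lborel. R * W (u (R *\<^sub>R x)) * \<phi> x)" for R
  have m_le: "\<bar>m b - m a\<bar> \<le> B * (A b - A a)" if ab: "0 < a" "a \<le> b" for a b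
  proof -
    have tr_int: "integrable lborel (\<lambda>x. V R x * trace_op (L x))" for R
      by (rule integrable_compact_support[where r = k])
         (auto intro!: continuous_on_mult V_cont C2_jet_continuous_trace[OF \<phi>] simp: C2_jet_support_trace[OF \<phi> supp])
    have "2 * (m b - m a) = (LINT x|lborel. V b x * trace_op (L x) - V a x * trace_op (L x))"
      using by_parts[OF _ \<phi> supp, of a] by_parts[OF _ \<phi> supp, of b] ab
      by (simp add: m_def Bochner_Integration.integral_diff[OF tr_int tr_int])
    then have "\<bar>2 * (m b - m a)\<bar> = \<bar>LINT x|lborel. V b x * trace_op (L x) - V a x * trace_op (L x)\<bar>"
      by simp
    also have "\<dots> \<le> (LINT x|lborel. \<bar>V b x * trace_op (L x) - V a x * trace_op (L x)\<bar>)"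
      by (rule integral_abs_bound)
    also have "\<dots> \<le> (LINT x|lborel. 2 * B * (V b x * \<rho> ((1 / k') *\<^sub>R x) - V a x * \<rho> ((1 / k') *\<^sub>R x)))"
    proof (rule integral_mono)
      fix x
      have "\<bar>V b x * trace_op (L x) - V a x * trace_op (L x)\<bar> = (V b x - V a x) * \<bar>trace_op (L x)\<bar>"
        using V_mono[OF ab, of x] by (simp add: abs_mult flip: left_diff_distrib)
      also have "\<dots> \<le> (V b x - V a x) * (2 * B * \<rho> ((1 / k') *\<^sub>R x))"
        using V_mono[OF ab, of x] by (intro mult_left_mono trace_le) auto
      finally show "\<bar>V b x * trace_op (L x) - V a x * trace_op (L x)\<bar> \<le>
          2 * B * (V b x * \<rho> ((1 / k') *\<^sub>R x) - V a x * \<rho> ((1 / k') *\<^sub>R x))"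
        by (simp add: algebra_simps)
    qed (intro integrable_abs integrable_mult_right Bochner_Integration.integrable_diff tr_int A_int)+
    also have "\<dots> = 2 * B * (A b - A a)"
      by (simp add: A_def Bochner_Integration.integral_diff[OF A_int A_int])
    finally show ?thesis
      by simp
  qed
  have m_abs_le: "\<bar>m b - m a\<bar> \<le> B * \<bar>A b - A a\<bar>" if "0 < a" "0 < b" for a b
  proof (cases "a \<le> b")
    case True
    with m_le[of a b] A_mono[of a b] that show ?thesis by simp
  next
    case False
    with m_le[of b a] A_mono[of b a] that show ?thesis by (simp add: abs_minus_commute)
  qed
  define S where "S = (SUP R\<in>{0<..}. A R)"
  have bdd: "bdd_above (A ` {0<..})"
    using A_le by (auto intro!: bdd_aboveI2)
  have A_lim: "(A \<longlongrightarrow> S) at_top"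
  proof (rule order_tendstoI)
    fix a assume "a < S"
    then obtain R0 where R0: "R0 > 0" "a < A R0"
      unfolding S_def using less_cSUP_iff[OF _ bdd] by auto
    show "\<forall>\<^sub>F R in at_top. a < A R"
      using eventually_ge_at_top[of R0] by eventually_elim (use R0 A_mono in \<open>force intro: less_le_trans\<close>)
  next
    fix a assume a: "S < a"
    show "\<forall>\<^sub>F R in at_top. A R < a"
      using eventually_gt_at_top[of 0]
    proof eventually_elim
      case (elim R)
      then have "A R \<le> S"
        unfolding S_def by (intro cSUP_upper bdd) simp
      with a show ?case by simp
    qed
  qed
  have A_diff: "(\<lambda>j. B * \<bar>A (r j) - A (s j)\<bar>) \<longlonglongrightarrow> B * \<bar>S - S\<bar>"
    by (intro tendsto_intros filterlim_compose[OF A_lim] r(1) s(1))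
  have "(\<lambda>j. m (r j) - m (s j)) \<longlonglongrightarrow> 0"
  proof (rule Lim_null_comparison)
    have "\<forall>\<^sub>F j in sequentially. 0 < r j" "\<forall>\<^sub>F j in sequentially. 0 < s j"
      using r(1) s(1) eventually_gt_at_top by (auto simp: filterlim_iff)
    then show "\<forall>\<^sub>F j in sequentially. norm (m (r j) - m (s j)) \<le> B * \<bar>A (r j) - A (s j)\<bar>"
      by eventually_elim (simp add: m_abs_le)
    show "(\<lambda>j. B * \<bar>A (r j) - A (s j)\<bar>) \<longlonglongrightarrow> 0"
      using A_diff by simp
  qed
  moreover have "(\<lambda>j. m (r j) - m (s j)) \<longlonglongrightarrow> l - l'"
    using tendsto_diff[OF r(2) s(2)] by (simp add: m_def)
  ultimately show ?thesis
    using LIMSEQ_unique by fastforce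
qed

end

lemma potential_measure_integral:
  assumes \<phi>: "continuous_on UNIV \<phi>" and Wu: "continuous_on UNIV (\<lambda>x. W (u x))" and W: "\<And>t. 0 \<le> W t" and "\<epsilon> > 0"
  shows "(LINT x|potential_measure W u \<epsilon>. \<phi> x) = (LINT x|lborel. inverse \<epsilon> * W (u (inverse \<epsilon> *\<^sub>R x)) * \<phi> x)"
proof -
  have cont: "continuous_on UNIV (\<lambda>x. 1 / \<epsilon> * W (rescale \<epsilon> u x))"
    unfolding rescale_def by (intro continuous_on_mult continuous_on_const continuous_on_compose2[OF Wu] continuous_intros) auto
  show ?thesis
    unfolding potential_measure_def
    using borel_measurable_continuous_onI[OF \<phi>] borel_measurable_continuous_onI[OF cont] W \<open>\<epsilon> > 0\<close>
    by (subst integral_density) (auto simp: rescale_def inverse_eq_divide)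
qed

context allen_cahn_plane
begin

lemma blow_down_test_integral_unique:
  assumes W_nonneg: "\<And>t. 0 \<le> W t" and modica: "\<And>x. G x \<bullet> G x \<le> 2 * W (u x)"
    and energy: "\<And>R. R > 0 \<Longrightarrow> (LINT x:ball 0 R|lborel. W (u x)) \<le> C * R"
    and lim: "blowing_down_limit W u \<epsilon> \<mu>1 \<mu>2" and lim': "blowing_down_limit W u \<epsilon>' \<mu>1' \<mu>2'"
    and \<phi>: "C2_jet \<phi> K L" and supp: "\<And>x. k < norm x \<Longrightarrow> \<phi> x = 0"
  shows "(LINT x|\<mu>2. \<phi> x) = (LINT x|\<mu>2'. \<phi> x)"
proof -
  have test: "filterlim (\<lambda>j. inverse (\<epsilon> j)) at_top sequentially \<and>
      (\<lambda>j. LINT x|lborel. inverse (\<epsilon> j) * W (u (inverse (\<epsilon> j) *\<^sub>R x)) * \<phi> x) \<longlonglongrightarrow> (LINT x|\<mu>2. \<phi> x)"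
    if "blowing_down_limit W u \<epsilon> \<mu>1 \<mu>2" for \<epsilon> \<mu>1 \<mu>2
  proof -
    have \<epsilon>: "\<And>j. \<epsilon> j > 0" "\<epsilon> \<longlonglongrightarrow> 0" and weak: "radon_weak_conv (\<lambda>j. potential_measure W u (\<epsilon> j)) \<mu>2"
      using that by (auto simp: blowing_down_limit_def)
    have cont: "continuous_on UNIV \<phi>"
      by (rule C2_jet_continuous(1)[OF \<phi>])
    have "\<exists>K. compact K \<and> (\<forall>x. x \<notin> K \<longrightarrow> \<phi> x = 0)"
      by (rule exI[of _ "cball 0 k"]) (simp add: supp)
    with weak cont have "(\<lambda>j. LINT x|potential_measure W u (\<epsilon> j). \<phi> x) \<longlonglongrightarrow> (LINT x|\<mu>2. \<phi> x)"
      unfolding radon_weak_conv_def by blast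
    then have "(\<lambda>j. LINT x|lborel. inverse (\<epsilon> j) * W (u (inverse (\<epsilon> j) *\<^sub>R x)) * \<phi> x) \<longlonglongrightarrow> (LINT x|\<mu>2. \<phi> x)"
      unfolding potential_measure_integral[OF cont Wu_cont(1) W_nonneg \<epsilon>(1)] .
    moreover have "filterlim (\<lambda>j. inverse (\<epsilon> j)) at_top sequentially"
      by (rule filterlim_inverse_at_top[OF \<epsilon>(2)]) (simp add: \<epsilon>(1))
    ultimately show ?thesis
      by simp
  qed
  show ?thesis
    using test[OF lim] test[OF lim'] blow_down_limit_unique[OF W_nonneg modica energy \<phi> supp] by blast
qed

end

section \<open>Recovering rays and multiplicities from the measure\<close>

text \<open>The bump is continuous and positive exactly on the ball, so its integral detects whether the ball is
  charged.\<close>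
lemma radon_bump_integrable:
  fixes M :: "'a::euclidean_space measure"
  assumes M: "radon_measure M" and r: "r > 0"
  shows "integrable M (bump (r\<^sup>2) x)"
    and "0 < (LINT y|M. bump (r\<^sup>2) x y) \<longleftrightarrow> 0 < emeasure M (ball x r)"
proof -
  have sets: "sets M = sets borel" and fin: "emeasure M (cball x r) < \<infinity>"
    using M by (auto simp: radon_measure_def)
  obtain K L where jet: "C2_jet (bump (r\<^sup>2) x) K L"
    by (rule bump_C2)
  have cont: "continuous_on UNIV (bump (r\<^sup>2) x)"
    by (rule C2_jet_continuous(1)[OF jet])
  have zero: "bump (r\<^sup>2) x y = 0" if "y \<notin> ball x r" for y
    using bump_pos_iff[OF r, of x y] that bump_nonneg[of "r\<^sup>2" x y] by auto
  have meas[measurable]: "bump (r\<^sup>2) x \<in> borel_measurable M"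
    using borel_measurable_continuous_onI[OF cont] by (simp add: measurable_cong_sets[OF sets refl])
  obtain B where B: "\<And>y. y \<in> cball x r \<Longrightarrow> norm (bump (r\<^sup>2) x y) \<le> B"
    using compact_imp_bounded[OF compact_continuous_image[OF continuous_on_subset[OF cont subset_UNIV] compact_cball[of x r]]]
    by (metis bounded_iff imageI)
  show int: "integrable M (bump (r\<^sup>2) x)"
    by (rule integrableI_bounded_set[where A = "cball x r" and B = B])
       (use sets fin B zero in \<open>auto simp: less_top\<close>)
  have "(LINT y|M. bump (r\<^sup>2) x y) = 0 \<longleftrightarrow> (AE y in M. bump (r\<^sup>2) x y = 0)"
    by (rule integral_nonneg_eq_0_iff_AE[OF int]) (simp add: bump_nonneg)
  also have "\<dots> \<longleftrightarrow> (AE y in M. y \<notin> ball x r)"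
    using bump_pos_iff[OF r, of x] zero by (intro AE_cong) force
  also have "\<dots> \<longleftrightarrow> emeasure M (ball x r) = 0"
    by (subst AE_iff_measurable[where N = "ball x r"]) (use sets sets_eq_imp_space_eq[OF sets] in auto)
  finally have "(LINT y|M. bump (r\<^sup>2) x y) = 0 \<longleftrightarrow> emeasure M (ball x r) = 0" .
  moreover have "0 \<le> (LINT y|M. bump (r\<^sup>2) x y)"
    by (rule integral_nonneg_AE) (simp add: bump_nonneg)
  ultimately show "0 < (LINT y|M. bump (r\<^sup>2) x y) \<longleftrightarrow> 0 < emeasure M (ball x r)"
    by (metis less_le not_gr_zero)
qed

text \<open>After restriction to the ball the two multiples coincide as measures.\<close>
lemma bump_integral_proportional:
  fixes M M' :: "'a::euclidean_space measure"
  assumes M: "radon_measure M" "radon_measure M'" and r: "r > 0"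
    and eq: "\<And>A. A \<in> sets borel \<Longrightarrow> A \<subseteq> ball x r \<Longrightarrow> of_nat m * emeasure M A = of_nat m' * emeasure M' A"
  shows "real m * (LINT y|M. bump (r\<^sup>2) x y) = real m' * (LINT y|M'. bump (r\<^sup>2) x y)"
proof -
  have sets: "sets M = sets borel" "sets M' = sets borel"
    using M by (auto simp: radon_measure_def)
  define \<nu> where "\<nu> M k = density (scale_measure (of_nat k) M) (indicator (ball x r))" for M :: "'a measure" and k
  have \<nu>: "emeasure (\<nu> M k) A = of_nat k * emeasure M (ball x r \<inter> A)" if "sets M = sets borel" "A \<in> sets borel"
    for M k A
    unfolding \<nu>_def using that by (subst emeasure_restricted) auto
  have \<nu>_eq: "\<nu> M m = \<nu> M' m'"
  proof (rule measure_eqI)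
    show "sets (\<nu> M m) = sets (\<nu> M' m')"
      by (simp add: \<nu>_def sets)
    fix A assume "A \<in> sets (\<nu> M m)"
    then have A: "A \<in> sets borel"
      by (simp add: \<nu>_def sets)
    then show "emeasure (\<nu> M m) A = emeasure (\<nu> M' m') A"
      using eq[of "ball x r \<inter> A"] by (simp add: \<nu>[OF sets(1) A] \<nu>[OF sets(2) A])
  qed
  have int: "(\<integral>\<^sup>+ y. ennreal (bump (r\<^sup>2) x y) \<partial>\<nu> M k) = ennreal (real k * (LINT y|M. bump (r\<^sup>2) x y))"
    if M: "radon_measure M" for M k
  proof -
    have sets: "sets M = sets borel"
      using M by (simp add: radon_measure_def)
    obtain K L where jet: "C2_jet (bump (r\<^sup>2) x) K L"
      by (rule bump_C2)
    have meas: "bump (r\<^sup>2) x \<in> borel_measurable M"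
      using borel_measurable_continuous_onI[OF C2_jet_continuous(1)[OF jet]] by (simp add: measurable_cong_sets[OF sets refl])
    have ind: "indicator (ball x r) y * ennreal (bump (r\<^sup>2) x y) = ennreal (bump (r\<^sup>2) x y)" for y
      using bump_pos_iff[OF r, of x y] bump_nonneg[of "r\<^sup>2" x y] by (auto simp: indicator_def)
    have "(\<integral>\<^sup>+ y. ennreal (bump (r\<^sup>2) x y) \<partial>\<nu> M k) = (\<integral>\<^sup>+ y. ennreal (bump (r\<^sup>2) x y) \<partial>scale_measure (of_nat k) M)"
      unfolding \<nu>_def
    proof (subst nn_integral_density)
      show "indicator (ball x r) \<in> borel_measurable (scale_measure (of_nat k) M)"
        by (rule borel_measurable_indicator) (simp add: sets)
    qed (use meas in \<open>simp_all add: ind\<close>)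
    also have "\<dots> = of_nat k * (\<integral>\<^sup>+ y. ennreal (bump (r\<^sup>2) x y) \<partial>M)"
      using meas by (intro nn_integral_scale_measure) auto
    also have "\<dots> = of_nat k * ennreal (LINT y|M. bump (r\<^sup>2) x y)"
      by (subst nn_integral_eq_integral[OF radon_bump_integrable(1)[OF M r]]) (auto simp: bump_nonneg)
    finally show ?thesis
      by (simp add: ennreal_mult' ennreal_of_nat_eq_real_of_nat)
  qed
  have "ennreal (real m * (LINT y|M. bump (r\<^sup>2) x y)) = ennreal (real m' * (LINT y|M'. bump (r\<^sup>2) x y))"
    using int[OF M(1), of m] int[OF M(2), of m'] \<nu>_eq by simp
  then show ?thesis
    by (subst (asm) ennreal_inj) (auto intro!: mult_nonneg_nonneg integral_nonneg_AE simp: bump_nonneg)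
qed

lemma hausdorff1_empty: "hausdorff1 ({} :: 'a::metric_space set) = 0"
proof -
  have "hausdorff1_pre \<delta> ({} :: 'a set) = 0" if "\<delta> > 0" for \<delta>
  proof -
    have "hausdorff1_pre \<delta> ({} :: 'a set) \<le> (\<Sum>j::nat. ennreal (diameter ({} :: 'a set)))"
      unfolding hausdorff1_pre_def using that by (intro INF_lower) auto
    then show ?thesis by simp
  qed
  then show ?thesis
    unfolding hausdorff1_def by (intro antisym SUP_least) auto
qed

lemma ray_unit:
  fixes e :: "'a::real_inner"
  assumes "norm e = 1"
  shows "ray e = {x. x = (x \<bullet> e) *\<^sub>R e \<and> 0 \<le> x \<bullet> e}"
    and "x \<in> ray e \<Longrightarrow> norm x = 1 \<Longrightarrow> x = e"
proof -
  have ee: "e \<bullet> e = 1"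
    using assms by (simp flip: power2_norm_eq_inner)
  then show "ray e = {x. x = (x \<bullet> e) *\<^sub>R e \<and> 0 \<le> x \<bullet> e}"
    by (auto simp: ray_def)
  show "x \<in> ray e \<Longrightarrow> norm x = 1 \<Longrightarrow> x = e"
    using assms by (auto simp: ray_def)
qed

lemma closed_ray:
  fixes e :: "'a::euclidean_space"
  assumes "norm e = 1"
  shows "closed (ray e)"
  unfolding ray_unit(1)[OF assms]
  by (intro closed_Collect_conj closed_Collect_eq closed_Collect_le continuous_intros)

lemma unit_vectors_of_rays:
  fixes e :: "nat \<Rightarrow> 'a::real_inner"
  assumes "\<And>i. i \<in> I \<Longrightarrow> norm (e i) = 1"
  shows "{x \<in> (\<Union>i\<in>I. ray (e i)). norm x = 1} = e ` I"
proof -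
  have "e i \<in> ray (e i)" for i
    unfolding ray_def by (rule CollectI, rule exI[of _ 1]) simp
  then show ?thesis
    using assms ray_unit(2)[OF assms] by fastforce
qed

text \<open>The energy measure is twice \<open>\<mu>2\<close>.\<close>
lemma blowing_down_data_support:
  assumes "sets \<mu>1 = sets borel" "sets \<mu>2 = sets borel"
    and "\<forall>A\<in>sets borel. emeasure \<mu>1 A = 2 * emeasure \<mu>2 A"
  shows "measure_support (energy_measure \<mu>1 \<mu>2) = {x :: real^2. \<forall>r>0. 0 < emeasure \<mu>2 (ball x r)}"
  unfolding measure_support_def using assms by (simp add: emeasure_energy_measure zero_less_iff_neq_zero)

lemma blowing_down_dataE:
  assumes "blowing_down_data W g u \<epsilon> \<Sigma> N e n"
  obtains \<mu>1 \<mu>2 where "blowing_down_limit W u \<epsilon> \<mu>1 \<mu>2"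
    "\<Sigma> = measure_support (energy_measure \<mu>1 \<mu>2)" "\<Sigma> = (\<Union>i\<in>{1..N}. ray (e i))"
    "\<forall>i\<in>{1..N}. norm (e i) = 1" "inj_on e {1..N}"
    "\<forall>A\<in>sets borel. emeasure \<mu>1 A = 2 * emeasure \<mu>2 A"
    "\<forall>A\<in>sets borel. emeasure \<mu>1 A =
       ennreal (surface_tension W g) * (\<Sum>i=1..N. of_nat (n i) * hausdorff1 (A \<inter> ray (e i)))"
  using assms unfolding blowing_down_data_def
  by (elim exE conjE) (rule that; assumption)

theorem theorem1p2:
  fixes W g :: "real \<Rightarrow> real" and u :: "real^2 \<Rightarrow> real"
    and \<epsilon> \<epsilon>' :: "nat \<Rightarrow> real"
    and \<Sigma> \<Sigma>' :: "(real^2) set" and N N' :: nat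
    and e e' :: "nat \<Rightarrow> real^2" and n n' :: "nat \<Rightarrow> nat"
  assumes "double_well W" and "is_profile W g"
    and "C_k 2 u" and "\<forall>x. laplacian u x = deriv W (u x)"
    and "\<exists>C>0. \<forall>R>0. (LINT x:ball 0 R|lborel. (norm (gradient u x))\<^sup>2 / 2 + W (u x)) \<le> C * R"
    and "blowing_down_data W g u \<epsilon> \<Sigma> N e n"
    and "blowing_down_data W g u \<epsilon>' \<Sigma>' N' e' n'"
  shows "\<Sigma> = \<Sigma>' \<and> N = N' \<and>
    (\<exists>\<pi>. bij_betw \<pi> {1..N} {1..N'} \<and> (\<forall>i\<in>{1..N}. e i = e' (\<pi> i) \<and> n i = n' (\<pi> i)))"
proof -
  have C3: "C_k 3 W" and W_nonneg: "0 \<le> W t" and W_zero: "W 1 = 0" "W (-1) = 0" for t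
    using assms(1) by (auto simp: double_well_def)
  obtain \<gamma> where \<gamma>: "-1 < \<gamma>" "\<gamma> < 1" "\<And>t. -1 < t \<Longrightarrow> t < \<gamma> \<Longrightarrow> 0 < deriv W t" "\<And>t. \<gamma> < t \<Longrightarrow> t < 1 \<Longrightarrow> deriv W t < 0"
    using assms(1) by (auto simp: double_well_def)
  obtain \<alpha> \<kappa> where \<kappa>: "\<alpha> < 1" "\<kappa> > 0" "\<And>t. \<alpha> \<le> \<bar>t\<bar> \<Longrightarrow> \<kappa> \<le> deriv (deriv W) t"
    using assms(1) by (auto simp: double_well_def)
  define W' W'' where "W' = deriv W" and "W'' = deriv W'"
  have W: "(W has_real_derivative W' t) (at t)" "(W' has_real_derivative W'' t) (at t)" "continuous_on UNIV W''" for t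
  proof -
    have "C_k (Suc (Suc (Suc 0))) W"
      using C3 by (simp add: numeral_3_eq_3)
    note 1 = C_k_Suc_real[OF this]
    note 2 = C_k_Suc_real[OF 1(2)]
    note 3 = C_k_Suc_real[OF 2(2)]
    show "(W has_real_derivative W' t) (at t)" "(W' has_real_derivative W'' t) (at t)" "continuous_on UNIV W''"
      using 1(1) 2(1) 3(1) unfolding W'_def W''_def
      by (auto intro!: continuous_at_imp_continuous_on intro: DERIV_isCont)
  qed
  obtain H where H: "C2_jet u (gradient u) H" "\<And>x. trace_op (H x) = laplacian u x"
    using C_k_2_imp_jet[OF assms(3)] by blast
  interpret allen_cahn_plane W W' W'' u "gradient u" H
    by unfold_locales (use H assms(4) W in \<open>auto simp: W'_def\<close>)
  \<comment> \<open>the lower bound \<open>-1 \<le> u\<close> is the upper bound for \<open>-u\<close>, which solves the equation with the reflected potential\<close>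
  interpret neg: allen_cahn "\<lambda>t. W (- t)" "\<lambda>t. - W' (- t)" "\<lambda>t. W'' (- t)" "\<lambda>x. - u x" "\<lambda>x. - gradient u x" "\<lambda>x v. - H x v"
  proof
    show "C2_jet (\<lambda>x. - u x) (\<lambda>x. - gradient u x) (\<lambda>x v. - H x v)"
      using C2_jet_cmult[OF u, of "-1"] by simp
    show "trace_op (\<lambda>v. - H x v) = - W' (- (- u x))" for x
      using trace_op_scaleR[of "-1" "H x"] by (simp add: eq)
    have m: "((\<lambda>t. - t) has_real_derivative -1) (at t)" for t :: real
      by (auto intro!: derivative_eq_intros)
    show "((\<lambda>t. W (- t)) has_real_derivative - W' (- t)) (at t)" for t
      using DERIV_chain2[OF W(1) m] by simp
    show "((\<lambda>t. - W' (- t)) has_real_derivative W'' (- t)) (at t)" for t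
      using DERIV_minus[OF DERIV_chain2[OF W(2) m]] by simp
    show "continuous_on UNIV (\<lambda>t. W'' (- t))"
      by (intro continuous_on_compose2[OF W(3)] continuous_intros) auto
  qed
  obtain C where C: "\<And>R. R > 0 \<Longrightarrow> (LINT x:ball 0 R|lborel. (norm (gradient u x))\<^sup>2 / 2 + W (u x)) \<le> C * R"
    using assms(5) by blast
  have energy: "(LINT x:ball 0 R|lborel. W (u x)) \<le> C * R" if R: "R > 0" for R
  proof -
    have "(LINT x:ball 0 R|lborel. W (u x)) \<le> (LINT x:ball 0 R|lborel. (norm (gradient u x))\<^sup>2 / 2 + W (u x))"
      by (intro set_integral_mono set_integrable_ball continuous_intros Wu_cont C2_jet_continuous[OF u]) auto
    with C[OF R] show ?thesis by linarith
  qed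
  have "\<bar>u x\<bar> \<le> 1" for x
  proof -
    have "u x \<le> 1"
      by (rule solution_le_1[OF W_nonneg W_zero(1) \<kappa>(2) _ energy]) (use \<kappa> in \<open>auto simp: W'_def W''_def\<close>)
    moreover have "- u x \<le> 1"
      by (rule neg.solution_le_1[OF W_nonneg _ \<kappa>(2)]) (use \<kappa> W_zero energy in \<open>auto simp: W'_def W''_def\<close>)
    ultimately show ?thesis by linarith
  qed
  moreover have "0 \<le> W' t * (\<gamma> - t)" if t: "\<bar>t\<bar> \<le> 1" for t
  proof -
    have ends: "W' 1 = 0" "W' (-1) = 0"
      using DERIV_local_min[OF W(1) zero_less_one] W_nonneg W_zero by auto
    consider "t = -1" | "t = 1" | "t = \<gamma>" | "-1 < t" "t < \<gamma>" | "\<gamma> < t" "t < 1"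
      using t by linarith
    then show ?thesis
    proof cases
      case 4
      then show ?thesis
        using \<gamma>(3)[of t] unfolding W'_def by (intro mult_nonneg_nonneg) simp_all
    next
      case 5
      then show ?thesis
        using \<gamma>(4)[of t] unfolding W'_def by (intro mult_nonpos_nonpos) simp_all
    qed (simp_all add: ends)
  qed
  ultimately have modica: "gradient u x \<bullet> gradient u x \<le> 2 * W (u x)" for x
    using \<gamma>(1,2) by (intro modica[of \<gamma>] W_nonneg) auto

  obtain \<mu>1 \<mu>2 where lim: "blowing_down_limit W u \<epsilon> \<mu>1 \<mu>2"
    and \<Sigma>: "\<Sigma> = measure_support (energy_measure \<mu>1 \<mu>2)" "\<Sigma> = (\<Union>i\<in>{1..N}. ray (e i))"
    and e: "\<forall>i\<in>{1..N}. norm (e i) = 1" "inj_on e {1..N}"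
    and \<mu>: "\<forall>A\<in>sets borel. emeasure \<mu>1 A = 2 * emeasure \<mu>2 A"
      "\<forall>A\<in>sets borel. emeasure \<mu>1 A =
           ennreal (surface_tension W g) * (\<Sum>i=1..N. of_nat (n i) * hausdorff1 (A \<inter> ray (e i)))"
    by (rule blowing_down_dataE[OF assms(6)]) (rule that; assumption)
  obtain \<mu>1' \<mu>2' where lim': "blowing_down_limit W u \<epsilon>' \<mu>1' \<mu>2'"
    and \<Sigma>': "\<Sigma>' = measure_support (energy_measure \<mu>1' \<mu>2')" "\<Sigma>' = (\<Union>i\<in>{1..N'}. ray (e' i))"
    and e': "\<forall>i\<in>{1..N'}. norm (e' i) = 1" "inj_on e' {1..N'}"
    and \<mu>': "\<forall>A\<in>sets borel. emeasure \<mu>1' A = 2 * emeasure \<mu>2' A"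
      "\<forall>A\<in>sets borel. emeasure \<mu>1' A =
           ennreal (surface_tension W g) * (\<Sum>i=1..N'. of_nat (n' i) * hausdorff1 (A \<inter> ray (e' i)))"
    by (rule blowing_down_dataE[OF assms(7)]) (rule that; assumption)
  have radon: "radon_measure \<mu>1" "radon_measure \<mu>2" "radon_measure \<mu>1'" "radon_measure \<mu>2'"
    using lim lim' by (auto simp: blowing_down_limit_def)
  then have sets: "sets \<mu>1 = sets borel" "sets \<mu>2 = sets borel" "sets \<mu>1' = sets borel" "sets \<mu>2' = sets borel"
    by (auto simp: radon_measure_def)
  have same: "(LINT y|\<mu>2. bump (r\<^sup>2) x y) = (LINT y|\<mu>2'. bump (r\<^sup>2) x y)" if r: "r > 0" for r x
  proof -
    obtain K L where jet: "C2_jet (bump (r\<^sup>2) x) K L"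
      by (rule bump_C2)
    have supp: "bump (r\<^sup>2) x y = 0" if "norm x + r < norm y" for y
    proof -
      have "y \<notin> ball x r"
        using that norm_triangle_ineq2[of y x] by (simp add: dist_norm norm_minus_commute)
      then show ?thesis
        using bump_pos_iff[OF r, of x y] bump_nonneg[of "r\<^sup>2" x y] by auto
    qed
    show ?thesis
      by (rule blow_down_test_integral_unique[OF W_nonneg modica energy lim lim' jet supp])
  qed
  \<comment> \<open>equal test integrals of bumps mean that the same balls are charged\<close>
  have \<Sigma>_eq: "\<Sigma> = \<Sigma>'"
    unfolding \<Sigma>(1) \<Sigma>'(1) blowing_down_data_support[OF sets(1,2) \<mu>(1)] blowing_down_data_support[OF sets(3,4) \<mu>'(1)]
    using radon_bump_integrable(2)[OF radon(2)] radon_bump_integrable(2)[OF radon(4)] same by auto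
  have img: "e ` {1..N} = e' ` {1..N'}"
  proof -
    have "{x \<in> \<Sigma>. norm x = 1} = e ` {1..N}"
      unfolding \<Sigma>(2) using e(1) by (intro unit_vectors_of_rays) blast
    moreover have "{x \<in> \<Sigma>'. norm x = 1} = e' ` {1..N'}"
      unfolding \<Sigma>'(2) using e'(1) by (intro unit_vectors_of_rays) blast
    ultimately show ?thesis
      by (simp only: \<Sigma>_eq)
  qed
  have N: "N = N'"
    using card_image[OF e(2)] card_image[OF e'(2)] img by simp
  define \<pi> where "\<pi> = inv_into {1..N'} e' \<circ> e"
  have \<pi>: "bij_betw \<pi> {1..N} {1..N'}"
    unfolding \<pi>_def
    by (rule bij_betw_trans[OF inj_on_imp_bij_betw[OF e(2)]]) (unfold img, rule bij_betw_inv_into[OF inj_on_imp_bij_betw[OF e'(2)]])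
  have e_\<pi>: "e i = e' (\<pi> i)" if "i \<in> {1..N}" for i
  proof -
    have "e i \<in> e' ` {1..N'}"
      unfolding img[symmetric] using that by (rule imageI)
    then show ?thesis
      by (simp only: \<pi>_def o_apply f_inv_into_f)
  qed
  have "n i = n' (\<pi> i)" if i: "i \<in> {1..N}" for i
  proof -
    have \<pi>i: "\<pi> i \<in> {1..N'}"
      using \<pi> i by (auto simp: bij_betw_def)
    \<comment> \<open>near \<open>e i\<close> only one ray is present, so both measures are explicit multiples of the same measure\<close>
    define F where "F = (\<Union>j\<in>{1..N} - {i}. ray (e j))"
    have "closed F"
      unfolding F_def
    proof (intro closed_UN ballI)
      show "closed (ray (e j))" if "j \<in> {1..N} - {i}" for j
        using e(1) that by (intro closed_ray) blast
    qed simp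
    moreover have "e i \<notin> F"
    proof
      assume "e i \<in> F"
      then obtain j where j: "j \<in> {1..N}" "j \<noteq> i" "e i \<in> ray (e j)"
        unfolding F_def by blast
      then have "e i = e j"
        using ray_unit(2)[of "e j" "e i"] e(1) i by blast
      with e(2) i j show False
        unfolding inj_on_def by blast
    qed
    ultimately obtain r where r: "r > 0" "ball (e i) r \<inter> F = {}"
      by (metis Compl_iff disjoint_eq_subset_Compl inf_commute open_Compl open_contains_ball)
    have local: "(\<Sum>j\<in>I. of_nat (k j) * hausdorff1 (A \<inter> ray (f j))) = of_nat (k a) * hausdorff1 (A \<inter> ray (f a))"
      if "finite I" "a \<in> I" "f a = e i" "inj_on f I" "f ` I = e ` {1..N}" "A \<subseteq> ball (e i) r"
      for I a and f :: "nat \<Rightarrow> real^2" and k :: "nat \<Rightarrow> nat" and A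
    proof -
      have "hausdorff1 (A \<inter> ray (f j)) = 0" if j: "j \<in> I - {a}" for j
      proof -
        obtain l where l: "l \<in> {1..N}" "f j = e l"
          using j \<open>f ` I = e ` {1..N}\<close> by (metis DiffD1 imageE imageI)
        have "l \<noteq> i"
          using l j \<open>a \<in> I\<close> \<open>f a = e i\<close> \<open>inj_on f I\<close> by (metis DiffD1 DiffD2 inj_onD singletonI)
        then have "ray (f j) \<subseteq> F"
          using l by (auto simp: F_def)
        with r(2) \<open>A \<subseteq> ball (e i) r\<close> have "A \<inter> ray (f j) = {}"
          by blast
        then show ?thesis by (simp add: hausdorff1_empty)
      qed
      then have "(\<Sum>j\<in>I - {a}. of_nat (k j) * hausdorff1 (A \<inter> ray (f j))) = 0"
        by (intro sum.neutral) auto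
      then show ?thesis
        using sum.remove[OF \<open>finite I\<close> \<open>a \<in> I\<close>, of "\<lambda>j. of_nat (k j) * hausdorff1 (A \<inter> ray (f j))"] by simp
    qed
    have "of_nat (n' (\<pi> i)) * emeasure \<mu>2 A = of_nat (n i) * emeasure \<mu>2' A"
      if A: "A \<in> sets borel" "A \<subseteq> ball (e i) r" for A
    proof -
      have "2 * emeasure \<mu>2 A = ennreal (surface_tension W g) * (of_nat (n i) * hausdorff1 (A \<inter> ray (e i)))"
        using \<mu> A local[of "{1..N}" i e A n] i e(2) by auto
      moreover have "2 * emeasure \<mu>2' A = ennreal (surface_tension W g) * (of_nat (n' (\<pi> i)) * hausdorff1 (A \<inter> ray (e i)))"
        using \<mu>' A local[of "{1..N'}" "\<pi> i" e' A n'] \<pi>i e'(2) e_\<pi>[OF i] img by auto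
      ultimately have "2 * (of_nat (n' (\<pi> i)) * emeasure \<mu>2 A) = 2 * (of_nat (n i) * emeasure \<mu>2' A)"
        by (metis mult.left_commute)
      then show ?thesis
        by (simp add: ennreal_mult_cancel_left)
    qed
    then have "real (n' (\<pi> i)) * (LINT y|\<mu>2. bump (r\<^sup>2) (e i) y) = real (n i) * (LINT y|\<mu>2'. bump (r\<^sup>2) (e i) y)"
      by (rule bump_integral_proportional[OF radon(2,4) r(1)])
    moreover have "0 < (LINT y|\<mu>2. bump (r\<^sup>2) (e i) y)"
    proof -
      have "e i \<in> \<Sigma>"
        using i unit_vectors_of_rays[of "{1..N}" e] e(1) \<Sigma>(2) by blast
      then have "0 < emeasure \<mu>2 (ball (e i) r)"
        unfolding \<Sigma>(1) blowing_down_data_support[OF sets(1,2) \<mu>(1)] using r(1) by simp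
      then show ?thesis
        by (simp add: radon_bump_integrable(2)[OF radon(2) r(1)])
    qed
    ultimately show ?thesis
      using same[OF r(1)] by simp
  qed
  with \<Sigma>_eq N \<pi> e_\<pi> show ?thesis
    by blast
qed

end
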